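(* Let $\{x_j\}_{j=1}^m$ be a sequence of points in the torus $\mathbb{T}^d=\mathbb{R}^d/\mathbb{Z}^d$, let $\Omega\subseteq\mathbb{T}^d$ be a measurable set with measure $\mu(\Omega)$, let $R>0$, and let $H_R(x)=4^{-1}\psi\left(2R\operatorname{dist}(x,\partial\Omega)\right)$, where $\psi$ is the function with fast decay at infinity defined in the context. Then $$\left|\mu(\Omega)-m^{-1}\sum_{j=1}^m\chi_\Omega(x_j)\right|\le\left|\widehat{H}_R(0)\right|+\sum_{0<|k|<R}\left(\left|\widehat{\chi}_\Omega(k)\right|+\left|\widehat{H}_R(k)\right|\right)\left|m^{-1}\sum_{j=1}^m\exp(2\pi ik\cdot x_j)\right|,$$ where the sum is over $k\in\mathbb{Z}^d$ with $0<|k|<R$.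
   Context: Definition of $\psi$: fix a smooth real valued radial function $m(\xi)$ on $\mathbb{R}^d$ with $m(\xi)=0$ for $|\xi|\ge1/2$ and $\int_{\mathbb{R}^d}m(\xi)^2d\xi=1$ (not to be confused with the number $m$ of points). Let $$K(x)=\int_{\mathbb{R}^d}(1+|\xi|^2)^{-(d+1)/2}\,(m\ast m)(\xi)\exp(2\pi i\xi\cdot x)\,d\xi,$$ which is a positive function of integral $1$ whose derivatives all have fast decay; let $I(t)=\int_{\{|x|\ge t\}}K(x)dx$, let $\gamma=\exp(2\pi)\left(\int_{\{|y|\le1\}}K(y)dy\right)^{-1}$, and set $\psi(t)=4\gamma I(t/2)$ for $t\ge0$. Thus $H_R(x)=\gamma I(R\operatorname{dist}(x,\partial\Omega))$. Fourier coefficients on the torus are $\widehat f(k)=\int_{\mathbb{T}^d}f(x)\exp(-2\pi ik\cdot x)dx$, $k\in\mathbb{Z}^d$, $\mu$ is Lebesgue measure, $\chi_\Omega$ is the characteristic function of $\Omega$. Standing convention: sets $\Omega$ in the torus are identified with periodic sets $\Omega=\Omega^\ast+\mathbb{Z}^d$ in $\mathbb{R}^d$, where $\Omega^\ast\subseteq\mathbb{R}^d$ satisfies, for some $\varepsilon>0$, $\operatorname{dist}(\Omega^\ast,\Omega^\ast+k)>\varepsilon$ for every $k\in\mathbb{Z}^d\setminus\{0\}$; the distance of $x$ from $\partial\Omega$ in $\mathbb{T}^d$ is the distance of $x$ from $\partial\Omega^\ast+\mathbb{Z}^d$ in $\mathbb{R}^d$ ($+\infty$ if the boundary is empty, with $\psi(+\infty)=0$).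 *)

theory Defs
  imports "HOL-Analysis.Analysis"
begin

fun C_k :: "nat \<Rightarrow> (real^'d \<Rightarrow> real) \<Rightarrow> bool" where
  "C_k 0 f = continuous_on UNIV f"
| "C_k (Suc n) f = ((\<forall>x. f differentiable (at x)) \<and>
     (\<forall>b\<in>Basis. C_k n (\<lambda>x. frechet_derivative f (at x) b)))"

definition smooth :: "(real^'d \<Rightarrow> real) \<Rightarrow> bool" where
  "smooth f \<longleftrightarrow> (\<forall>n. C_k n f)"

definition radial :: "(real^'d \<Rightarrow> real) \<Rightarrow> bool" where
  "radial f \<longleftrightarrow> (\<forall>x y. norm x = norm y \<longrightarrow> f x = f y)"

definition convolve :: "(real^'d \<Rightarrow> real) \<Rightarrow> (real^'d \<Rightarrow> real) \<Rightarrow> real^'d \<Rightarrow> real" where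
  "convolve f g \<xi> = (LINT \<eta>|lborel. f \<eta> * g (\<xi> - \<eta>))"

definition kernel_weight :: "(real^'d \<Rightarrow> real) \<Rightarrow> real^'d \<Rightarrow> real" where
  "kernel_weight \<phi> \<xi> =
     (1 + (norm \<xi>)\<^sup>2) powr (- (real CARD('d) + 1) / 2) * convolve \<phi> \<phi> \<xi>"

text \<open>
  In the next definitions \<open>\<phi>\<close> is the radial bump function. The kernel is the Fourier integral of
  an even real function, hence real; \<open>Re\<close> only gives it a real type, see \<open>bump_kernel_eq\<close> below.
\<close>

definition bump_kernel :: "(real^'d \<Rightarrow> real) \<Rightarrow> real^'d \<Rightarrow> real" where
  "bump_kernel \<phi> x =
     Re (LINT \<xi>|lborel. complex_of_real (kernel_weight \<phi> \<xi>) * exp (2 * pi * \<i> * (\<xi> \<bullet> x)))"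

lemma radial_minus: "radial f \<Longrightarrow> f (- x) = f x"
  unfolding radial_def by (metis norm_minus_cancel)

lemma lborel_integral_minus:
  fixes f :: "real^'d \<Rightarrow> 'b::{banach, second_countable_topology}"
  shows "(LINT x|lborel. f (- x)) = (LINT x|lborel. f x)"
proof (cases "f \<in> borel_measurable borel")
  case True
  have "lborel = density (distr lborel borel (\<lambda>x::real^'d. 0 + (-1) *\<^sub>R x))
      (\<lambda>_. \<bar>-1::real\<bar> ^ DIM(real^'d))"
    by (rule lborel_affine) simp
  also have "\<dots> = distr lborel borel uminus"
    by (simp add: density_1)
  finally have "distr lborel borel uminus = (lborel :: (real^'d) measure)" ..
  then have "(LINT x|lborel. f x) = (LINT x|distr lborel borel uminus. f x)"
    by simp
  also have "\<dots> = (LINT x|lborel. f (- x))"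
    using True by (intro integral_distr) auto
  finally show ?thesis ..
next
  case False
  have "(\<lambda>x. f (- x)) \<notin> borel_measurable borel"
  proof
    assume "(\<lambda>x. f (- x)) \<in> borel_measurable borel"
    from measurable_compose[OF borel_measurable_uminus[OF measurable_ident] this] False
    show False by simp
  qed
  then have "\<not> integrable lborel f" "\<not> integrable lborel (\<lambda>x. f (- x))"
    using False by (auto dest: borel_measurable_integrable)
  then show ?thesis
    by (simp add: not_integrable_integral_eq)
qed

lemma kernel_weight_minus:
  assumes "radial \<phi>"
  shows "kernel_weight \<phi> (- \<xi>) = kernel_weight \<phi> \<xi>"
proof -
  have "convolve \<phi> \<phi> (- \<xi>) = (LINT \<eta>|lborel. \<phi> (- \<eta>) * \<phi> (- \<xi> - (- \<eta>)))"
    unfolding convolve_def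
    by (rule lborel_integral_minus[symmetric, where f = "\<lambda>\<eta>. \<phi> \<eta> * \<phi> (- \<xi> - \<eta>)"])
  also have "\<dots> = (LINT \<eta>|lborel. \<phi> \<eta> * \<phi> (\<xi> - \<eta>))"
  proof (rule Bochner_Integration.integral_cong[OF refl])
    fix \<eta>
    show "\<phi> (- \<eta>) * \<phi> (- \<xi> - (- \<eta>)) = \<phi> \<eta> * \<phi> (\<xi> - \<eta>)"
      using radial_minus[OF assms, of \<eta>] radial_minus[OF assms, of "\<xi> - \<eta>"] by simp
  qed
  also have "\<dots> = convolve \<phi> \<phi> \<xi>"
    by (simp only: convolve_def)
  finally show ?thesis
    by (simp add: kernel_weight_def)
qed

lemma bump_kernel_eq:
  assumes "radial \<phi>"
  shows "complex_of_real (bump_kernel \<phi> x) =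
    (LINT \<xi>|lborel. complex_of_real (kernel_weight \<phi> \<xi>) * exp (2 * pi * \<i> * (\<xi> \<bullet> x)))"
proof -
  define F where
    "F \<xi> = complex_of_real (kernel_weight \<phi> \<xi>) * exp (2 * pi * \<i> * (\<xi> \<bullet> x))" for \<xi>
  have "cnj (F \<xi>) = F (- \<xi>)" for \<xi>
    unfolding F_def by (simp add: exp_cnj kernel_weight_minus[OF assms])
  then have minus: "(\<lambda>\<xi>. cnj (F \<xi>)) = (\<lambda>\<xi>. F (- \<xi>))"
    by (rule ext)
  have "cnj (integral\<^sup>L lborel F) = (LINT \<xi>|lborel. cnj (F \<xi>))"
    by (rule Bochner_Integration.integral_cnj[symmetric])
  also have "\<dots> = (LINT \<xi>|lborel. F (- \<xi>))"
    by (subst minus) (rule refl)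
  also have "\<dots> = integral\<^sup>L lborel F"
    by (rule lborel_integral_minus)
  finally have "cnj (integral\<^sup>L lborel F) = integral\<^sup>L lborel F" .
  then have "complex_of_real (Re (integral\<^sup>L lborel F)) = integral\<^sup>L lborel F"
    by (metis Reals_cnj_iff of_real_Re)
  then show ?thesis
    by (simp only: bump_kernel_def F_def[abs_def])
qed

definition kernel_tail :: "(real^'d \<Rightarrow> real) \<Rightarrow> real \<Rightarrow> real" where
  "kernel_tail \<phi> t = (LINT x:{x. t \<le> norm x}|lborel. bump_kernel \<phi> x)"

definition gamma_const :: "(real^'d \<Rightarrow> real) \<Rightarrow> real" where
  "gamma_const \<phi> = exp (2 * pi) * inverse (LINT y:{y. norm y \<le> 1}|lborel. bump_kernel \<phi> y)"

definition psi :: "(real^'d \<Rightarrow> real) \<Rightarrow> ennreal \<Rightarrow> real" where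
  "psi \<phi> t = (if t = \<infinity> then 0 else 4 * gamma_const \<phi> * kernel_tail \<phi> (enn2real t / 2))"

text \<open>
  The torus is represented by objects on Euclidean space: its subsets by sets that are periodic
  under the integer lattice, its points by representatives, integrals over it by integrals over
  a fundamental cell.
  A set is given by a subset \<open>A\<close> of Euclidean space whose lattice translates are separated; the
  boundary distance is that to the translates of \<open>frontier A\<close>. Distances are extended reals, so
  that distances from the empty set are infinite, unlike with \<open>infdist\<close> and \<open>setdist\<close>.
\<close>

definition int_lattice :: "(real^'d) set" where
  "int_lattice = {k. \<forall>i. k $ i \<in> \<int>}"

definition unit_cell :: "(real^'d) set" where
  "unit_cell = {x. \<forall>i. 0 \<le> x $ i \<and> x $ i < 1}"

definition periodize :: "(real^'d) set \<Rightarrow> (real^'d) set" where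
  "periodize A = {a + k | a k. a \<in> A \<and> k \<in> int_lattice}"

definition edist_sets :: "(real^'d) set \<Rightarrow> (real^'d) set \<Rightarrow> ennreal" where
  "edist_sets A B = (INF a\<in>A. INF b\<in>B. ennreal (dist a b))"

definition torus_boundary_dist :: "real^'d \<Rightarrow> (real^'d) set \<Rightarrow> ennreal" where
  "torus_boundary_dist x A = edist_sets {x} (periodize (frontier A))"

definition torus_measure :: "(real^'d) set \<Rightarrow> real" where
  "torus_measure A = measure lebesgue (A \<inter> unit_cell)"

definition torus_fourier :: "(real^'d \<Rightarrow> real) \<Rightarrow> real^'d \<Rightarrow> complex" where
  "torus_fourier f k =
     (LINT x:unit_cell|lebesgue. complex_of_real (f x) * exp (- (2 * pi * \<i> * (k \<bullet> x))))"

definition H_fun :: "(real^'d \<Rightarrow> real) \<Rightarrow> (real^'d) set \<Rightarrow> real \<Rightarrow> real^'d \<Rightarrow> real" where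
  "H_fun \<phi> A R x = psi \<phi> (ennreal (2 * R) * torus_boundary_dist x A) / 4"

end

theory Submission
  imports Defs "HOL-Probability.Characteristic_Functions"
begin

text \<open>
  The weight \<open>(1 + |\<xi>|\<^sup>2)\<close> to the power \<open>-(d + 1) / 2\<close> is the Fourier transform of a multiple of
  \<open>exp (- 2 \<pi> |y|)\<close>, and \<open>\<phi> * \<phi>\<close> is that of a square, so the kernel \<open>K\<close> is a superposition of
  translates of \<open>exp (- 2 \<pi> |y|)\<close> with nonnegative weights. Hence \<open>K\<close> is positive, satisfies the
  Harnack inequality \<open>K x \<le> exp (2 \<pi> |h|) K (x + h)\<close>, has integral 1, and its Fourier transform is
  supported in the unit ball. Convolving a periodic function with the dilate \<open>K\<^sub>R\<close> therefore gives a
  trigonometric polynomial with frequencies of norm less than \<open>R\<close>, obtained by multiplying the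
  Fourier coefficients by numbers of modulus at most 1.

  The value at \<open>x\<close> of the indicator of \<open>\<Omega>\<close> differs from that of its convolution with \<open>K\<^sub>R\<close> by at most
  \<open>I (R dist (x, \<partial>\<Omega>))\<close>. The Harnack inequality gives \<open>I t \<le> exp (2 \<pi>) I (t + 1)\<close>, so this is at most
  the convolution of \<open>H\<^sub>R\<close> with \<open>K\<^sub>R\<close>. Thus the indicator is approximated pointwise by a
  trigonometric polynomial with an error bounded by another one, and averaging over the points
  \<open>x\<^sub>j\<close> gives the theorem.
\<close>

section \<open>Gaussian Fourier transforms\<close>

text \<open>The points x_j are arbitrary, so the trigonometric identities must hold everywhere, not
  just almost everywhere. The mollified functions are therefore shown to be continuous, and
  uniqueness of Fourier coefficients is proved for continuous periodic functions. Positivity of K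
  replaces decay estimates: a nonnegative transform of a bounded continuous integrable function is
  integrable by Gaussian summation, and the Harnack inequality makes every mollification continuous.
  The multiplier at frequency k is the weight at k/R. It is 1 at k = 0, so averaging the mollified
  indicator produces exactly the measure of the set. In the tail inequality the mass is moved
  radially by one unit. The Jacobian is favourable; this is expressed as nonexpansive maps not
  increasing Lebesgue measure. In the constant gamma, exp (2 pi) pays for this shift, and the
  inverse ball integral for restricting the convolution of H_R to |y| <= 1, where R dist changes by
  at most 1. Separation of the translates matters because the frontier of an infinite union need not
  lie in the union of the frontiers.\<close>

lemma gauss_integrable_1:
  fixes u :: real
  assumes "u > 0"
  shows "integrable lborel (\<lambda>x. exp (- (pi * x / u)\<^sup>2))"
proof -
  have "integrable lborel (\<lambda>x. exp (- x\<^sup>2) :: real)"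
    using has_bochner_integral_even_function[OF gaussian_moment_0] has_bochner_integral_iff by auto
  from lborel_integrable_real_affine[OF this, of "pi / u" 0] assms
  show ?thesis by simp
qed

text \<open>The characteristic function of the standard normal distribution, rescaled. The width
  enters as \<open>pi / u\<close> because this is how Gaussians in \<open>y\<close> occur in the
  subordination formula below, with \<open>u\<close> as the integration variable.\<close>

lemma gauss_fourier_1:
  fixes u t :: real
  assumes "u > 0"
  shows "(LINT x|lborel. complex_of_real (exp (- (pi * x / u)\<^sup>2)) * cis (2 * pi * (x * t)))
    = complex_of_real (u / sqrt pi * exp (- (t * u)\<^sup>2))"
proof -
  \<comment> \<open>Chosen so that \<open>z = x / c\<close> turns \<open>z\<^sup>2 / 2\<close> into
    \<open>(pi * x / u)\<^sup>2\<close> and the phase \<open>sqrt 2 * t * u * z\<close> into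
    \<open>2 * pi * (x * t)\<close>.\<close>
  define c where "c = u / (pi * sqrt 2)"
  have c: "c > 0" using assms by (simp add: c_def)
  have "complex_of_real (exp (- ((sqrt 2 * t * u)^2) / 2)) = char std_normal_distribution (sqrt 2 * t * u)"
    by (simp add: char_std_normal_distribution)
  also have "\<dots> = (LINT z|lborel. std_normal_density z *\<^sub>R iexp (sqrt 2 * t * u * z))"
    unfolding char_def by (subst integral_density) (auto simp: normal_density_nonneg)
  also have "\<dots> = (LINT z|lborel. complex_of_real (1 / sqrt (2 * pi)) * (complex_of_real (exp (- z\<^sup>2 / 2)) * cis (sqrt 2 * t * u * z)))"
    by (intro Bochner_Integration.integral_cong refl)
       (simp add: std_normal_density_def cis_conv_exp scaleR_conv_of_real exp_of_real)
  also have "\<dots> = complex_of_real (1 / sqrt (2 * pi)) * (LINT z|lborel. complex_of_real (exp (- z\<^sup>2 / 2)) * cis (sqrt 2 * t * u * z))"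
    by simp
  finally have A: "(LINT z|lborel. complex_of_real (exp (- z\<^sup>2 / 2)) * cis (sqrt 2 * t * u * z)) = complex_of_real (sqrt (2 * pi) * exp (- (t * u)\<^sup>2))"
    by (simp add: field_simps power_mult_distrib)
  have "(LINT z|lborel. complex_of_real (exp (- z\<^sup>2 / 2)) * cis (sqrt 2 * t * u * z)) =
     \<bar>1 / c\<bar> *\<^sub>R (LINT x|lborel. complex_of_real (exp (- (0 + (1 / c) * x)\<^sup>2 / 2)) * cis (sqrt 2 * t * u * (0 + (1 / c) * x)))"
    by (rule lborel_integral_real_affine) (use c in auto)
  also have "(\<lambda>x. complex_of_real (exp (- (0 + (1 / c) * x)\<^sup>2 / 2)) * cis (sqrt 2 * t * u * (0 + (1 / c) * x)))
     = (\<lambda>x. complex_of_real (exp (- (pi * x / u)\<^sup>2)) * cis (2 * pi * (x * t)))"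
  proof
    fix x
    have "(0 + (1 / c) * x)\<^sup>2 / 2 = (pi * x / u)\<^sup>2"
      using assms by (simp add: c_def power_mult_distrib power_divide field_simps)
    moreover have "sqrt 2 * t * u * (0 + (1 / c) * x) = 2 * pi * (x * t)"
      using assms by (simp add: c_def field_simps)
    ultimately show "complex_of_real (exp (- (0 + (1 / c) * x)\<^sup>2 / 2)) * cis (sqrt 2 * t * u * (0 + (1 / c) * x))
     = complex_of_real (exp (- (pi * x / u)\<^sup>2)) * cis (2 * pi * (x * t))"
      by (metis minus_divide_left)
  qed
  finally have "(LINT x|lborel. complex_of_real (exp (- (pi * x / u)\<^sup>2)) * cis (2 * pi * (x * t)))
     = c *\<^sub>R complex_of_real (sqrt (2 * pi) * exp (- (t * u)\<^sup>2))"
    unfolding A using c by simp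
  also have "c * sqrt (2 * pi) = u / sqrt pi"
    by (simp add: c_def real_sqrt_mult field_simps)
  then have "c *\<^sub>R complex_of_real (sqrt (2 * pi) * exp (- (t * u)\<^sup>2)) = complex_of_real (u / sqrt pi * exp (- (t * u)\<^sup>2))"
    by (metis (no_types, opaque_lifting) mult.assoc of_real_mult scaleR_conv_of_real)
  finally show ?thesis .
qed

lemma lborel_integral_prod_Basis:
  fixes f :: "'a::euclidean_space \<Rightarrow> real \<Rightarrow> 'b::{real_normed_field,banach,second_countable_topology}"
  assumes f: "\<And>b. b \<in> Basis \<Longrightarrow> integrable lborel (f b)"
  shows "(LINT x|lborel. (\<Prod>b\<in>Basis. f b (x \<bullet> b))) = (\<Prod>b\<in>Basis. LINT x|lborel. f b x)"
    and "integrable lborel (\<lambda>x. \<Prod>b\<in>Basis. f b (x \<bullet> b))"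
proof -
  interpret P: product_sigma_finite "\<lambda>_::'a. lborel::real measure" ..
  have [measurable]: "f b \<in> borel_measurable borel" if "b \<in> Basis" for b
    using f[OF that] by auto
  have m: "(\<lambda>f. \<Sum>b\<in>Basis. f b *\<^sub>R b) \<in> (\<Pi>\<^sub>M b\<in>Basis. lborel) \<rightarrow>\<^sub>M (borel :: 'a measure)"
    by measurable
  have eq: "(\<lambda>x. \<Prod>b\<in>Basis. f b ((\<Sum>b\<in>Basis. x b *\<^sub>R b) \<bullet> b)) = (\<lambda>x. \<Prod>b\<in>Basis. f b (x b))"
    by (intro ext prod.cong refl) simp
  show "(LINT x|lborel. (\<Prod>b\<in>Basis. f b (x \<bullet> b))) = (\<Prod>b\<in>Basis. LINT x|lborel. f b x)"
    by (subst lborel_eq, subst integral_distr[OF m], measurable, subst eq,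
        rule P.product_integral_prod) (use f in auto)
  show "integrable lborel (\<lambda>x. \<Prod>b\<in>Basis. f b (x \<bullet> b))"
    by (subst lborel_eq, subst integrable_distr_eq[OF m], measurable, subst eq,
        rule P.product_integrable_prod) (use f in auto)
qed

lemma norm_power2_eq_sum_Basis: "(norm x)\<^sup>2 = (\<Sum>b\<in>Basis. (x \<bullet> b)\<^sup>2)" for x :: "'a::euclidean_space"
  unfolding power2_norm_eq_inner euclidean_inner[of x x] by (simp add: power2_eq_square)

lemma
  fixes \<xi> :: "'a::euclidean_space" and u :: real
  assumes "u > 0"
  shows gauss_fourier: "(LINT y|lborel. complex_of_real (exp (- (pi * norm y / u)\<^sup>2)) * cis (2 * pi * (y \<bullet> \<xi>)))
    = complex_of_real ((u / sqrt pi) ^ DIM('a) * exp (- (u * norm \<xi>)\<^sup>2))"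
   and gauss_integrable: "integrable lborel (\<lambda>y::'a. exp (- (pi * norm y / u)\<^sup>2))"
proof -
  have *: "(pi * norm y / u)\<^sup>2 = (\<Sum>b\<in>Basis. (pi * (y \<bullet> b) / u)\<^sup>2)" for y :: 'a
    by (simp add: power_mult_distrib power_divide norm_power2_eq_sum_Basis sum_distrib_left sum_divide_distrib)
  show "integrable lborel (\<lambda>y::'a. exp (- (pi * norm y / u)\<^sup>2))"
    using lborel_integral_prod_Basis(2)[of "\<lambda>_::'a. \<lambda>x. exp (- (pi * x / u)\<^sup>2)"] gauss_integrable_1[OF assms]
    by (simp add: * exp_sum flip: sum_negf)
  have "cis (sum g A) = (\<Prod>a\<in>A. cis (g a))" if "finite A" for g :: "'a \<Rightarrow> real" and A
    using that by (induction A rule: finite_induct) (auto simp: cis_mult[symmetric])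
  then have cs: "cis (sum g Basis) = (\<Prod>a\<in>Basis. cis (g a))" for g :: "'a \<Rightarrow> real" by simp
  have 1: "(\<lambda>y. complex_of_real (exp (- (pi * norm y / u)\<^sup>2)) * cis (2 * pi * (y \<bullet> \<xi>)))
     = (\<lambda>y. \<Prod>b\<in>Basis. complex_of_real (exp (- (pi * (y \<bullet> b) / u)\<^sup>2)) * cis (2 * pi * ((y \<bullet> b) * (\<xi> \<bullet> b))))"
  proof
    fix y :: 'a
    have e: "exp (- (pi * norm y / u)\<^sup>2) = (\<Prod>b\<in>Basis. exp (- (pi * (y \<bullet> b) / u)\<^sup>2))"
      unfolding * by (simp add: exp_sum del: sum_negf flip: sum_negf)
    have c: "cis (2 * pi * (y \<bullet> \<xi>)) = (\<Prod>b\<in>Basis. cis (2 * pi * ((y \<bullet> b) * (\<xi> \<bullet> b))))"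
      unfolding euclidean_inner[of y \<xi>] sum_distrib_left by (rule cs)
    show "complex_of_real (exp (- (pi * norm y / u)\<^sup>2)) * cis (2 * pi * (y \<bullet> \<xi>))
      = (\<Prod>b\<in>Basis. complex_of_real (exp (- (pi * (y \<bullet> b) / u)\<^sup>2)) * cis (2 * pi * ((y \<bullet> b) * (\<xi> \<bullet> b))))"
      unfolding e c by (simp add: prod.distrib)
  qed
  have i: "integrable lborel (\<lambda>x. complex_of_real (exp (- (pi * x / u)\<^sup>2)) * cis (2 * pi * (x * t)))" for t
    by (rule Bochner_Integration.integrable_bound[OF gauss_integrable_1[OF assms]])
       (auto simp: norm_mult cis_conv_exp)
  have e2: "exp (- (u * norm \<xi>)\<^sup>2) = (\<Prod>b\<in>Basis. exp (- ((\<xi> \<bullet> b) * u)\<^sup>2))"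
    by (simp add: power_mult_distrib norm_power2_eq_sum_Basis[of \<xi>] sum_distrib_left mult.commute exp_sum del: sum_negf flip: sum_negf)
  show "(LINT y|lborel. complex_of_real (exp (- (pi * norm y / u)\<^sup>2)) * cis (2 * pi * (y \<bullet> \<xi>)))
    = complex_of_real ((u / sqrt pi) ^ DIM('a) * exp (- (u * norm \<xi>)\<^sup>2))"
  proof -
    let ?f = "\<lambda>b x. complex_of_real (exp (- (pi * x / u)\<^sup>2)) * cis (2 * pi * (x * (\<xi> \<bullet> b)))"
    have "(LINT y|lborel. (\<Prod>b\<in>Basis. ?f b (y \<bullet> b))) = (\<Prod>b\<in>Basis. (LINT x|lborel. ?f b x))"
      by (rule lborel_integral_prod_Basis(1)) (rule i)
    also have "\<dots> = (\<Prod>b\<in>Basis. complex_of_real (u / sqrt pi * exp (- ((\<xi> \<bullet> b) * u)\<^sup>2)))"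
      by (simp only: gauss_fourier_1[OF assms])
    also have "\<dots> = complex_of_real ((u / sqrt pi) ^ DIM('a) * exp (- (u * norm \<xi>)\<^sup>2))"
      by (simp only: e2 of_real_mult prod.distrib) simp
    finally show ?thesis unfolding 1 .
  qed
qed

text \<open>The change of variables below yields absolute integrability with respect to
  \<open>lebesgue\<close>, while Fubini is applied over \<open>lborel\<close>; Borel measurability
  of \<open>f\<close> allows the passage.\<close>

lemma has_bochner_integral_Ioi:
  fixes f :: "real \<Rightarrow> real"
  assumes "f absolutely_integrable_on {0<..}" "integral {0<..} f = b" "f \<in> borel_measurable borel"
  shows "has_bochner_integral lborel (\<lambda>u. indicator {0<..} u * f u) b"
proof -
  have i: "integrable lebesgue (\<lambda>u. indicator {0<..} u * f u)"
    using assms(1) by (simp add: set_integrable_def)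
  moreover have m: "(\<lambda>u. indicator {0<..} u * f u) \<in> borel_measurable lborel"
    using assms(3) by measurable
  ultimately have "integrable lborel (\<lambda>u. indicator {0<..} u * f u)"
    by (simp add: integrable_completion)
  moreover have "(LINT u|lborel. indicator {0<..} u * f u) = b"
    using set_lebesgue_integral_eq_integral(2)[OF assms(1)] assms(2) m
    by (simp add: set_lebesgue_integral_def integral_completion)
  ultimately show ?thesis by (simp add: has_bochner_integral_iff)
qed

text \<open>
  With \<open>h u = exp (- (u - b / u)\<^sup>2)\<close>, the involution \<open>u \<mapsto> b / u\<close> turns the integral of \<open>h\<close> into that of
  \<open>b / u\<^sup>2 * h u\<close>, and the integral of the sum \<open>(1 + b / u\<^sup>2) * h u\<close> is Gaussian in \<open>w = u - b / u\<close>.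
\<close>

lemma cauchy_schloemilch:
  fixes b :: real
  assumes b: "b > 0"
  shows "has_bochner_integral lborel (\<lambda>u. indicator {0<..} u * (exp (- u\<^sup>2) * exp (- (b / u)\<^sup>2)))
    (sqrt pi / 2 * exp (- 2 * b))"
proof -
  define h where "h u = exp (- (u - b / u)\<^sup>2)" for u :: real
  have [measurable]: "h \<in> borel_measurable borel" unfolding h_def by measurable
  have hb: "has_bochner_integral lborel (\<lambda>x::real. exp (- x\<^sup>2)) (sqrt pi)"
    using has_bochner_integral_even_function[OF gaussian_moment_0] by simp
  then have hl: "(\<lambda>x::real. exp (- x\<^sup>2)) absolutely_integrable_on UNIV"
    by (auto simp: set_integrable_def has_bochner_integral_iff integrable_completion)
  have hI: "integral UNIV (\<lambda>x::real. exp (- x\<^sup>2)) = sqrt pi"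
    using set_lebesgue_integral_eq_integral(2)[OF hl] hb
    by (simp add: set_lebesgue_integral_def integral_completion has_bochner_integral_iff)
  have img: "(\<lambda>u. u - b / u) ` {0<..} = UNIV"
  proof -
    have "w \<in> (\<lambda>u. u - b / u) ` {0<..}" for w
    proof -
      \<comment> \<open>\<open>(w + s) / 2\<close> is the positive root of u^2 - w u - b = 0, that
        is, the preimage of \<open>w\<close>.\<close>
      define s where "s = sqrt (w\<^sup>2 + 4 * b)"
      have s2: "s\<^sup>2 = w\<^sup>2 + 4 * b" using b by (simp add: s_def)
      have "\<bar>w\<bar> < s" unfolding s_def using b by (intro real_less_rsqrt) simp
      then have p: "(w + s) / 2 > 0" by (simp add: abs_less_iff)
      have "(w + s) / 2 * ((w + s) / 2) - b = w * ((w + s) / 2)"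
        using s2 by (simp add: power2_eq_square algebra_simps)
      then have "(w + s) / 2 - b / ((w + s) / 2) = w"
        using p by (simp add: field_simps)
      then show ?thesis using p by (intro image_eqI[of _ _ "(w + s) / 2"]) auto
    qed
    then show ?thesis by blast
  qed
  have inj: "inj_on (\<lambda>u. u - b / u) {0<..}"
  proof (rule inj_onI)
    fix u v :: real assume uv: "u \<in> {0<..}" "v \<in> {0<..}" "u - b / u = v - b / v"
    have "(u - v) * (1 + b / (u * v)) = 0" using uv by (simp add: field_simps)
    moreover have "1 + b / (u * v) > 0" using uv b by (simp add: add_pos_pos)
    ultimately show "u = v" by simp
  qed
  have 1: "(\<lambda>u. \<bar>1 + b / u\<^sup>2\<bar> * h u) absolutely_integrable_on {0<..} \<and>
     integral {0<..} (\<lambda>u. \<bar>1 + b / u\<^sup>2\<bar> * h u) = sqrt pi"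
    unfolding h_def
    by (subst has_absolute_integral_change_of_variables_1'[where g = "\<lambda>u. u - b / u" and f = "\<lambda>x. exp (- x\<^sup>2)"])
       (use inj img hl hI in \<open>auto intro!: derivative_eq_intros simp: power2_eq_square field_simps\<close>)
  have hai: "h absolutely_integrable_on {0<..}"
  proof (rule measurable_bounded_by_integrable_imp_absolutely_integrable)
    show "h \<in> borel_measurable (lebesgue_on {0<..})"
      by (intro borel_measurable_if_D measurable_completion measurable_restrict_space1) auto
    show "(\<lambda>u. \<bar>1 + b / u\<^sup>2\<bar> * h u) integrable_on {0<..}"
      using 1 set_lebesgue_integral_eq_integral(1) by blast
    show "norm (h x) \<le> \<bar>1 + b / x\<^sup>2\<bar> * h x" if "x \<in> {0<..}" for x
      using b by (simp add: h_def)
  qed auto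
  have img2: "(\<lambda>u. b / u) ` {0<..} = {0<..}"
    using b by (auto intro!: image_eqI[of _ _ "b / x" for x])
  have inj2: "inj_on (\<lambda>u. b / u) {0<..}"
    using b by (auto simp: inj_on_def)
  have hh: "h (b / u) = h u" if "u > 0" for u
    using b that by (simp add: h_def power2_commute)
  define J where "J = integral {0<..} h"
  have 2: "(\<lambda>u. \<bar>- b / u\<^sup>2\<bar> * h (b / u)) absolutely_integrable_on {0<..} \<and>
     integral {0<..} (\<lambda>u. \<bar>- b / u\<^sup>2\<bar> * h (b / u)) = J"
    by (subst has_absolute_integral_change_of_variables_1'[where g = "\<lambda>u. b / u" and f = h])
       (use inj2 img2 hai J_def in \<open>auto intro!: derivative_eq_intros simp: power2_eq_square field_simps\<close>)
  have 3: "integral {0<..} (\<lambda>u. \<bar>- b / u\<^sup>2\<bar> * h (b / u) + h u) = J + J"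
    using 2 hai by (subst Henstock_Kurzweil_Integration.integral_add) (auto simp: J_def set_lebesgue_integral_eq_integral(1))
  have "integral {0<..} (\<lambda>u. \<bar>- b / u\<^sup>2\<bar> * h (b / u) + h u) = integral {0<..} (\<lambda>u. \<bar>1 + b / u\<^sup>2\<bar> * h u)"
    using b by (intro Henstock_Kurzweil_Integration.integral_cong) (auto simp: hh algebra_simps abs_of_pos)
  with 1 3 have J: "J = sqrt pi / 2" by simp
  have "has_bochner_integral lborel (\<lambda>u. indicator {0<..} u * h u) (sqrt pi / 2)"
    using hai J J_def by (intro has_bochner_integral_Ioi) auto
  then have "has_bochner_integral lborel (\<lambda>u. (indicator {0<..} u * h u) * exp (- 2 * b)) (sqrt pi / 2 * exp (- 2 * b))"
    by (rule has_bochner_integral_mult_left)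
  also have "(\<lambda>u. (indicator {0<..} u * h u) * exp (- 2 * b)) = (\<lambda>u. indicator {0<..} u * (exp (- u\<^sup>2) * exp (- (b / u)\<^sup>2)))"
  proof
    fix u :: real
    have "exp (- (u - b / u)\<^sup>2) * exp (- 2 * b) = exp (- u\<^sup>2) * exp (- (b / u)\<^sup>2)" if "u > 0"
      using that by (simp add: power2_diff algebra_simps flip: exp_add)
    then show "(indicator {0<..} u * h u) * exp (- 2 * b) = indicator {0<..} u * (exp (- u\<^sup>2) * exp (- (b / u)\<^sup>2))"
      by (auto simp: h_def indicator_def)
  qed
  finally show ?thesis .
qed

text \<open>Scaling by \<open>c\<close> gives one power for each factor of the monomial and one more
  for the differential. The constant is half the Gamma function at (n + 1) / 2; only its positivity
  matters later, so it stays existential and the formulas for even and odd moments need not be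
  unified.\<close>

lemma power_gauss_integral:
  fixes n :: nat
  obtains \<kappa> :: real where "\<kappa> > 0" "\<And>c. c > 0 \<Longrightarrow>
    has_bochner_integral lborel (\<lambda>u. indicator {0<..} u * (u ^ n * exp (- (u * c)\<^sup>2))) (\<kappa> * inverse c ^ Suc n)"
proof -
  obtain \<kappa> :: real where k: "\<kappa> > 0" "has_bochner_integral lborel (\<lambda>x::real. indicator {0..} x *\<^sub>R (exp (- x\<^sup>2) * x ^ n)) \<kappa>"
  proof (cases "even n")
    case True
    then obtain k where "n = 2 * k" by (auto elim: evenE)
    then show ?thesis
      using gaussian_moment_even_pos[of k] by (intro that[of "(sqrt pi / 2) * (fact (2 * k) / (2 ^ (2 * k) * fact k))"]) auto
  next
    case False
    then obtain k where "n = 2 * k + 1" by (auto elim: oddE)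
    then show ?thesis
      using gaussian_moment_odd_pos[of k] by (intro that[of "fact k / 2"]) auto
  qed
  have e: "AE x::real in lborel. indicator {0..} x *\<^sub>R (exp (- x\<^sup>2) * x ^ n) = indicator {0<..} x * (x ^ n * exp (- x\<^sup>2))"
    using AE_lborel_singleton[of "0::real"] by (auto simp: indicator_def elim!: eventually_mono)
  have k2: "has_bochner_integral lborel (\<lambda>x. indicator {0<..} x * (x ^ n * exp (- x\<^sup>2))) \<kappa>"
    using k(2) by (subst has_bochner_integral_cong_AE[THEN iffD1, OF _ _ e]) auto
  show ?thesis
  proof (rule that[OF k(1)])
    fix c :: real assume c: "c > 0"
    have "has_bochner_integral lborel (\<lambda>x. indicator {0<..} (0 + c * x) * ((0 + c * x) ^ n * exp (- (0 + c * x)\<^sup>2))) (\<kappa> /\<^sub>R \<bar>c\<bar>)"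
      using c k2 by (intro lborel_has_bochner_integral_real_affine_iff[THEN iffD1]) auto
    then have "has_bochner_integral lborel (\<lambda>x. (indicator {0<..} (0 + c * x) * ((0 + c * x) ^ n * exp (- (0 + c * x)\<^sup>2))) * inverse c ^ n) ((\<kappa> /\<^sub>R \<bar>c\<bar>) * inverse c ^ n)"
      by (rule has_bochner_integral_mult_left)
    also have "(\<lambda>x. (indicator {0<..} (0 + c * x) * ((0 + c * x) ^ n * exp (- (0 + c * x)\<^sup>2))) * inverse c ^ n) = (\<lambda>u. indicator {0<..} u * (u ^ n * exp (- (u * c)\<^sup>2)))"
      using c by (auto simp: fun_eq_iff indicator_def power_mult_distrib field_simps zero_less_mult_iff)
    also have "(\<kappa> /\<^sub>R \<bar>c\<bar>) * inverse c ^ n = \<kappa> * inverse c ^ Suc n"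
      using c by (simp add: field_simps)
    finally show "has_bochner_integral lborel (\<lambda>u. indicator {0<..} u * (u ^ n * exp (- (u * c)\<^sup>2))) (\<kappa> * inverse c ^ Suc n)" .
  qed
qed

section \<open>The Bessel-type weight as a Fourier transform\<close>

text \<open>Subordination: \<open>cauchy_schloemilch\<close> with b = pi |y| writes exp (- 2 pi |y|)
  as a mixture of Gaussians, whose transforms are explicit, and Fubini exchanges the integrals. The
  remaining integral over \<open>u\<close> is evaluated in \<open>weight_eq_fourier\<close>.\<close>

lemma
  fixes \<xi> :: "'a::euclidean_space"
  shows integrable_exp_norm: "integrable lborel (\<lambda>y::'a. exp (- 2 * pi * norm y))"
    and fourier_exp_norm: "complex_of_real (sqrt pi / 2) *
      (LINT y|lborel. complex_of_real (exp (- 2 * pi * norm y)) * cis (2 * pi * (y \<bullet> \<xi>)))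
      = complex_of_real (LINT u|lborel. indicator {0<..} u * ((u / sqrt pi) ^ DIM('a) * exp (- (u * sqrt (1 + (norm \<xi>)\<^sup>2))\<^sup>2)))"
proof -
  define F where "F \<eta> u y = complex_of_real (indicator {0<..} u * (exp (- u\<^sup>2) * exp (- (pi * norm y / u)\<^sup>2))) * cis (2 * pi * (y \<bullet> \<eta>))"
    for \<eta> :: 'a and u :: real and y :: 'a
  have nF: "norm (F \<eta> u y) = indicator {0<..} u * exp (- u\<^sup>2) * exp (- (pi * norm y / u)\<^sup>2)" for \<eta> u y
    unfolding F_def by (simp add: norm_mult)
  have gr: "(LINT y::'a|lborel. exp (- (pi * norm y / u)\<^sup>2)) = (u / sqrt pi) ^ DIM('a)" if "u > 0" for u :: real
  proof -
    have "complex_of_real (LINT y::'a|lborel. exp (- (pi * norm y / u)\<^sup>2)) = complex_of_real ((u / sqrt pi) ^ DIM('a))"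
      using gauss_fourier[OF that, of "0::'a"] by simp
    then show ?thesis by (simp only: of_real_eq_iff)
  qed
  obtain \<kappa> :: real where \<kappa>: "\<kappa> > 0" "\<And>c::real. c > 0 \<Longrightarrow>
    has_bochner_integral lborel (\<lambda>u. indicator {0<..} u * (u ^ DIM('a) * exp (- (u * c)\<^sup>2))) (\<kappa> * inverse c ^ Suc (DIM('a)))"
    using power_gauss_integral[of "DIM('a)"] by blast
  have int: "integrable (lborel \<Otimes>\<^sub>M lborel) (case_prod (F \<eta>))" for \<eta>
  proof (rule lborel_pair.Fubini_integrable)
    show "case_prod (F \<eta>) \<in> borel_measurable (lborel \<Otimes>\<^sub>M lborel)"
      unfolding F_def cis_conv_exp by measurable
    have "(LINT y|lborel. norm (case_prod (F \<eta>) (u, y))) = indicator {0<..} u * (u ^ DIM('a) * exp (- (u * 1)\<^sup>2)) / sqrt pi ^ DIM('a)" for u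
    proof (cases "u > 0")
      case True
      have "(LINT y|lborel. norm (case_prod (F \<eta>) (u, y))) = exp (- u\<^sup>2) * (LINT y::'a|lborel. exp (- (pi * norm y / u)\<^sup>2))"
        using True by (simp add: nF)
      then show ?thesis using gr[OF True] True by (simp add: field_simps)
    next
      case False
      then show ?thesis by (simp add: nF)
    qed
    then show "integrable lborel (\<lambda>u. LINT y|lborel. norm (case_prod (F \<eta>) (u, y)))"
      using \<kappa>(2)[of 1] by (simp add: has_bochner_integral_iff)
    show "AE u in lborel. integrable lborel (\<lambda>y. case_prod (F \<eta>) (u, y))"
    proof (rule AE_I2)
      fix u :: real
      show "integrable lborel (\<lambda>y. case_prod (F \<eta>) (u, y))"
      proof (cases "u > 0")
        case True
        show ?thesis
          by (rule Bochner_Integration.integrable_bound[OF integrable_mult_right[OF gauss_integrable[OF True], of "exp (- u\<^sup>2)"]])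
            (use True in \<open>auto simp: nF, auto simp: F_def cis_conv_exp\<close>)
      qed (simp add: F_def)
    qed
  qed
  have inner: "(LINT u|lborel. F \<eta> u y) = complex_of_real (sqrt pi / 2 * exp (- 2 * pi * norm y)) * cis (2 * pi * (y \<bullet> \<eta>))"
    if "y \<noteq> 0" for \<eta> y
  proof -
    have "has_bochner_integral lborel (\<lambda>u. indicator {0<..} u * (exp (- u\<^sup>2) * exp (- (pi * norm y / u)\<^sup>2))) (sqrt pi / 2 * exp (- 2 * (pi * norm y)))"
      using that by (intro cauchy_schloemilch) simp
    then have "(LINT u|lborel. indicator {0<..} u * (exp (- u\<^sup>2) * exp (- (pi * norm y / u)\<^sup>2))) = sqrt pi / 2 * exp (- 2 * pi * norm y)"
      by (simp only: has_bochner_integral_integral_eq mult.assoc)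
    then show ?thesis
      unfolding F_def by (simp only: integral_mult_left_zero integral_complex_of_real)
  qed
  \<comment> \<open>\<open>cauchy_schloemilch\<close> requires b > 0, hence the exceptional point y
    = 0.\<close>
  have AE0: "AE y::'a in lborel. (LINT u|lborel. F \<eta> u y) = complex_of_real (sqrt pi / 2 * exp (- 2 * pi * norm y)) * cis (2 * pi * (y \<bullet> \<eta>))" for \<eta>
    using AE_lborel_singleton[of "0::'a"] by (rule eventually_mono) (rule inner)
  have si: "integrable lborel (\<lambda>y. LINT u|lborel. F \<eta> u y)" for \<eta>
    using lborel_pair.integrable_snd[OF int] by simp
  note [measurable] = borel_measurable_integrable[OF si, simplified]
  \<comment> \<open>At frequency 0 the inner integral is a multiple of exp (- 2 pi |y|), so its
    integrability is a by-product of Fubini, without polar coordinates.\<close>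
  have "integrable lborel (\<lambda>y. LINT u|lborel. F 0 u y)" by (rule si)
  then have "integrable lborel (\<lambda>y::'a. complex_of_real (sqrt pi / 2 * exp (- 2 * pi * norm y)))"
    by (subst (asm) integrable_cong_AE[OF _ _ AE0]) auto
  then have "integrable lborel (\<lambda>y::'a. sqrt pi / 2 * exp (- 2 * pi * norm y))"
    by (simp only: complex_of_real_integrable_eq)
  from integrable_mult_right[OF this, of "2 / sqrt pi"]
  show "integrable lborel (\<lambda>y::'a. exp (- 2 * pi * norm y))"
    by simp
  have "complex_of_real (sqrt pi / 2) *
      (LINT y|lborel. complex_of_real (exp (- 2 * pi * norm y)) * cis (2 * pi * (y \<bullet> \<xi>)))
     = (LINT y|lborel. complex_of_real (sqrt pi / 2 * exp (- 2 * pi * norm y)) * cis (2 * pi * (y \<bullet> \<xi>)))"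
    by (simp add: mult.assoc)
  also have "\<dots> = (LINT y|lborel. LINT u|lborel. F \<xi> u y)"
    unfolding cis_conv_exp using AE0[of \<xi>] by (intro integral_cong_AE) (auto simp: cis_conv_exp)
  also have "\<dots> = (LINT u|lborel. LINT y|lborel. F \<xi> u y)"
    by (rule lborel_pair.Fubini_integral[OF int])
  also have "\<dots> = (LINT u|lborel. complex_of_real (indicator {0<..} u * ((u / sqrt pi) ^ DIM('a) * exp (- (u * sqrt (1 + (norm \<xi>)\<^sup>2))\<^sup>2))))"
  proof (intro Bochner_Integration.integral_cong refl)
    fix u :: real
    show "(LINT y|lborel. F \<xi> u y) = complex_of_real (indicator {0<..} u * ((u / sqrt pi) ^ DIM('a) * exp (- (u * sqrt (1 + (norm \<xi>)\<^sup>2))\<^sup>2)))"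
    proof (cases "u > 0")
      case True
      have "(LINT y|lborel. F \<xi> u y) = complex_of_real (exp (- u\<^sup>2)) * (LINT y|lborel. complex_of_real (exp (- (pi * norm y / u)\<^sup>2)) * cis (2 * pi * (y \<bullet> \<xi>)))"
        unfolding F_def using True by (simp add: mult.assoc)
      also have "\<dots> = complex_of_real ((u / sqrt pi) ^ DIM('a) * (exp (- u\<^sup>2) * exp (- (u * norm \<xi>)\<^sup>2)))"
        unfolding gauss_fourier[OF True] by (simp only: of_real_mult mult_ac)
      also have "exp (- u\<^sup>2) * exp (- (u * norm \<xi>)\<^sup>2) = exp (- (u * sqrt (1 + (norm \<xi>)\<^sup>2))\<^sup>2)"
        by (simp add: power_mult_distrib algebra_simps add_nonneg_nonneg flip: exp_add)
      finally show ?thesis using True by simp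
    qed (simp add: F_def)
  qed
  finally show "complex_of_real (sqrt pi / 2) *
      (LINT y|lborel. complex_of_real (exp (- 2 * pi * norm y)) * cis (2 * pi * (y \<bullet> \<xi>)))
      = complex_of_real (LINT u|lborel. indicator {0<..} u * ((u / sqrt pi) ^ DIM('a) * exp (- (u * sqrt (1 + (norm \<xi>)\<^sup>2))\<^sup>2)))"
    by (simp only: integral_complex_of_real)
qed

text \<open>This is the Poisson kernel pair. The Gaussian in dimension d contributes
  \<open>u\<close> to the power d, so the integral over \<open>u\<close> scales like the power d + 1
  of \<open>inverse c\<close> with \<open>c = sqrt (1 + (norm \<xi>)\<^sup>2)\<close>: hence the
  exponent of the weight. \<open>C\<close> collects the constants.\<close>

lemma weight_eq_fourier:
  obtains C where "C > 0" "\<And>\<xi>::'a::euclidean_space.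
    complex_of_real ((1 + (norm \<xi>)\<^sup>2) powr (- (real DIM('a) + 1) / 2)) =
    (LINT y|lborel. complex_of_real (C * exp (- 2 * pi * norm y)) * cis (2 * pi * (y \<bullet> \<xi>)))"
proof -
  obtain \<kappa> :: real where \<kappa>: "\<kappa> > 0" "\<And>c::real. c > 0 \<Longrightarrow>
    has_bochner_integral lborel (\<lambda>u. indicator {0<..} u * (u ^ DIM('a) * exp (- (u * c)\<^sup>2))) (\<kappa> * inverse c ^ Suc (DIM('a)))"
    using power_gauss_integral[of "DIM('a)"] by blast
  define C where "C = sqrt pi / 2 * sqrt pi ^ DIM('a) / \<kappa>"
  have "C > 0" using \<kappa>(1) by (simp add: C_def)
  moreover have "complex_of_real ((1 + (norm \<xi>)\<^sup>2) powr (- (real DIM('a) + 1) / 2)) =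
    (LINT y|lborel. complex_of_real (C * exp (- 2 * pi * norm y)) * cis (2 * pi * (y \<bullet> \<xi>)))" for \<xi> :: 'a
  proof -
    define c where "c = sqrt (1 + (norm \<xi>)\<^sup>2)"
    have p: "1 + (norm \<xi>)\<^sup>2 > 0" by (simp add: add_pos_nonneg)
    then have c: "c > 0" by (simp add: c_def)
    have w: "(1 + (norm \<xi>)\<^sup>2) powr (- (real DIM('a) + 1) / 2) = inverse c ^ Suc (DIM('a))"
    proof -
      have "inverse c ^ Suc (DIM('a)) = inverse (c powr (real (Suc DIM('a))))"
        using c by (simp only: powr_realpow power_inverse)
      also have "\<dots> = c powr (- real (Suc DIM('a)))"
        by (simp only: powr_minus)
      also have "\<dots> = ((1 + (norm \<xi>)\<^sup>2) powr (1 / 2)) powr (- real (Suc DIM('a)))"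
        using p by (simp add: c_def powr_half_sqrt)
      also have "\<dots> = (1 + (norm \<xi>)\<^sup>2) powr (1 / 2 * (- real (Suc DIM('a))))"
        by (rule powr_powr)
      also have "1 / 2 * (- real (Suc DIM('a))) = - (real DIM('a) + 1) / 2"
        by simp
      finally show ?thesis by simp
    qed
    have "(LINT u|lborel. indicator {0<..} u * ((u / sqrt pi) ^ DIM('a) * exp (- (u * c)\<^sup>2)))
      = (LINT u|lborel. (indicator {0<..} u * (u ^ DIM('a) * exp (- (u * c)\<^sup>2))) / sqrt pi ^ DIM('a))"
      by (intro Bochner_Integration.integral_cong refl) (simp add: power_divide)
    also have "\<dots> = \<kappa> * inverse c ^ Suc (DIM('a)) / sqrt pi ^ DIM('a)"
      using \<kappa>(2)[OF c] by (simp add: has_bochner_integral_iff)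
    finally have "complex_of_real (sqrt pi / 2) *
      (LINT y|lborel. complex_of_real (exp (- 2 * pi * norm y)) * cis (2 * pi * (y \<bullet> \<xi>)))
       = complex_of_real (\<kappa> * inverse c ^ Suc (DIM('a)) / sqrt pi ^ DIM('a))"
      unfolding fourier_exp_norm[of \<xi>] c_def by (simp only: )
    then have "complex_of_real (sqrt pi ^ DIM('a) / \<kappa>) * (complex_of_real (sqrt pi / 2) *
      (LINT y|lborel. complex_of_real (exp (- 2 * pi * norm y)) * cis (2 * pi * (y \<bullet> \<xi>))))
       = complex_of_real (sqrt pi ^ DIM('a) / \<kappa> * (\<kappa> * inverse c ^ Suc (DIM('a)) / sqrt pi ^ DIM('a)))"
      by (simp only: of_real_mult)
    also have "sqrt pi ^ DIM('a) / \<kappa> * (\<kappa> * inverse c ^ Suc (DIM('a)) / sqrt pi ^ DIM('a)) = inverse c ^ Suc (DIM('a))"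
      using \<kappa>(1) by simp
    finally have "complex_of_real C * (LINT y|lborel. complex_of_real (exp (- 2 * pi * norm y)) * cis (2 * pi * (y \<bullet> \<xi>)))
       = complex_of_real (inverse c ^ Suc (DIM('a)))"
      by (simp add: C_def field_simps)
    then show ?thesis unfolding w by (simp add: mult.assoc)
  qed
  ultimately show ?thesis by (rule that)
qed

section \<open>Fourier inversion for nonnegative kernels\<close>

lemma
  fixes f :: "'a::euclidean_space \<Rightarrow> 'b::{banach, second_countable_topology}"
  assumes c: "c \<noteq> 0" and [measurable]: "f \<in> borel_measurable borel"
  shows lborel_integral_affine: "(LINT x|lborel. f x) = \<bar>c\<bar> ^ DIM('a) *\<^sub>R (LINT x|lborel. f (t + c *\<^sub>R x))"
    and lborel_integrable_affine: "integrable lborel (\<lambda>x. f (t + c *\<^sub>R x)) \<longleftrightarrow> integrable lborel f"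
proof -
  have "(LINT x|lborel. f x) = (LINT x|density (distr lborel borel (\<lambda>x::'a. t + c *\<^sub>R x)) (\<lambda>_. \<bar>c\<bar> ^ DIM('a)). f x)"
    using lborel_affine[OF c, of t] by simp
  also have "\<dots> = \<bar>c\<bar> ^ DIM('a) *\<^sub>R (LINT x|lborel. f (t + c *\<^sub>R x))"
    by (simp add: integral_density integral_distr)
  finally show "(LINT x|lborel. f x) = \<bar>c\<bar> ^ DIM('a) *\<^sub>R (LINT x|lborel. f (t + c *\<^sub>R x))" .
  have "integrable lborel f \<longleftrightarrow> integrable (density (distr lborel borel (\<lambda>x::'a. t + c *\<^sub>R x)) (\<lambda>_. \<bar>c\<bar> ^ DIM('a))) f"
    using lborel_affine[OF c, of t] by simp
  also have "\<dots> \<longleftrightarrow> integrable lborel (\<lambda>x. f (t + c *\<^sub>R x))"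
  proof -
    have "integrable lborel (\<lambda>x. \<bar>c\<bar> ^ DIM('a) *\<^sub>R f (t + c *\<^sub>R x)) \<longleftrightarrow> integrable lborel (\<lambda>x. f (t + c *\<^sub>R x))"
      using integrable_scaleR_right[of "inverse (\<bar>c\<bar> ^ DIM('a))" lborel "\<lambda>x. \<bar>c\<bar> ^ DIM('a) *\<^sub>R f (t + c *\<^sub>R x)"] c
      by auto
    then show ?thesis
      by (simp add: integrable_density integrable_distr_eq)
  qed
  finally show "integrable lborel (\<lambda>x. f (t + c *\<^sub>R x)) \<longleftrightarrow> integrable lborel f" ..
qed

lemma lborel_integral_translate:
  fixes f :: "'a::euclidean_space \<Rightarrow> 'b::{banach, second_countable_topology}"
  assumes "f \<in> borel_measurable borel"
  shows "(LINT x|lborel. f (x + t)) = (LINT x|lborel. f x)"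
  using lborel_integral_affine[of 1 f t] assms by (simp add: add.commute)

lemma lborel_integrable_translate:
  fixes f :: "'a::euclidean_space \<Rightarrow> 'b::{banach, second_countable_topology}"
  assumes "f \<in> borel_measurable borel"
  shows "integrable lborel (\<lambda>x. f (x + t)) \<longleftrightarrow> integrable lborel f"
  using lborel_integrable_affine[of 1 f t] assms by (simp add: add.commute)

lemma integrable_lborel_pair_bound:
  fixes F :: "'a::euclidean_space \<times> 'b::euclidean_space \<Rightarrow> complex"
  assumes [measurable]: "F \<in> borel_measurable (lborel \<Otimes>\<^sub>M lborel)"
    and f: "integrable lborel f" and g: "integrable lborel g"
    and le: "\<And>x y. norm (F (x, y)) \<le> \<bar>f x\<bar> * \<bar>g y :: real\<bar>"
  shows "integrable (lborel \<Otimes>\<^sub>M lborel) F"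
proof -
  have [measurable]: "f \<in> borel_measurable borel" "g \<in> borel_measurable borel"
    using f g by auto
  have "integrable (lborel \<Otimes>\<^sub>M lborel) (\<lambda>(x, y). \<bar>f x\<bar> * \<bar>g y\<bar>)"
    by (rule lborel_pair.Fubini_integrable) (use f g in auto)
  then show ?thesis
    by (rule Bochner_Integration.integrable_bound) (use le in auto)
qed

text \<open>Gauss-Weierstrass summation: by Fubini, the integral damped by the Gaussian
  \<open>E n\<close> is an average of \<open>g\<close> around \<open>\<eta>\<close> at scale
  \<open>1 / real (Suc n)\<close>, and so tends to \<open>g \<eta>\<close>. As \<open>K\<close> is
  nonnegative, the limit at frequency 0 already forces integrability by monotone convergence;
  dominated convergence then removes the damping at every \<open>\<eta>\<close>.\<close>

lemma fourier_inversion_nonneg: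
  fixes g K :: "'a::euclidean_space \<Rightarrow> real"
  assumes cont: "continuous_on UNIV g" and int: "integrable lborel g" and bd: "\<And>x. \<bar>g x\<bar> \<le> B"
    and K: "\<And>x. complex_of_real (K x) = (LINT \<xi>|lborel. complex_of_real (g \<xi>) * cis (2 * pi * (\<xi> \<bullet> x)))"
    and nonneg: "\<And>x. K x \<ge> 0"
  shows "integrable lborel K"
    and "(LINT x|lborel. complex_of_real (K x) * cis (- (2 * pi * (x \<bullet> \<eta>)))) = complex_of_real (g \<eta>)"
proof -
  define E where "E n x = exp (- (pi * norm x / real (Suc n))\<^sup>2)" for n and x :: 'a
  have [measurable]: "E n \<in> borel_measurable borel" for n unfolding E_def by measurable
  have [measurable]: "g \<in> borel_measurable borel" using int by auto
  have Kre: "K = (\<lambda>x. Re (LINT \<xi>|lborel. complex_of_real (g \<xi>) * cis (2 * pi * (\<xi> \<bullet> x))))"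
    using K by (metis Re_complex_of_real)
  have [measurable]: "K \<in> borel_measurable borel"
    unfolding Kre cis_conv_exp by measurable
  have E_int: "integrable lborel (E n)" for n
    unfolding E_def by (rule gauss_integrable) simp
  have K_le: "K x \<le> (LINT \<xi>|lborel. \<bar>g \<xi>\<bar>)" for x
  proof -
    have "K x = norm (complex_of_real (K x))" using nonneg[of x] by simp
    also have "\<dots> \<le> (LINT \<xi>|lborel. norm (complex_of_real (g \<xi>) * cis (2 * pi * (\<xi> \<bullet> x))))"
      unfolding K by (rule integral_norm_bound)
    finally show ?thesis by (simp add: norm_mult)
  qed
  have KE_int: "integrable lborel (\<lambda>x. K x * E n x)" for n
    by (rule Bochner_Integration.integrable_bound[OF integrable_mult_right[OF E_int[of n], of "LINT \<xi>|lborel. \<bar>g \<xi>\<bar>"]])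
      (auto simp: abs_mult E_def nonneg K_le intro!: mult_right_mono)
  \<comment> \<open>The Gaussian probability density to which the transform of \<open>E n\<close>
    reduces under \<open>\<xi> = \<eta> + \<zeta> / (n + 1)\<close>.\<close>
  define D where "D \<zeta> = (1 / sqrt pi) ^ DIM('a) * exp (- (norm \<zeta>)\<^sup>2)" for \<zeta> :: 'a
  have [measurable]: "D \<in> borel_measurable borel" unfolding D_def by measurable
  have D_int: "integrable lborel D"
    using gauss_integrable[of pi, where 'a='a] unfolding D_def by simp
  have D1: "(LINT \<zeta>|lborel. D \<zeta>) = 1"
  proof -
    have "complex_of_real (LINT y::'a|lborel. exp (- (norm y)\<^sup>2)) = complex_of_real ((pi / sqrt pi) ^ DIM('a))"
      using gauss_fourier[of pi "0::'a"] by simp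
    then have "(LINT y::'a|lborel. exp (- (norm y)\<^sup>2)) = (pi / sqrt pi) ^ DIM('a)"
      by (simp only: of_real_eq_iff)
    then show ?thesis
      unfolding D_def by (simp flip: power_mult_distrib power_divide)
  qed
  have step: "(LINT x|lborel. complex_of_real (K x * E n x) * cis (- (2 * pi * (x \<bullet> \<eta>))))
     = complex_of_real (LINT \<zeta>|lborel. g (\<eta> + (1 / real (Suc n)) *\<^sub>R \<zeta>) * D \<zeta>)" for n \<eta>
  proof -
    let ?u = "real (Suc n)"
    define F where "F x \<xi> = complex_of_real (g \<xi> * E n x) * cis (2 * pi * (x \<bullet> (\<xi> - \<eta>)))" for x \<xi>
    have "case_prod F \<in> borel_measurable (lborel \<Otimes>\<^sub>M lborel)"
      unfolding F_def cis_conv_exp by measurable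
    then have F_int: "integrable (lborel \<Otimes>\<^sub>M lborel) (case_prod F)"
      by (rule integrable_lborel_pair_bound[OF _ E_int[of n] int]) (simp add: F_def norm_mult abs_mult)
    have "(LINT x|lborel. complex_of_real (K x * E n x) * cis (- (2 * pi * (x \<bullet> \<eta>)))) = (LINT x|lborel. LINT \<xi>|lborel. F x \<xi>)"
    proof (intro Bochner_Integration.integral_cong refl)
      fix x
      have "complex_of_real (K x * E n x) * cis (- (2 * pi * (x \<bullet> \<eta>)))
        = complex_of_real (K x) * (complex_of_real (E n x) * cis (- (2 * pi * (x \<bullet> \<eta>))))"
        by simp
      also have "\<dots> = (LINT \<xi>|lborel. (complex_of_real (g \<xi>) * cis (2 * pi * (\<xi> \<bullet> x))) * (complex_of_real (E n x) * cis (- (2 * pi * (x \<bullet> \<eta>)))))"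
        unfolding K by (rule integral_mult_left_zero[symmetric])
      also have "\<dots> = (LINT \<xi>|lborel. F x \<xi>)"
      proof (intro Bochner_Integration.integral_cong refl)
        fix \<xi>
        have "cis (2 * pi * (x \<bullet> (\<xi> - \<eta>))) = cis (2 * pi * (\<xi> \<bullet> x)) * cis (- (2 * pi * (x \<bullet> \<eta>)))"
          by (simp add: cis_mult inner_diff_right inner_commute algebra_simps)
        then show "complex_of_real (g \<xi>) * cis (2 * pi * (\<xi> \<bullet> x)) * (complex_of_real (E n x) * cis (- (2 * pi * (x \<bullet> \<eta>)))) = F x \<xi>"
          by (simp add: F_def)
      qed
      finally show "complex_of_real (K x * E n x) * cis (- (2 * pi * (x \<bullet> \<eta>))) = (LINT \<xi>|lborel. F x \<xi>)" .
    qed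
    also have "\<dots> = (LINT \<xi>|lborel. LINT x|lborel. F x \<xi>)"
      by (rule lborel_pair.Fubini_integral[OF F_int, symmetric])
    also have "\<dots> = (LINT \<xi>|lborel. complex_of_real (g \<xi> * ((?u / sqrt pi) ^ DIM('a) * exp (- (?u * norm (\<xi> - \<eta>))\<^sup>2))))"
    proof (intro Bochner_Integration.integral_cong refl)
      fix \<xi>
      have "(LINT x|lborel. F x \<xi>) = (LINT x|lborel. complex_of_real (g \<xi>) * (complex_of_real (E n x) * cis (2 * pi * (x \<bullet> (\<xi> - \<eta>)))))"
        by (simp add: F_def mult.assoc)
      also have "\<dots> = complex_of_real (g \<xi>) * (LINT x|lborel. complex_of_real (E n x) * cis (2 * pi * (x \<bullet> (\<xi> - \<eta>))))"
        by (rule integral_mult_right_zero)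
      also have "(LINT x|lborel. complex_of_real (E n x) * cis (2 * pi * (x \<bullet> (\<xi> - \<eta>)))) = complex_of_real ((?u / sqrt pi) ^ DIM('a) * exp (- (?u * norm (\<xi> - \<eta>))\<^sup>2))"
        unfolding E_def by (rule gauss_fourier) simp
      finally show "(LINT x|lborel. F x \<xi>) = complex_of_real (g \<xi> * ((?u / sqrt pi) ^ DIM('a) * exp (- (?u * norm (\<xi> - \<eta>))\<^sup>2)))"
        by (simp only: of_real_mult)
    qed
    also have "\<dots> = complex_of_real (LINT \<xi>|lborel. g \<xi> * ((?u / sqrt pi) ^ DIM('a) * exp (- (?u * norm (\<xi> - \<eta>))\<^sup>2)))"
      by (rule integral_complex_of_real)
    also have "(LINT \<xi>|lborel. g \<xi> * ((?u / sqrt pi) ^ DIM('a) * exp (- (?u * norm (\<xi> - \<eta>))\<^sup>2)))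
       = \<bar>1 / ?u\<bar> ^ DIM('a) *\<^sub>R (LINT \<zeta>|lborel. g (\<eta> + (1 / ?u) *\<^sub>R \<zeta>) * ((?u / sqrt pi) ^ DIM('a) * exp (- (?u * norm ((\<eta> + (1 / ?u) *\<^sub>R \<zeta>) - \<eta>))\<^sup>2)))"
      by (rule lborel_integral_affine) auto
    also have "\<dots> = (LINT \<zeta>|lborel. g (\<eta> + (1 / ?u) *\<^sub>R \<zeta>) * D \<zeta>)"
      unfolding integral_scaleR_right[symmetric]
    proof (intro Bochner_Integration.integral_cong refl)
      fix \<zeta> :: 'a
      have 1: "?u * norm ((\<eta> + (1 / ?u) *\<^sub>R \<zeta>) - \<eta>) = norm \<zeta>" by simp
      have 2: "\<bar>1 / ?u\<bar> ^ DIM('a) * (?u / sqrt pi) ^ DIM('a) = (1 / sqrt pi) ^ DIM('a)"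
        by (simp flip: power_mult_distrib)
      show "\<bar>1 / ?u\<bar> ^ DIM('a) *\<^sub>R (g (\<eta> + (1 / ?u) *\<^sub>R \<zeta>) * ((?u / sqrt pi) ^ DIM('a) * exp (- (?u * norm ((\<eta> + (1 / ?u) *\<^sub>R \<zeta>) - \<eta>))\<^sup>2))) = g (\<eta> + (1 / ?u) *\<^sub>R \<zeta>) * D \<zeta>"
        unfolding 1 D_def 2[symmetric] by simp
    qed
    finally show ?thesis .
  qed
  have lim: "(\<lambda>n. LINT \<zeta>|lborel. g (\<eta> + (1 / real (Suc n)) *\<^sub>R \<zeta>) * D \<zeta>) \<longlonglongrightarrow> g \<eta>" for \<eta>
  proof -
    have "(\<lambda>n. LINT \<zeta>|lborel. g (\<eta> + (1 / real (Suc n)) *\<^sub>R \<zeta>) * D \<zeta>) \<longlonglongrightarrow> (LINT \<zeta>|lborel. g \<eta> * D \<zeta>)"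
    proof (rule integral_dominated_convergence[where w = "\<lambda>\<zeta>. B * D \<zeta>"])
      show "integrable lborel (\<lambda>\<zeta>. B * D \<zeta>)" using D_int by simp
      show "AE \<zeta> in lborel. (\<lambda>n. g (\<eta> + (1 / real (Suc n)) *\<^sub>R \<zeta>) * D \<zeta>) \<longlonglongrightarrow> g \<eta> * D \<zeta>"
      proof (rule AE_I2)
        fix \<zeta>
        have "(\<lambda>n. \<eta> + (1 / real (Suc n)) *\<^sub>R \<zeta>) \<longlonglongrightarrow> \<eta> + 0 *\<^sub>R \<zeta>"
          by (intro tendsto_intros LIMSEQ_Suc[OF lim_1_over_n])
        then have "(\<lambda>n. g (\<eta> + (1 / real (Suc n)) *\<^sub>R \<zeta>)) \<longlonglongrightarrow> g \<eta>"
          using cont isCont_tendsto_compose[of \<eta> g] by (simp add: continuous_on_eq_continuous_at)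
        then show "(\<lambda>n. g (\<eta> + (1 / real (Suc n)) *\<^sub>R \<zeta>) * D \<zeta>) \<longlonglongrightarrow> g \<eta> * D \<zeta>"
          by (intro tendsto_mult tendsto_const)
      qed
      show "AE \<zeta> in lborel. norm (g (\<eta> + (1 / real (Suc n)) *\<^sub>R \<zeta>) * D \<zeta>) \<le> B * D \<zeta>" for n
        using bd by (auto simp: abs_mult D_def intro!: mult_right_mono)
    qed auto
    then show ?thesis using D1 by simp
  qed
  have E_lim: "(\<lambda>n. E n x) \<longlonglongrightarrow> 1" for x
  proof -
    have "(\<lambda>n. pi * norm x / real (Suc n)) \<longlonglongrightarrow> 0"
      using tendsto_mult_left[OF LIMSEQ_Suc[OF lim_1_over_n], of "pi * norm x"] by simp
    from tendsto_exp[OF tendsto_minus[OF tendsto_power[OF this, of 2]]]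
    show ?thesis by (simp add: E_def)
  qed
  have KE_lim: "(\<lambda>n. K x * E n x) \<longlonglongrightarrow> K x" for x
    using tendsto_mult_left[OF E_lim, of "K x" x] by simp
  have E_mono: "mono (\<lambda>n. K x * E n x)" for x
  proof (rule monoI)
    fix m n :: nat assume "m \<le> n"
    then have "(pi * norm x / real (Suc n))\<^sup>2 \<le> (pi * norm x / real (Suc m))\<^sup>2"
      by (intro power_mono divide_left_mono) auto
    then show "K x * E m x \<le> K x * E n x"
      unfolding E_def by (intro mult_left_mono nonneg) simp
  qed
  have "(\<lambda>n. LINT x|lborel. K x * E n x) \<longlonglongrightarrow> g 0"
  proof -
    have "(LINT x|lborel. K x * E n x) = (LINT \<zeta>|lborel. g (0 + (1 / real (Suc n)) *\<^sub>R \<zeta>) * D \<zeta>)" for n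
    proof -
      have "complex_of_real (LINT x|lborel. K x * E n x) = complex_of_real (LINT \<zeta>|lborel. g (0 + (1 / real (Suc n)) *\<^sub>R \<zeta>) * D \<zeta>)"
        using step[of n 0] by (simp flip: integral_complex_of_real)
      then show ?thesis by (simp only: of_real_eq_iff)
    qed
    then show ?thesis using lim[of 0] by simp
  qed
  from integrable_monotone_convergence[OF KE_int _ _ this, of K]
  show K_int: "integrable lborel K"
    using E_mono KE_lim by simp
  have "(\<lambda>n. LINT x|lborel. complex_of_real (K x * E n x) * cis (- (2 * pi * (x \<bullet> \<eta>))))
     \<longlonglongrightarrow> (LINT x|lborel. complex_of_real (K x) * cis (- (2 * pi * (x \<bullet> \<eta>))))"
  proof (rule integral_dominated_convergence[OF _ _ K_int])
    show "AE x in lborel. (\<lambda>n. complex_of_real (K x * E n x) * cis (- (2 * pi * (x \<bullet> \<eta>)))) \<longlonglongrightarrow> complex_of_real (K x) * cis (- (2 * pi * (x \<bullet> \<eta>)))"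
      by (intro AE_I2 tendsto_intros KE_lim)
    show "AE x in lborel. norm (complex_of_real (K x * E n x) * cis (- (2 * pi * (x \<bullet> \<eta>)))) \<le> K x" for n
      using nonneg by (auto simp: norm_mult abs_mult E_def intro!: mult_left_le)
  qed (auto simp: cis_conv_exp)
  moreover have "(\<lambda>n. LINT x|lborel. complex_of_real (K x * E n x) * cis (- (2 * pi * (x \<bullet> \<eta>)))) \<longlonglongrightarrow> complex_of_real (g \<eta>)"
    unfolding step by (intro tendsto_of_real lim)
  ultimately show "(LINT x|lborel. complex_of_real (K x) * cis (- (2 * pi * (x \<bullet> \<eta>)))) = complex_of_real (g \<eta>)"
    by (rule LIMSEQ_unique)
qed

section \<open>Tail integrals and nonexpansive maps\<close>

definition unit_ball_proj :: "'a::euclidean_space \<Rightarrow> 'a" where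
  "unit_ball_proj z = (if norm z \<le> 1 then z else z /\<^sub>R norm z)"

lemma norm_unit_ball_proj_le: "norm (unit_ball_proj z) \<le> 1"
  by (cases "z = 0") (simp_all add: unit_ball_proj_def)

text \<open>The variational inequality for the nearest point of a convex set. Outside the ball,
  Cauchy-Schwarz bounds \<open>z \<bullet> y\<close> by \<open>norm z\<close>, the value attained at
  the projection.\<close>

lemma unit_ball_proj_dot:
  assumes "norm y \<le> 1"
  shows "(z - unit_ball_proj z) \<bullet> (y - unit_ball_proj z) \<le> 0"
proof (cases "norm z \<le> 1")
  case False
  then have p: "norm z > 0" by linarith
  have "z \<bullet> y \<le> norm z * norm y" by (rule norm_cauchy_schwarz)
  also have "\<dots> \<le> norm z" using assms by (simp add: mult_left_le)
  finally have zy: "z \<bullet> y \<le> norm z" .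
  have "z - unit_ball_proj z = (1 - 1 / norm z) *\<^sub>R z"
    using False by (simp add: unit_ball_proj_def scaleR_left_diff_distrib inverse_eq_divide)
  moreover have "z \<bullet> (y - unit_ball_proj z) = z \<bullet> y - norm z"
    using False p by (simp add: unit_ball_proj_def inner_diff_right dot_square_norm power2_eq_square field_simps)
  ultimately have "(z - unit_ball_proj z) \<bullet> (y - unit_ball_proj z) = (1 - 1 / norm z) * (z \<bullet> y - norm z)"
    by simp
  also have "\<dots> \<le> 0" using False p zy by (intro mult_nonneg_nonpos) auto
  finally show ?thesis .
qed (simp add: unit_ball_proj_def)

text \<open>Adding \<open>unit_ball_proj_dot\<close> at \<open>z\<close> and at \<open>w\<close>
  gives |p|^2 <= d . p, where d = z - w and p is the difference of the projections. Hence |d - p|^2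
  <= |d|^2 - |p|^2.\<close>

lemma nonexpansive_minus_unit_ball_proj:
  "norm ((z - unit_ball_proj z) - (w - unit_ball_proj w)) \<le> norm (z - w)"
proof -
  let ?d = "z - w" and ?p = "unit_ball_proj z - unit_ball_proj w"
  have 1: "(z - unit_ball_proj z) \<bullet> (unit_ball_proj w - unit_ball_proj z) \<le> 0"
    and 2: "(w - unit_ball_proj w) \<bullet> (unit_ball_proj z - unit_ball_proj w) \<le> 0"
    by (auto intro: unit_ball_proj_dot norm_unit_ball_proj_le)
  have "?p \<bullet> ?p \<le> ?d \<bullet> ?p"
    using 1 2 by (simp add: inner_diff_left inner_diff_right inner_commute algebra_simps)
  then have "(?d - ?p) \<bullet> (?d - ?p) \<le> ?d \<bullet> ?d - ?p \<bullet> ?p"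
    by (simp add: inner_diff_left inner_diff_right inner_commute algebra_simps)
  also have "\<dots> \<le> ?d \<bullet> ?d" by simp
  finally have "norm (?d - ?p) \<le> norm ?d" by (simp add: norm_le)
  then show ?thesis by (simp add: algebra_simps)
qed

text \<open>Subadditivity in the form parallel to \<open>emeasure_UN_countable\<close>: the disjoint
  Vitali balls and the balls covering their images, indexed by the same countable set, can then be
  compared term by term.\<close>

lemma emeasure_UN_countable_le:
  assumes [measurable]: "\<And>i. i \<in> I \<Longrightarrow> X i \<in> sets M" and "countable I"
  shows "emeasure M (\<Union>(X ` I)) \<le> (\<integral>\<^sup>+i. emeasure M (X i) \<partial>count_space I)"
proof -
  have "emeasure M (\<Union>(X ` I)) = (\<integral>\<^sup>+x. indicator (\<Union>(X ` I)) x \<partial>M)"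
    using assms by (intro nn_integral_indicator[symmetric] sets.countable_UN'') auto
  also have "\<dots> \<le> (\<integral>\<^sup>+x. \<integral>\<^sup>+i. indicator (X i) x \<partial>count_space I \<partial>M)"
  proof (rule nn_integral_mono)
    fix x
    show "indicator (\<Union>(X ` I)) x \<le> (\<integral>\<^sup>+i. indicator (X i) x \<partial>count_space I)"
    proof (cases "x \<in> \<Union>(X ` I)")
      case True
      then obtain i where "i \<in> I" "x \<in> X i" by auto
      then show ?thesis
        using nn_integral_ge_point[of i I "\<lambda>i. indicator (X i) x"] True by simp
    qed simp
  qed
  also have "\<dots> = (\<integral>\<^sup>+i. \<integral>\<^sup>+x. indicator (X i) x \<partial>M \<partial>count_space I)"
    using assms by (intro nn_integral_count_space_nn_integral) auto
  also have "\<dots> = (\<integral>\<^sup>+i. emeasure M (X i) \<partial>count_space I)"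
    using assms by (intro nn_integral_cong) auto
  finally show ?thesis .
qed

text \<open>A nonexpansive map sends a ball into a ball of the same radius. Vitali's theorem fills
  an open set, of measure only slightly larger than that of \<open>E\<close>, with disjoint balls up
  to a null set, and the image of that null set is null because \<open>f\<close> is Lipschitz. A
  measurable \<open>A\<close> inside the image stands in for the image itself, which need not be
  Borel.\<close>

lemma emeasure_nonexpansive_image:
  fixes f :: "'a::euclidean_space \<Rightarrow> 'a"
  assumes f: "\<And>x y. norm (f x - f y) \<le> norm (x - y)"
    and E: "E \<in> sets lborel" and A: "A \<in> sets lborel" "A \<subseteq> f ` E"
  shows "emeasure lborel A \<le> emeasure lborel E"
proof (rule ennreal_le_epsilon)
  fix e :: real assume "emeasure lborel E < top" "0 < e"
  obtain U where U: "open U" "E \<subseteq> U" "emeasure lborel (U - E) < e"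
    using outer_regular_lborel[OF _ \<open>0 < e\<close>, of E] E by auto
  have UE: "emeasure lborel U \<le> emeasure lborel E + e"
  proof -
    have "emeasure lborel U = emeasure lborel E + emeasure lborel (U - E)"
      using U E by (subst plus_emeasure) (auto simp: Un_absorb1)
    then show ?thesis using U(3) by (simp add: add_left_mono)
  qed
  let ?K = "{(x, r). ball x r \<subseteq> U \<and> 0 < r}"
  have "\<exists>i. i \<in> ?K \<and> x \<in> ball (fst i) (snd i) \<and> snd i < d" if "x \<in> U" "0 < d" for x d
  proof -
    obtain r where r: "r > 0" "ball x r \<subseteq> U" using U(1) \<open>x \<in> U\<close> openE by blast
    have "ball x (min r (d / 2)) \<subseteq> U" using r by auto
    then show ?thesis using r \<open>0 < d\<close> by (intro exI[of _ "(x, min r (d / 2))"]) auto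
  qed
  note cov = this
  obtain C where C: "countable C" "C \<subseteq> ?K"
     "pairwise (\<lambda>i j. disjnt (ball (fst i) (snd i)) (ball (fst j) (snd j))) C"
     "negligible (U - (\<Union>i\<in>C. ball (fst i) (snd i)))"
    by (rule Vitali_covering_theorem_balls[of U ?K fst snd, OF cov]) (assumption | rule that)+
  define N where "N = U - (\<Union>i\<in>C. ball (fst i) (snd i))"
  have "negligible (f ` N)"
    using C(4) f unfolding N_def[symmetric]
    by (intro negligible_locally_Lipschitz_image exI[of _ UNIV] exI[of _ "1::real"]) auto
  then obtain N' where N': "f ` N \<subseteq> N'" "N' \<in> null_sets lborel"
    by (auto simp: negligible_iff_null_sets null_sets_completion_iff2)
  have disj: "disjoint_family_on (\<lambda>i. ball (fst i) (snd i)) C"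
    using C(3) by (auto simp: disjoint_family_on_def pairwise_def disjnt_def)
  have sub: "A \<subseteq> N' \<union> (\<Union>i\<in>C. cball (f (fst i)) (snd i))"
  proof
    fix a assume "a \<in> A"
    then obtain x where x: "x \<in> E" "a = f x" using A(2) by auto
    show "a \<in> N' \<union> (\<Union>i\<in>C. cball (f (fst i)) (snd i))"
    proof (cases "x \<in> N")
      case True then show ?thesis using N' x by auto
    next
      case False
      then obtain i where i: "i \<in> C" "x \<in> ball (fst i) (snd i)" using x U(2) by (auto simp: N_def)
      then have "dist (f (fst i)) (f x) \<le> snd i"
        using f[of "fst i" x] by (simp add: dist_norm)
      then show ?thesis using i x by auto
    qed
  qed
  have [measurable]: "N' \<in> sets borel" "(\<Union>i\<in>C. cball (f (fst i)) (snd i)) \<in> sets borel"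
    using N'(2) C(1) by (auto intro!: sets.countable_UN'')
  have "emeasure lborel A \<le> emeasure lborel (N' \<union> (\<Union>i\<in>C. cball (f (fst i)) (snd i)))"
    using N' C(1) sub by (intro emeasure_mono) auto
  also have "\<dots> \<le> emeasure lborel N' + emeasure lborel (\<Union>i\<in>C. cball (f (fst i)) (snd i))"
    using N' C(1) by (intro emeasure_subadditive) auto
  also have "\<dots> = emeasure lborel (\<Union>i\<in>C. cball (f (fst i)) (snd i))"
    using N' by (simp add: null_setsD1)
  also have "\<dots> \<le> (\<integral>\<^sup>+i. emeasure lborel (cball (f (fst i)) (snd i)) \<partial>count_space C)"
    using C(1) by (intro emeasure_UN_countable_le) auto
  also have "\<dots> = (\<integral>\<^sup>+i. emeasure lborel (ball (fst i) (snd i)) \<partial>count_space C)"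
    using C(2) by (intro nn_integral_cong) (auto simp: emeasure_ball emeasure_cball)
  also have "\<dots> = emeasure lborel (\<Union>i\<in>C. ball (fst i) (snd i))"
    using C(1) disj by (intro emeasure_UN_countable[symmetric]) auto
  also have "\<dots> \<le> emeasure lborel U"
  proof (rule emeasure_mono)
    have "ball (fst i) (snd i) \<subseteq> U" if "i \<in> C" for i
      using subsetD[OF C(2) that] by auto
    then show "(\<Union>i\<in>C. ball (fst i) (snd i)) \<subseteq> U" by (rule UN_least)
  qed (use U(1) in auto)
  finally show "emeasure lborel A \<le> emeasure lborel E + e"
    using UE by (rule order_trans)
qed

text \<open>
  The map \<open>z \<mapsto> z - unit_ball_proj z\<close> is nonexpansive and carries \<open>{z. t + 1 \<le> norm z}\<close> onto
  \<open>{x. t \<le> norm x} - {0}\<close>, so its push-forward of Lebesgue measure dominates Lebesgue measure there.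
\<close>

lemma tail_integral_shift:
  fixes K :: "'a::euclidean_space \<Rightarrow> real"
  assumes int: "integrable lborel K" and nonneg: "\<And>x. K x \<ge> 0"
    and harnack: "\<And>x h. K x \<le> exp (2 * pi * norm h) * K (x + h)" and t: "t \<ge> 0"
  shows "(LINT x:{x. t \<le> norm x}|lborel. K x) \<le> exp (2 * pi) * (LINT x:{x. t + 1 \<le> norm x}|lborel. K x)"
proof -
  have [measurable]: "K \<in> borel_measurable borel" using int by auto
  define f where "f z = z - unit_ball_proj z" for z :: 'a
  have [measurable]: "f \<in> borel_measurable borel"
    unfolding f_def unit_ball_proj_def by measurable
  \<comment> \<open>The origin lies in the tail only for \<open>t = 0\<close>. It is dropped, as a
    null set, because the preimage constructed below divides by \<open>norm x\<close>.\<close>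
  define S where "S = {x::'a. t \<le> norm x} - {0}"
  define T where "T = {z::'a. t + 1 \<le> norm z}"
  have [measurable]: "S \<in> sets borel" "T \<in> sets borel" unfolding S_def T_def by measurable
  have f_eq: "f z = z - z /\<^sub>R norm z" if "norm z \<ge> 1" for z
    using that by (auto simp: f_def unit_ball_proj_def)
  have surj: "S \<subseteq> f ` T"
  proof
    fix x assume x: "x \<in> S"
    then have p: "norm x > 0" by (simp add: S_def)
    define z where "z = ((norm x + 1) / norm x) *\<^sub>R x"
    have nz: "norm z = norm x + 1" using p by (simp add: z_def)
    have "z /\<^sub>R norm z = (1 / norm x) *\<^sub>R x"
      unfolding nz using p add_pos_pos[OF p zero_less_one] by (simp add: z_def divide_simps)
    then have "f z = ((norm x + 1) / norm x - 1 / norm x) *\<^sub>R x"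
      using p nz f_eq[of z] by (simp add: z_def scaleR_left_diff_distrib)
    also have "(norm x + 1) / norm x - 1 / norm x = 1"
      using p by (simp add: field_simps)
    finally have "f z = x" by simp
    moreover have "z \<in> T" using x nz by (simp add: S_def T_def)
    ultimately show "x \<in> f ` T" by force
  qed
  define \<nu> where "\<nu> = distr (density lborel (indicator T)) borel f"
  have le: "density lborel (indicator S) \<le> \<nu>"
    unfolding \<nu>_def
  proof (subst le_measure, simp, intro ballI)
    fix A assume "A \<in> sets (density lborel (indicator S :: 'a \<Rightarrow> ennreal))"
    then have [measurable]: "A \<in> sets borel" by simp
    have [measurable]: "f -` A \<in> sets borel"
      using measurable_sets[of f borel borel A] by simp
    have "emeasure (density lborel (indicator S)) A = emeasure lborel (S \<inter> A)"
      by (subst emeasure_density) (auto simp: nn_integral_indicator[symmetric] indicator_inter_arith[symmetric] simp del: nn_integral_indicator)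
    also have "\<dots> \<le> emeasure lborel (T \<inter> (f -` A \<inter> space borel))"
      using surj by (intro emeasure_nonexpansive_image[of f]) (auto simp: f_def nonexpansive_minus_unit_ball_proj)
    also have "\<dots> = emeasure (density lborel (indicator T)) (f -` A \<inter> space borel)"
      by (subst emeasure_density) (auto simp: nn_integral_indicator[symmetric] indicator_inter_arith[symmetric] simp del: nn_integral_indicator)
    also have "\<dots> = emeasure (distr (density lborel (indicator T)) borel f) A"
      by (subst emeasure_distr) auto
    finally show "emeasure (density lborel (indicator S)) A \<le> emeasure (distr (density lborel (indicator T)) borel f) A" .
  qed
  have i: "integrable lborel (\<lambda>x. indicator A x * K x)" if "A \<in> sets borel" for A
    using integrable_mult_indicator[OF _ int, of A] that by simp
  have eq: "ennreal (LINT x:A|lborel. K x) = (\<integral>\<^sup>+x. indicator A x * ennreal (K x) \<partial>lborel)" if "A \<in> sets borel" for A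
    using i[OF that] nonneg unfolding set_lebesgue_integral_def
    by (subst nn_integral_eq_integral[symmetric]) (auto simp: indicator_def intro!: nn_integral_cong)
  have "ennreal (LINT x:{x. t \<le> norm x}|lborel. K x) = (\<integral>\<^sup>+x. indicator {x. t \<le> norm x} x * ennreal (K x) \<partial>lborel)"
    by (rule eq) measurable
  also have "\<dots> = (\<integral>\<^sup>+x. indicator S x * ennreal (K x) \<partial>lborel)"
    using AE_lborel_singleton[of "0::'a"] by (intro nn_integral_cong_AE) (auto simp: S_def indicator_def elim!: eventually_mono)
  also have "\<dots> = (\<integral>\<^sup>+x. ennreal (K x) \<partial>density lborel (indicator S))"
    by (subst nn_integral_density) auto
  also have "\<dots> \<le> (\<integral>\<^sup>+x. ennreal (K x) \<partial>\<nu>)"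
    using le by (intro nn_integral_mono_measure) (auto simp: \<nu>_def)
  also have "\<dots> = (\<integral>\<^sup>+z. indicator T z * ennreal (K (f z)) \<partial>lborel)"
    unfolding \<nu>_def by (subst nn_integral_distr) (auto simp: nn_integral_density)
  also have "\<dots> \<le> (\<integral>\<^sup>+z. ennreal (exp (2 * pi)) * (indicator T z * ennreal (K z)) \<partial>lborel)"
  proof (rule nn_integral_mono)
    fix z
    \<comment> \<open>Harnack with displacement \<open>unit_ball_proj z\<close>, of norm at most 1,
      which leads from \<open>f z\<close> to \<open>z\<close>; this is the factor
      \<open>exp (2 * pi)\<close>.\<close>
    have "K (f z) \<le> exp (2 * pi) * K z"
    proof -
      have "K (f z) \<le> exp (2 * pi * norm (unit_ball_proj z)) * K (f z + unit_ball_proj z)"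
        by (rule harnack)
      also have "\<dots> \<le> exp (2 * pi) * K z"
        using norm_unit_ball_proj_le[of z] nonneg by (intro mult_mono) (auto simp: f_def)
      finally show ?thesis .
    qed
    then show "indicator T z * ennreal (K (f z)) \<le> ennreal (exp (2 * pi)) * (indicator T z * ennreal (K z))"
      by (auto simp: indicator_def nonneg ennreal_mult[symmetric] intro!: ennreal_leI)
  qed
  also have "\<dots> = ennreal (exp (2 * pi)) * (\<integral>\<^sup>+z. indicator T z * ennreal (K z) \<partial>lborel)"
    by (rule nn_integral_cmult) measurable
  also have "(\<integral>\<^sup>+z. indicator T z * ennreal (K z) \<partial>lborel) = ennreal (LINT x:T|lborel. K x)"
    by (rule eq[symmetric]) measurable
  also have "ennreal (exp (2 * pi)) * \<dots> = ennreal (exp (2 * pi) * (LINT x:T|lborel. K x))"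
    by (rule ennreal_mult[symmetric]) (auto simp: set_lebesgue_integral_def nonneg intro!: integral_nonneg)
  finally show ?thesis
    unfolding T_def
    by (subst (asm) ennreal_le_iff) (auto simp: set_lebesgue_integral_def nonneg intro!: integral_nonneg)
qed

section \<open>The kernel of a radial bump\<close>

lemma
  fixes f :: "'a::euclidean_space \<Rightarrow> real"
  assumes cont: "continuous_on UNIV f" and supp: "\<And>x. norm x \<ge> 1 \<Longrightarrow> f x = 0"
  shows integrable_continuous_unit_ball: "integrable lborel f"
    and bounded_continuous_unit_ball: "\<exists>B. \<forall>x. \<bar>f x\<bar> \<le> B"
proof -
  have "integrable lborel (\<lambda>x. indicator (cball 0 1) x *\<^sub>R f x)"
    by (intro borel_integrable_compact continuous_on_subset[OF cont]) auto
  also have "(\<lambda>x. indicator (cball 0 1) x *\<^sub>R f x) = f"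
    using supp by (force simp: indicator_def)
  finally show "integrable lborel f" .
  have "compact (f ` cball 0 1)"
    by (intro compact_continuous_image continuous_on_subset[OF cont]) auto
  then obtain B where B: "\<And>x. x \<in> cball 0 1 \<Longrightarrow> \<bar>f x\<bar> \<le> B"
    by (force simp: bounded_iff dest: compact_imp_bounded)
  have "\<bar>f x\<bar> \<le> max B 0" for x
    using B[of x] supp[of x] by (cases "norm x \<le> 1") auto
  then show "\<exists>B. \<forall>x. \<bar>f x\<bar> \<le> B" by blast
qed

locale radial_bump =
  fixes \<phi> :: "real^'d \<Rightarrow> real"
  assumes cont: "continuous_on UNIV \<phi>"
    and radial: "radial \<phi>"
    and supp: "\<And>\<xi>. norm \<xi> \<ge> 1/2 \<Longrightarrow> \<phi> \<xi> = 0"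
    and l2: "(LINT \<xi>|lborel. (\<phi> \<xi>)\<^sup>2) = 1"
begin

lemma phi_measurable[measurable]: "\<phi> \<in> borel_measurable borel"
  using cont by (rule borel_measurable_continuous_onI)

lemma phi_eq_0: "norm \<xi> \<ge> 1 \<Longrightarrow> \<phi> \<xi> = 0"
  by (rule supp) simp

lemma phi_integrable: "integrable lborel \<phi>"
  by (intro integrable_continuous_unit_ball cont phi_eq_0)

abbreviation "conv \<equiv> convolve \<phi> \<phi>"

text \<open>If \<open>\<xi>\<close> has norm at least 1, then \<open>\<eta>\<close> or
  \<open>\<xi> - \<eta>\<close> has norm at least 1/2. The two radii 1/2 adding up to 1 is what
  later confines the frequencies to norm less than \<open>R\<close>.\<close>

lemma conv_eq_0: "norm \<xi> \<ge> 1 \<Longrightarrow> conv \<xi> = 0"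
proof -
  assume "norm \<xi> \<ge> 1"
  then have "\<phi> \<eta> * \<phi> (\<xi> - \<eta>) = 0" for \<eta>
    using supp[of \<eta>] supp[of "\<xi> - \<eta>"] norm_triangle_ineq[of \<eta> "\<xi> - \<eta>"]
    by (cases "norm \<eta> \<ge> 1/2") auto
  then have "(\<lambda>\<eta>. \<phi> \<eta> * \<phi> (\<xi> - \<eta>)) = (\<lambda>_. 0)" by (rule ext)
  then show ?thesis unfolding convolve_def by (simp only: Bochner_Integration.integral_zero)
qed

lemma conv_continuous: "continuous_on UNIV conv"
  unfolding continuous_on_eq_continuous_at[OF open_UNIV]
proof (intro ballI)
  fix \<xi> :: "real^'d"
  obtain B where B: "\<And>\<eta>. \<bar>\<phi> \<eta>\<bar> \<le> B"
    using bounded_continuous_unit_ball[OF cont phi_eq_0] by blast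
  show "isCont conv \<xi>"
    unfolding continuous_at_sequentially
  proof (intro allI impI)
    fix s assume s: "s \<longlonglongrightarrow> \<xi>"
    show "(conv \<circ> s) \<longlonglongrightarrow> conv \<xi>"
      unfolding comp_def convolve_def
    proof (rule integral_dominated_convergence[where w = "\<lambda>\<eta>. \<bar>\<phi> \<eta>\<bar> * B"])
      show "AE \<eta> in lborel. (\<lambda>n. \<phi> \<eta> * \<phi> (s n - \<eta>)) \<longlonglongrightarrow> \<phi> \<eta> * \<phi> (\<xi> - \<eta>)"
      proof (rule AE_I2)
        fix \<eta>
        have "(\<lambda>n. s n - \<eta>) \<longlonglongrightarrow> \<xi> - \<eta>" by (intro tendsto_intros s)
        then have "(\<lambda>n. \<phi> (s n - \<eta>)) \<longlonglongrightarrow> \<phi> (\<xi> - \<eta>)"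
          using cont isCont_tendsto_compose[of "\<xi> - \<eta>" \<phi>] by (simp add: continuous_on_eq_continuous_at)
        then show "(\<lambda>n. \<phi> \<eta> * \<phi> (s n - \<eta>)) \<longlonglongrightarrow> \<phi> \<eta> * \<phi> (\<xi> - \<eta>)"
          by (intro tendsto_mult tendsto_const)
      qed
      show "integrable lborel (\<lambda>\<eta>. \<bar>\<phi> \<eta>\<bar> * B)" using phi_integrable by simp
      show "AE \<eta> in lborel. norm (\<phi> \<eta> * \<phi> (s n - \<eta>)) \<le> \<bar>\<phi> \<eta>\<bar> * B" for n
        by (auto simp: abs_mult intro!: mult_left_mono B)
    qed auto
  qed
qed

lemma conv_measurable[measurable]: "conv \<in> borel_measurable borel"
  using conv_continuous by (rule borel_measurable_continuous_onI)

lemma conv_integrable: "integrable lborel conv"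
  by (intro integrable_continuous_unit_ball conv_continuous conv_eq_0)

definition phihat :: "real^'d \<Rightarrow> complex" where
  "phihat z = (LINT \<xi>|lborel. complex_of_real (\<phi> \<xi>) * cis (2 * pi * (\<xi> \<bullet> z)))"

text \<open>A radial function is even, so the reflection of the variable undoes the
  conjugation.\<close>

lemma phihat_real: "complex_of_real (Re (phihat z)) = phihat z"
proof -
  have "cnj (phihat z) = (LINT \<xi>|lborel. cnj (complex_of_real (\<phi> \<xi>) * cis (2 * pi * (\<xi> \<bullet> z))))"
    unfolding phihat_def by (rule Bochner_Integration.integral_cnj[symmetric])
  also have "\<dots> = (LINT \<xi>|lborel. complex_of_real (\<phi> (- \<xi>)) * cis (2 * pi * ((- \<xi>) \<bullet> z)))"
    by (simp add: cis_cnj radial_minus[OF radial])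
  also have "\<dots> = phihat z"
    unfolding phihat_def by (rule lborel_integral_minus)
  finally show ?thesis by (metis Reals_cnj_iff of_real_Re)
qed

lemma phihat_bounded: "\<bar>Re (phihat z)\<bar> \<le> (LINT \<xi>|lborel. \<bar>\<phi> \<xi>\<bar>)"
proof -
  have "\<bar>Re (phihat z)\<bar> \<le> norm (phihat z)" by (rule abs_Re_le_cmod)
  also have "\<dots> \<le> (LINT \<xi>|lborel. norm (complex_of_real (\<phi> \<xi>) * cis (2 * pi * (\<xi> \<bullet> z))))"
    unfolding phihat_def by (rule integral_norm_bound)
  finally show ?thesis by (simp add: norm_mult)
qed

lemma phihat_measurable[measurable]: "phihat \<in> borel_measurable borel"
  unfolding phihat_def cis_conv_exp by measurable

text \<open>The convolution theorem. Because \<open>phihat\<close> is real, its square is a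
  nonnegative number; this is the source of the positivity of the kernel.\<close>

lemma fourier_conv:
  "(LINT \<xi>|lborel. complex_of_real (conv \<xi>) * cis (2 * pi * (\<xi> \<bullet> z))) = complex_of_real ((Re (phihat z))\<^sup>2)"
proof -
  define F where "F \<eta> \<xi> = complex_of_real (\<phi> \<eta> * \<phi> (\<xi> - \<eta>)) * cis (2 * pi * (\<xi> \<bullet> z))" for \<eta> \<xi>
  have [measurable]: "case_prod F \<in> borel_measurable (lborel \<Otimes>\<^sub>M lborel)"
    unfolding F_def cis_conv_exp by measurable
  have "integrable lborel (\<lambda>\<xi>. \<phi> (\<xi> + - \<eta>))" for \<eta>
    using phi_integrable by (subst lborel_integrable_translate) auto
  then have tr: "integrable lborel (\<lambda>\<xi>. \<phi> (\<xi> - \<eta>))" for \<eta> by simp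
  have F_int: "integrable (lborel \<Otimes>\<^sub>M lborel) (case_prod F)"
  proof (rule lborel_pair.Fubini_integrable)
    have "(LINT \<xi>|lborel. norm (case_prod F (\<eta>, \<xi>))) = \<bar>\<phi> \<eta>\<bar> * (LINT \<xi>|lborel. \<bar>\<phi> \<xi>\<bar>)" for \<eta>
      using lborel_integral_translate[of "\<lambda>\<xi>. \<bar>\<phi> \<xi>\<bar>" "- \<eta>"] by (simp add: F_def norm_mult abs_mult)
    then show "integrable lborel (\<lambda>\<eta>. LINT \<xi>|lborel. norm (case_prod F (\<eta>, \<xi>)))"
      using phi_integrable by simp
    show "AE \<eta> in lborel. integrable lborel (\<lambda>\<xi>. case_prod F (\<eta>, \<xi>))"
    proof (rule AE_I2)
      fix \<eta>
      show "integrable lborel (\<lambda>\<xi>. case_prod F (\<eta>, \<xi>))"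
        by (rule Bochner_Integration.integrable_bound[OF integrable_mult_right[OF tr[of \<eta>], of "\<phi> \<eta>"]])
          (auto simp: F_def norm_mult cis_conv_exp)
    qed
  qed auto
  have "(LINT \<xi>|lborel. complex_of_real (conv \<xi>) * cis (2 * pi * (\<xi> \<bullet> z))) = (LINT \<xi>|lborel. LINT \<eta>|lborel. F \<eta> \<xi>)"
    unfolding F_def convolve_def by (simp only: integral_complex_of_real[symmetric] integral_mult_left_zero)
  also have "\<dots> = (LINT \<eta>|lborel. LINT \<xi>|lborel. F \<eta> \<xi>)"
    by (rule lborel_pair.Fubini_integral[OF F_int])
  also have "\<dots> = (LINT \<eta>|lborel. (complex_of_real (\<phi> \<eta>) * cis (2 * pi * (\<eta> \<bullet> z))) * phihat z)"
  proof (intro Bochner_Integration.integral_cong refl)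
    fix \<eta>
    have "(LINT \<xi>|lborel. F \<eta> \<xi>) = (LINT \<xi>|lborel. F \<eta> (\<xi> + \<eta>))"
      by (rule lborel_integral_translate[symmetric]) (simp add: F_def cis_conv_exp)
    also have "\<dots> = (LINT \<xi>|lborel. (complex_of_real (\<phi> \<eta>) * cis (2 * pi * (\<eta> \<bullet> z))) * (complex_of_real (\<phi> \<xi>) * cis (2 * pi * (\<xi> \<bullet> z))))"
      by (intro Bochner_Integration.integral_cong refl)
        (simp add: F_def inner_add_left distrib_left mult_ac flip: cis_mult)
    also have "\<dots> = (complex_of_real (\<phi> \<eta>) * cis (2 * pi * (\<eta> \<bullet> z))) * phihat z"
      unfolding phihat_def by (rule integral_mult_right_zero)
    finally show "(LINT \<xi>|lborel. F \<eta> \<xi>) = (complex_of_real (\<phi> \<eta>) * cis (2 * pi * (\<eta> \<bullet> z))) * phihat z" .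
  qed
  also have "\<dots> = phihat z * phihat z"
    by (subst integral_mult_left_zero) (simp add: phihat_def)
  also have "\<dots> = complex_of_real ((Re (phihat z))\<^sup>2)"
    by (simp add: phihat_real power2_eq_square)
  finally show ?thesis .
qed

abbreviation "K \<equiv> bump_kernel \<phi>"

lemma weight_continuous: "continuous_on UNIV (kernel_weight \<phi>)"
  unfolding kernel_weight_def[abs_def]
  by (intro continuous_intros conv_continuous) (auto simp: add_nonneg_eq_0_iff)

lemma weight_eq_0: "norm \<xi> \<ge> 1 \<Longrightarrow> kernel_weight \<phi> \<xi> = 0"
  by (simp add: kernel_weight_def conv_eq_0)

lemma K_fourier: "complex_of_real (K x) = (LINT \<xi>|lborel. complex_of_real (kernel_weight \<phi> \<xi>) * cis (2 * pi * (\<xi> \<bullet> x)))"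
  unfolding bump_kernel_eq[OF radial] by (simp add: cis_conv_exp mult_ac)

text \<open>The weight is a product of two Fourier transforms, so Fubini turns \<open>K\<close> into
  a convolution. The final translation leaves \<open>x\<close> in the exponential factor alone,
  which reduces the Harnack inequality to a pointwise statement about exp (- 2 pi |z - x|).\<close>

lemma K_eq_convolution:
  obtains C where "C > 0" "\<And>x. K x = (LINT z|lborel. C * exp (- 2 * pi * norm (z - x)) * (Re (phihat z))\<^sup>2)"
    "\<And>x. integrable lborel (\<lambda>z. C * exp (- 2 * pi * norm (z - x)) * (Re (phihat z))\<^sup>2)"
proof -
  obtain C where C: "C > 0" "\<And>\<xi>::real^'d.
    complex_of_real ((1 + (norm \<xi>)\<^sup>2) powr (- (real DIM(real^'d) + 1) / 2)) =
    (LINT y|lborel. complex_of_real (C * exp (- 2 * pi * norm y)) * cis (2 * pi * (y \<bullet> \<xi>)))"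
    by (rule weight_eq_fourier[where 'a = "real^'d"]) blast
  define G where "G y = C * exp (- 2 * pi * norm y)" for y :: "real^'d"
  have [measurable]: "G \<in> borel_measurable borel" unfolding G_def by measurable
  have G_int: "integrable lborel G" unfolding G_def by (intro integrable_mult_right integrable_exp_norm)
  have M_le: "\<bar>(Re (phihat z))\<^sup>2\<bar> \<le> (LINT \<xi>|lborel. \<bar>\<phi> \<xi>\<bar>)\<^sup>2" for z
    using power_mono[OF phihat_bounded[of z], of 2] by simp
  have int: "integrable lborel (\<lambda>y. G y * (Re (phihat (y + x)))\<^sup>2)" for x
    by (rule Bochner_Integration.integrable_bound[OF integrable_mult_left[OF G_int, of "(LINT \<xi>|lborel. \<bar>\<phi> \<xi>\<bar>)\<^sup>2"]])
      (use M_le in \<open>auto simp: abs_mult intro!: mult_left_mono\<close>)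
  have K1: "K x = (LINT y|lborel. G y * (Re (phihat (y + x)))\<^sup>2)" for x
  proof -
    define F where "F y \<xi> = complex_of_real (G y * conv \<xi>) * cis (2 * pi * (\<xi> \<bullet> (y + x)))" for y \<xi>
    have "case_prod F \<in> borel_measurable (lborel \<Otimes>\<^sub>M lborel)"
      unfolding F_def cis_conv_exp by measurable
    then have F_int: "integrable (lborel \<Otimes>\<^sub>M lborel) (case_prod F)"
      by (rule integrable_lborel_pair_bound[OF _ G_int conv_integrable]) (simp add: F_def norm_mult abs_mult)
    have "complex_of_real (K x) = (LINT \<xi>|lborel. LINT y|lborel. F y \<xi>)"
      unfolding K_fourier
    proof (intro Bochner_Integration.integral_cong refl)
      fix \<xi>
      have "complex_of_real (kernel_weight \<phi> \<xi>) * cis (2 * pi * (\<xi> \<bullet> x))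
        = complex_of_real ((1 + (norm \<xi>)\<^sup>2) powr (- (real DIM(real^'d) + 1) / 2)) * (complex_of_real (conv \<xi>) * cis (2 * pi * (\<xi> \<bullet> x)))"
        by (simp add: kernel_weight_def)
      also have "\<dots> = (LINT y|lborel. complex_of_real (G y) * cis (2 * pi * (y \<bullet> \<xi>)) * (complex_of_real (conv \<xi>) * cis (2 * pi * (\<xi> \<bullet> x))))"
        unfolding C(2) G_def by (rule integral_mult_left_zero[symmetric])
      also have "\<dots> = (LINT y|lborel. F y \<xi>)"
        by (intro Bochner_Integration.integral_cong refl)
          (simp add: F_def inner_add_right distrib_left inner_commute mult_ac flip: cis_mult)
      finally show "complex_of_real (kernel_weight \<phi> \<xi>) * cis (2 * pi * (\<xi> \<bullet> x)) = (LINT y|lborel. F y \<xi>)" .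
    qed
    also have "\<dots> = (LINT y|lborel. LINT \<xi>|lborel. F y \<xi>)"
      by (rule lborel_pair.Fubini_integral[OF F_int])
    also have "\<dots> = (LINT y|lborel. complex_of_real (G y * (Re (phihat (y + x)))\<^sup>2))"
    proof (intro Bochner_Integration.integral_cong refl)
      fix y
      have "(LINT \<xi>|lborel. F y \<xi>) = complex_of_real (G y) * (LINT \<xi>|lborel. complex_of_real (conv \<xi>) * cis (2 * pi * (\<xi> \<bullet> (y + x))))"
        by (simp add: F_def mult.assoc)
      also have "\<dots> = complex_of_real (G y * (Re (phihat (y + x)))\<^sup>2)"
        unfolding fourier_conv by (simp only: of_real_mult)
      finally show "(LINT \<xi>|lborel. F y \<xi>) = complex_of_real (G y * (Re (phihat (y + x)))\<^sup>2)" .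
    qed
    finally have "complex_of_real (K x) = complex_of_real (LINT y|lborel. G y * (Re (phihat (y + x)))\<^sup>2)"
      by (simp only: integral_complex_of_real)
    then show ?thesis by (simp only: of_real_eq_iff)
  qed
  have shift: "(\<lambda>y. G y * (Re (phihat (y + x)))\<^sup>2) = (\<lambda>y. (\<lambda>z. G (z - x) * (Re (phihat z))\<^sup>2) (y + x))" for x
    by simp
  show ?thesis
  proof (rule that[OF C(1)])
    fix x
    show "K x = (LINT z|lborel. C * exp (- 2 * pi * norm (z - x)) * (Re (phihat z))\<^sup>2)"
      using K1[of x] lborel_integral_translate[of "\<lambda>z. G (z - x) * (Re (phihat z))\<^sup>2" x] by (simp add: G_def)
    show "integrable lborel (\<lambda>z. C * exp (- 2 * pi * norm (z - x)) * (Re (phihat z))\<^sup>2)"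
      using int[of x] lborel_integrable_translate[of "\<lambda>z. G (z - x) * (Re (phihat z))\<^sup>2" x] by (simp add: G_def)
  qed
qed

lemma K_nonneg: "K x \<ge> 0"
  by (rule K_eq_convolution) (auto intro!: integral_nonneg)

text \<open>The triangle inequality for \<open>z - (x + h)\<close>, exponentiated and applied under
  the integral of \<open>K_eq_convolution\<close>.\<close>

lemma K_harnack: "K x \<le> exp (2 * pi * norm h) * K (x + h)"
proof -
  obtain C where C: "C > 0" "\<And>x. K x = (LINT z|lborel. C * exp (- 2 * pi * norm (z - x)) * (Re (phihat z))\<^sup>2)"
    "\<And>x. integrable lborel (\<lambda>z. C * exp (- 2 * pi * norm (z - x)) * (Re (phihat z))\<^sup>2)"
    by (rule K_eq_convolution) blast
  have "K x \<le> (LINT z|lborel. exp (2 * pi * norm h) * (C * exp (- 2 * pi * norm (z - (x + h))) * (Re (phihat z))\<^sup>2))"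
    unfolding C(2)[of x]
  proof (rule integral_mono[OF C(3) integrable_mult_right[OF C(3)]])
    fix z
    have "norm (z - (x + h)) \<le> norm (z - x) + norm h"
      using norm_triangle_ineq4[of "z - x" h] by (simp add: algebra_simps)
    then have "2 * pi * norm (z - (x + h)) \<le> 2 * pi * (norm (z - x) + norm h)"
      by (intro mult_left_mono) auto
    then have "exp (- 2 * pi * norm (z - x)) \<le> exp (2 * pi * norm h) * exp (- 2 * pi * norm (z - (x + h)))"
      by (simp add: algebra_simps flip: exp_add)
    from mult_right_mono[OF mult_left_mono[OF this, of C], of "(Re (phihat z))\<^sup>2"]
    show "C * exp (- 2 * pi * norm (z - x)) * (Re (phihat z))\<^sup>2
      \<le> exp (2 * pi * norm h) * (C * exp (- 2 * pi * norm (z - (x + h))) * (Re (phihat z))\<^sup>2)"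
      using C(1) by (simp add: mult_ac)
  qed
  then show ?thesis unfolding C(2)[of "x + h"] by simp
qed

lemma
  shows K_integrable: "integrable lborel K"
    and K_fourier_inv: "(LINT x|lborel. complex_of_real (K x) * cis (- (2 * pi * (x \<bullet> \<eta>)))) = complex_of_real (kernel_weight \<phi> \<eta>)"
proof -
  obtain B where "\<forall>\<xi>. \<bar>kernel_weight \<phi> \<xi>\<bar> \<le> B"
    using bounded_continuous_unit_ball[OF weight_continuous weight_eq_0] by blast
  then show "integrable lborel K"
    "(LINT x|lborel. complex_of_real (K x) * cis (- (2 * pi * (x \<bullet> \<eta>)))) = complex_of_real (kernel_weight \<phi> \<eta>)"
    using fourier_inversion_nonneg[OF weight_continuous
      integrable_continuous_unit_ball[OF weight_continuous weight_eq_0] _ K_fourier K_nonneg]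
    by blast+
qed

text \<open>The total mass is the weight at frequency 0, where the convolution is the integral of
  the square by evenness. This is the purpose of the normalization \<open>l2\<close>.\<close>

lemma K_integral: "(LINT x|lborel. K x) = 1"
proof -
  have "complex_of_real (LINT x|lborel. K x) = complex_of_real (kernel_weight \<phi> 0)"
    using K_fourier_inv[of 0] by simp
  then have "(LINT x|lborel. K x) = kernel_weight \<phi> 0" by (simp only: of_real_eq_iff)
  also have "\<dots> = 1"
    using l2 by (simp add: kernel_weight_def convolve_def radial_minus[OF radial] power2_eq_square)
  finally show ?thesis .
qed

lemma K_measurable[measurable]: "K \<in> borel_measurable borel"
  using K_integrable by auto

lemma tail_shift: "t \<ge> 0 \<Longrightarrow> kernel_tail \<phi> t \<le> exp (2 * pi) * kernel_tail \<phi> (t + 1)"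
  unfolding kernel_tail_def by (intro tail_integral_shift K_integrable K_nonneg K_harnack)

text \<open>By the Harnack inequality a single zero would spread to all points, contrary to mass
  1.\<close>

lemma K_pos: "K x > 0"
proof (rule ccontr)
  assume "\<not> K x > 0"
  then have "K x = 0" using K_nonneg[of x] by simp
  then have "K z = 0" for z
    using K_harnack[of z "x - z"] K_nonneg[of z] by simp
  then show False using K_integral by simp
qed

text \<open>Makes \<open>gamma_const\<close> meaningful: \<open>inverse 0\<close> would be 0. On the
  unit ball the Harnack inequality bounds the kernel below by
  \<open>exp (- 2 * pi) * K 0\<close>.\<close>

lemma K_unit_ball_pos: "(LINT y:{y. norm y \<le> 1}|lborel. K y) > 0"
proof -
  have i: "integrable lborel (\<lambda>y. indicator {y. norm y \<le> 1} y *\<^sub>R K y)"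
    by (intro integrable_mult_indicator K_integrable) measurable
  have "(LINT y|lborel. indicator (cball (0::real^'d) 1) y *\<^sub>R (exp (- 2 * pi) * K 0)) \<le> (LINT y|lborel. indicator {y. norm y \<le> 1} y *\<^sub>R K y)"
  proof (rule integral_mono)
    show "integrable lborel (\<lambda>y. indicator {y. norm y \<le> 1} y *\<^sub>R K y)" by (rule i)
    show "integrable lborel (\<lambda>y. indicator (cball (0::real^'d) 1) y *\<^sub>R (exp (- 2 * pi) * K 0))"
      by (intro integrable_scaleR_left) (use emeasure_lborel_cball_finite[of "0::real^'d" 1] in \<open>auto intro!: integrable_real_indicator\<close>)
    fix y
    have "exp (- 2 * pi) * K 0 \<le> K y" if "norm y \<le> 1"
    proof -
      have "K 0 \<le> exp (2 * pi * norm y) * K (0 + y)" by (rule K_harnack)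
      also have "\<dots> \<le> exp (2 * pi) * K y"
        using that K_nonneg[of y] by (intro mult_mono) auto
      finally show ?thesis by (simp add: exp_minus field_simps)
    qed
    then show "indicator (cball (0::real^'d) 1) y *\<^sub>R (exp (- 2 * pi) * K 0) \<le> indicator {y. norm y \<le> 1} y *\<^sub>R K y"
      by (auto simp: indicator_def)
  qed
  moreover have "(LINT y|lborel. indicator (cball (0::real^'d) 1) y *\<^sub>R (exp (- 2 * pi) * K 0)) > 0"
    using K_pos[of 0] content_cball_pos[of 1 "0::real^'d"] by (simp add: zero_less_mult_iff)
  ultimately show ?thesis by (simp add: set_lebesgue_integral_def)
qed

end

section \<open>Periodic functions on Euclidean space\<close>

lemma int_lattice_add: "k \<in> int_lattice \<Longrightarrow> l \<in> int_lattice \<Longrightarrow> k + l \<in> int_lattice"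
  and int_lattice_minus: "k \<in> int_lattice \<Longrightarrow> - k \<in> int_lattice"
  and int_lattice_diff: "k \<in> int_lattice \<Longrightarrow> l \<in> int_lattice \<Longrightarrow> k - l \<in> int_lattice"
  and int_lattice_zero: "0 \<in> int_lattice"
  and int_lattice_axis: "axis i 1 \<in> int_lattice"
  by (auto simp: int_lattice_def axis_def)

lemma int_lattice_eq_range: "int_lattice = range (\<lambda>v::int^'d. \<chi> i. of_int (v $ i))"
proof -
  have "k \<in> range (\<lambda>v::int^'d. \<chi> i. of_int (v $ i))" if "k \<in> int_lattice" for k :: "real^'d"
    using that by (intro image_eqI[of _ _ "\<chi> i. \<lfloor>k $ i\<rfloor>"]) (auto simp: int_lattice_def vec_eq_iff)
  then show ?thesis by (auto simp: int_lattice_def)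
qed

lemma countable_int_lattice: "countable int_lattice"
  unfolding int_lattice_eq_range by blast

lemma inner_int_lattice:
  assumes "k \<in> int_lattice" "l \<in> int_lattice"
  shows "k \<bullet> l \<in> \<int>"
  using assms by (auto simp: inner_vec_def int_lattice_def)

lemma finite_int_lattice_norm_less: "finite {k::real^'d. k \<in> int_lattice \<and> norm k < R}"
proof -
  have "{k::real^'d. k \<in> int_lattice \<and> norm k < R} \<subseteq> (\<lambda>f. \<chi> i. real_of_int (f i)) ` (PiE UNIV (\<lambda>_::'d. {-\<lceil>R\<rceil>..\<lceil>R\<rceil>}))"
  proof
    fix k :: "real^'d" assume k: "k \<in> {k. k \<in> int_lattice \<and> norm k < R}"
    have "real_of_int \<lfloor>k $ i\<rfloor> = k $ i" for i using k by (auto simp: int_lattice_def)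
    then have "k = (\<chi> i. real_of_int \<lfloor>k $ i\<rfloor>)" by (simp only: vec_eq_iff vec_lambda_beta simp_thms)
    moreover have "- \<lceil>R\<rceil> \<le> \<lfloor>k $ i\<rfloor> \<and> \<lfloor>k $ i\<rfloor> \<le> \<lceil>R\<rceil>" for i
    proof -
      have "\<bar>k $ i\<bar> < R" using component_le_norm_cart[of k i] k by simp
      then show ?thesis by linarith
    qed
    ultimately show "k \<in> (\<lambda>f. \<chi> i. real_of_int (f i)) ` (PiE UNIV (\<lambda>_::'d. {-\<lceil>R\<rceil>..\<lceil>R\<rceil>}))"
      by (intro image_eqI[of _ _ "\<lambda>i. \<lfloor>k $ i\<rfloor>"]) auto
  qed
  then show ?thesis by (rule finite_subset) (auto intro!: finite_PiE)
qed

definition lattice_periodic :: "(real^'d \<Rightarrow> 'b) \<Rightarrow> bool" where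
  "lattice_periodic f \<longleftrightarrow> (\<forall>x. \<forall>k\<in>int_lattice. f (x + k) = f x)"

text \<open>The quotient map to the torus, realized as a Borel map onto the representatives in
  \<open>unit_cell\<close>.\<close>

definition frac_vec :: "real^'d \<Rightarrow> real^'d" where
  "frac_vec x = (\<chi> i. frac (x $ i))"

lemma frac_vec_in_cell: "frac_vec x \<in> unit_cell"
  by (simp add: frac_vec_def unit_cell_def frac_lt_1)

lemma frac_vec_diff_lattice: "x - frac_vec x \<in> int_lattice"
  by (simp add: frac_vec_def int_lattice_def frac_def)

lemma frac_vec_cell: "x \<in> unit_cell \<Longrightarrow> frac_vec x = x"
  by (simp add: frac_vec_def unit_cell_def vec_eq_iff frac_eq)

lemma lattice_periodic_frac_vec: "lattice_periodic f \<Longrightarrow> f (frac_vec x) = f x"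
  using frac_vec_diff_lattice[of x] unfolding lattice_periodic_def by (metis add.commute diff_add_cancel)

lemma frac_vec_periodic: "k \<in> int_lattice \<Longrightarrow> frac_vec (x + k) = frac_vec x"
  by (auto simp: frac_vec_def int_lattice_def vec_eq_iff frac_def elim!: Ints_cases)

lemma frac_vec_measurable[measurable]: "frac_vec \<in> borel_measurable borel"
proof -
  have "(\<lambda>x::real^'d. frac_vec x \<bullet> axis i 1) \<in> borel_measurable borel" for i
  proof -
    have "(\<lambda>x::real^'d. frac_vec x \<bullet> axis i 1) = (\<lambda>x. x \<bullet> axis i 1 - of_int \<lfloor>x \<bullet> axis i 1\<rfloor>)"
      by (simp add: frac_vec_def inner_axis frac_def)
    then show ?thesis by simp
  qed
  then show ?thesis
    by (subst borel_measurable_euclidean_space) (auto simp: Basis_vec_def)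
qed

lemma unit_cell_measurable[measurable]: "unit_cell \<in> sets borel"
proof -
  have "unit_cell = (\<Inter>i. {x. 0 \<le> x $ i} \<inter> {x. x $ i < 1})"
    by (auto simp: unit_cell_def)
  also have "\<dots> \<in> sets borel"
    by (intro sets.countable_INT'' sets.Int borel_closed borel_open) 
       (auto intro!: closed_Collect_le open_Collect_less continuous_intros)
  finally show ?thesis .
qed

lemma unit_cell_bounds: "box 0 (\<chi> i. 1) \<subseteq> unit_cell" "unit_cell \<subseteq> cbox 0 (\<chi> i. 1)"
  by (auto simp: unit_cell_def mem_box_cart less_imp_le)

lemma emeasure_unit_cell: "emeasure lborel unit_cell = 1"
proof (rule antisym)
  have 1: "(\<Prod>b\<in>Basis. ((\<chi> i. 1) - 0 :: real^'d) \<bullet> b) = 1"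
    by (intro prod.neutral) (auto simp: Basis_vec_def inner_axis)
  have le: "(0::real^'d) \<bullet> b \<le> (\<chi> i. 1) \<bullet> b" if "b \<in> Basis" for b
    using that by (auto simp: Basis_vec_def inner_axis)
  show "emeasure lborel (unit_cell :: (real^'d) set) \<le> 1"
  proof -
    have "emeasure lborel (cbox (0::real^'d) (\<chi> i. 1)) = 1"
      using 1 by (subst emeasure_lborel_cbox[OF le]) auto
    moreover have "emeasure lborel (unit_cell :: (real^'d) set) \<le> emeasure lborel (cbox (0::real^'d) (\<chi> i. 1))"
      by (intro emeasure_mono unit_cell_bounds) auto
    ultimately show ?thesis by simp
  qed
  show "1 \<le> emeasure lborel (unit_cell :: (real^'d) set)"
  proof -
    have "emeasure lborel (box (0::real^'d) (\<chi> i. 1)) = 1"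
      using 1 by (subst emeasure_lborel_box[OF le]) auto
    moreover have "emeasure lborel (box (0::real^'d) (\<chi> i. 1)) \<le> emeasure lborel (unit_cell :: (real^'d) set)"
      by (intro emeasure_mono unit_cell_bounds) auto
    ultimately show ?thesis by simp
  qed
qed

lemma emeasure_translate:
  fixes Z :: "'a::euclidean_space set"
  assumes [measurable]: "Z \<in> sets borel"
  shows "emeasure lborel {x. x + t \<in> Z} = emeasure lborel Z"
proof -
  have "emeasure lborel Z = emeasure (distr lborel borel ((+) t)) Z"
    by (simp add: lborel_distr_plus)
  also have "\<dots> = emeasure lborel ((+) t -` Z \<inter> space lborel)"
    by (rule emeasure_distr) auto
  also have "(+) t -` Z \<inter> space lborel = {x. x + t \<in> Z}"
    by (auto simp: add.commute)
  finally show ?thesis ..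
qed

lemma unit_cell_unique:
  assumes "x + k \<in> unit_cell" "x + l \<in> unit_cell" "k \<in> int_lattice" "l \<in> int_lattice"
  shows "k = l"
  using frac_vec_cell[OF assms(1)] frac_vec_cell[OF assms(2)] assms(3,4)
  by (simp add: frac_vec_periodic)

lemma unit_cell_exists: obtains k where "k \<in> int_lattice" "x + k \<in> unit_cell"
  using frac_vec_in_cell[of x] int_lattice_minus[OF frac_vec_diff_lattice[of x]] by (intro that) auto

text \<open>Translation invariance on the torus. The translated cell is cut along the lattice
  translates of \<open>unit_cell\<close>, and each piece is moved back by a lattice vector, which
  changes neither its measure nor membership in the periodic set \<open>A\<close>.\<close>

lemma emeasure_cell_translate:
  assumes [measurable]: "A \<in> sets borel" and A: "\<And>x k. k \<in> int_lattice \<Longrightarrow> x + k \<in> A \<longleftrightarrow> x \<in> A"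
  shows "emeasure lborel (unit_cell \<inter> {x. x + a \<in> A}) = emeasure lborel (unit_cell \<inter> A)"
proof -
  \<comment> \<open>The part of \<open>unit_cell \<inter> A\<close> that is reached from the cell by
    the translation \<open>a + k\<close>; over all lattice vectors \<open>k\<close> these pieces
    partition \<open>unit_cell \<inter> A\<close>.\<close>
  define Z where "Z k = unit_cell \<inter> A \<inter> {y. y + (- (a + k)) \<in> unit_cell}" for k
  have [measurable]: "Z k \<in> sets borel" for k unfolding Z_def by measurable
  have Y: "{x. x + (a + k) \<in> Z k} = unit_cell \<inter> {x. x + a \<in> A} \<inter> {x. x + (a + k) \<in> unit_cell}" if "k \<in> int_lattice" for k
    using A[OF that] by (auto simp: Z_def add.assoc[symmetric])
  have [measurable]: "{x. x + (a + k) \<in> Z k} \<in> sets borel" for k by measurable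
  have "unit_cell \<inter> {x. x + a \<in> A} = (\<Union>k\<in>int_lattice. {x. x + (a + k) \<in> Z k})"
  proof -
    have "\<exists>k\<in>int_lattice. x + (a + k) \<in> unit_cell" for x
      by (rule unit_cell_exists[of "x + a"]) (auto simp: add.assoc)
    then show ?thesis using Y by auto
  qed
  also have "emeasure lborel \<dots> = (\<integral>\<^sup>+k. emeasure lborel {x. x + (a + k) \<in> Z k} \<partial>count_space int_lattice)"
  proof (rule emeasure_UN_countable[OF _ countable_int_lattice])
    show "disjoint_family_on (\<lambda>k. {x. x + (a + k) \<in> Z k}) int_lattice"
      unfolding disjoint_family_on_def Z_def
      using unit_cell_unique[of "_ + a"] by (auto simp: add.assoc[symmetric])
  qed measurable
  also have "\<dots> = (\<integral>\<^sup>+k. emeasure lborel (Z k) \<partial>count_space int_lattice)"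
    by (intro nn_integral_cong emeasure_translate) measurable
  also have "\<dots> = emeasure lborel (\<Union>k\<in>int_lattice. Z k)"
  proof (rule emeasure_UN_countable[OF _ countable_int_lattice, symmetric])
    have "k = l" if "k \<in> int_lattice" "l \<in> int_lattice" "y + (- (a + k)) \<in> unit_cell" "y + (- (a + l)) \<in> unit_cell" for k l y
      using unit_cell_unique[of "y - a" "- k" "- l"] that int_lattice_minus by (auto simp: algebra_simps)
    then show "disjoint_family_on Z int_lattice"
      unfolding disjoint_family_on_def Z_def by blast
  qed measurable
  also have "(\<Union>k\<in>int_lattice. Z k) = unit_cell \<inter> A"
  proof -
    have "\<exists>k\<in>int_lattice. y + (- (a + k)) \<in> unit_cell" for y
      by (rule unit_cell_exists[of "y - a"]) (auto intro!: bexI[of _ "- _"] int_lattice_minus simp: algebra_simps)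
    then show ?thesis by (auto simp: Z_def)
  qed
  finally show ?thesis .
qed

text \<open>The torus translation \<open>x \<mapsto> frac_vec (x + a)\<close> preserves the measure
  of the cell, as is checked on sets, and a periodic \<open>f\<close> does not see the reduction by
  \<open>frac_vec\<close>.\<close>

lemma integral_cell_translate:
  fixes f :: "real^'d \<Rightarrow> 'b::{banach, second_countable_topology}"
  assumes [measurable]: "f \<in> borel_measurable borel" and f: "lattice_periodic f"
  shows "(LINT x:unit_cell|lborel. f (x + a)) = (LINT x:unit_cell|lborel. f x)"
proof -
  define M where "M = restrict_space lborel (unit_cell :: (real^'d) set)"
  have [measurable]: "g \<in> measurable M borel" if "g \<in> borel_measurable borel" for g :: "real^'d \<Rightarrow> real^'d"
    unfolding M_def by (intro measurable_restrict_space1) (use that in simp)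
  have sp: "space M = unit_cell" by (simp add: M_def space_restrict_space)
  have em: "emeasure M A = emeasure lborel A" if "A \<subseteq> unit_cell" for A
    using that unfolding M_def by (subst emeasure_restrict_space) auto
  have eq: "distr M borel (\<lambda>x. frac_vec (x + a)) = distr M borel (\<lambda>x. x)"
  proof (rule measure_eqI)
    fix A assume "A \<in> sets (distr M borel (\<lambda>x. frac_vec (x + a)))"
    then have [measurable]: "A \<in> sets borel" by simp
    have "emeasure (distr M borel (\<lambda>x. frac_vec (x + a))) A = emeasure M ((\<lambda>x. frac_vec (x + a)) -` A \<inter> space M)"
      by (rule emeasure_distr) measurable
    also have "\<dots> = emeasure lborel (unit_cell \<inter> {x. x + a \<in> {y. frac_vec y \<in> A}})"
      by (subst em) (auto simp: sp intro!: arg_cong[where f = "emeasure lborel"])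
    also have "\<dots> = emeasure lborel (unit_cell \<inter> {y. frac_vec y \<in> A})"
      by (intro emeasure_cell_translate) (auto simp: frac_vec_periodic)
    also have "\<dots> = emeasure M ((\<lambda>x. x) -` A \<inter> space M)"
      by (subst em) (auto simp: sp frac_vec_cell intro!: arg_cong[where f = "emeasure lborel"])
    also have "\<dots> = emeasure (distr M borel (\<lambda>x. x)) A"
      by (rule emeasure_distr[symmetric]) measurable
    finally show "emeasure (distr M borel (\<lambda>x. frac_vec (x + a))) A = emeasure (distr M borel (\<lambda>x. x)) A" .
  qed simp
  have set: "(LINT x:unit_cell|lborel. g x) = (LINT x|M. g x)" for g :: "real^'d \<Rightarrow> 'b"
    unfolding M_def set_lebesgue_integral_def by (subst integral_restrict_space) auto
  have "(LINT x:unit_cell|lborel. f (x + a)) = (LINT x|M. f (frac_vec (x + a)))"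
    by (simp add: set lattice_periodic_frac_vec[OF f])
  also have "\<dots> = (LINT y|distr M borel (\<lambda>x. frac_vec (x + a)). f y)"
    by (rule integral_distr[symmetric]) measurable
  also have "\<dots> = (LINT x|M. f x)"
    unfolding eq by (rule integral_distr) measurable
  finally show ?thesis by (simp add: set)
qed

section \<open>Characters of the torus and their integrals\<close>

definition echar :: "real^'d \<Rightarrow> real^'d \<Rightarrow> complex" where
  "echar k x = cis (2 * pi * (k \<bullet> x))"

lemma echar_continuous: "continuous_on S (echar k)"
  unfolding echar_def by (intro continuous_intros)

lemma echar_measurable[measurable]: "echar k \<in> borel_measurable borel"
  by (intro borel_measurable_continuous_onI echar_continuous)

lemma norm_echar[simp]: "norm (echar k x) = 1"
  by (simp add: echar_def)

lemma echar_add: "echar k (x + y) = echar k x * echar k y"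
  by (simp add: echar_def cis_mult inner_add_right distrib_left)

lemma echar_add_left: "echar (k + l) x = echar k x * echar l x"
  by (simp add: echar_def cis_mult inner_add_left distrib_left)

lemma echar_0[simp]: "echar 0 x = 1"
  by (simp add: echar_def)

lemma echar_lattice: "k \<in> int_lattice \<Longrightarrow> l \<in> int_lattice \<Longrightarrow> echar k l = 1"
  using inner_int_lattice[of k l] by (auto simp: echar_def elim!: Ints_cases)

lemma echar_periodic: "k \<in> int_lattice \<Longrightarrow> lattice_periodic (echar k)"
  by (simp add: lattice_periodic_def echar_add echar_lattice)

lemma measure_unit_cell: "measure lborel unit_cell = 1"
  by (simp add: measure_def emeasure_unit_cell)

text \<open>For nonzero \<open>k\<close>, a shift by half a period in a coordinate where
  \<open>k\<close> does not vanish multiplies the character by -1, so the integral equals its own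
  negative.\<close>

lemma integral_echar:
  assumes k: "k \<in> int_lattice"
  shows "(LINT x:unit_cell|lborel. echar k x) = (if k = 0 then 1 else 0)"
proof (cases "k = 0")
  case True
  then show ?thesis
    by (simp add: set_lebesgue_integral_def measure_unit_cell emeasure_unit_cell)
next
  case False
  then obtain i where i: "k $ i \<noteq> 0" by (auto simp: vec_eq_iff)
  define a where "a = axis i (1 / (2 * k $ i))"
  have "echar k a = - 1"
    using i by (simp add: echar_def a_def inner_axis)
  then have "(LINT x:unit_cell|lborel. echar k (x + a)) = - (LINT x:unit_cell|lborel. echar k x)"
    by (simp add: echar_add set_lebesgue_integral_def)
  then show ?thesis
    using integral_cell_translate[OF _ echar_periodic[OF k], of a] False by simp
qed

lemma set_integrable_cell_continuous:
  fixes f :: "real^'d \<Rightarrow> 'b::{banach, second_countable_topology}"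
  assumes "continuous_on UNIV f"
  shows "set_integrable lborel unit_cell f"
proof -
  have "set_integrable lborel (cbox 0 (\<chi> i. 1)) f"
    unfolding set_integrable_def
    by (intro borel_integrable_compact continuous_on_subset[OF assms]) auto
  then show ?thesis by (rule set_integrable_subset) (use unit_cell_bounds in auto)
qed

section \<open>Uniqueness of Fourier coefficients\<close>

inductive trig_poly :: "(real^'d \<Rightarrow> complex) \<Rightarrow> bool" where
  trig_poly_echar: "k \<in> int_lattice \<Longrightarrow> trig_poly (echar k)"
| trig_poly_scale: "trig_poly p \<Longrightarrow> trig_poly (\<lambda>x. c * p x)"
| trig_poly_add: "trig_poly p \<Longrightarrow> trig_poly q \<Longrightarrow> trig_poly (\<lambda>x. p x + q x)"

lemma trig_poly_const: "trig_poly (\<lambda>_. c)"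
  using trig_poly_scale[OF trig_poly_echar[OF int_lattice_zero], of c] by simp

lemma trig_poly_echar_mult:
  assumes "trig_poly q" and k: "k \<in> int_lattice"
  shows "trig_poly (\<lambda>x. echar k x * q x)"
  using assms(1)
proof induction
  case (trig_poly_echar l)
  have "trig_poly (echar (k + l))"
    using k trig_poly_echar by (intro trig_poly.trig_poly_echar int_lattice_add)
  then show ?case by (simp add: echar_add_left[abs_def])
next
  case (trig_poly_scale p c)
  from trig_poly.trig_poly_scale[OF trig_poly_scale.IH, of c] show ?case by (simp add: mult_ac)
next
  case (trig_poly_add p q)
  from trig_poly.trig_poly_add[OF trig_poly_add.IH] show ?case by (simp add: distrib_left)
qed

lemma trig_poly_mult:
  assumes "trig_poly p" "trig_poly q"
  shows "trig_poly (\<lambda>x. p x * q x)"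
  using assms(1)
proof induction
  case (trig_poly_echar k)
  then show ?case using assms(2) by (rule trig_poly_echar_mult[rotated])
next
  case (trig_poly_scale p c)
  from trig_poly.trig_poly_scale[OF trig_poly_scale.IH, of c] show ?case by (simp add: mult_ac)
next
  case (trig_poly_add p1 p2)
  from trig_poly.trig_poly_add[OF trig_poly_add.IH] show ?case by (simp add: distrib_right)
qed

lemma trig_poly_prod:
  assumes "finite A" "\<And>i. i \<in> A \<Longrightarrow> trig_poly (p i)"
  shows "trig_poly (\<lambda>x. \<Prod>i\<in>A. p i x)"
  using assms by (induction A rule: finite_induct) (auto intro: trig_poly_mult trig_poly_const)

lemma trig_poly_power: "trig_poly p \<Longrightarrow> trig_poly (\<lambda>x. p x ^ n)"
  by (induction n) (auto intro: trig_poly_mult trig_poly_const)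

lemma trig_poly_continuous: "trig_poly p \<Longrightarrow> continuous_on UNIV p"
  by (induction rule: trig_poly.induct) (auto intro!: continuous_intros echar_continuous)

lemma integral_trig_poly_eq_0:
  fixes h :: "real^'d \<Rightarrow> complex"
  assumes h: "continuous_on UNIV h"
    and zero: "\<And>k. k \<in> int_lattice \<Longrightarrow> (LINT x:unit_cell|lborel. h x * echar k x) = 0"
    and p: "trig_poly p"
  shows "(LINT x:unit_cell|lborel. h x * p x) = 0"
  using p
proof induction
  case (trig_poly_echar k)
  then show ?case by (rule zero)
next
  case (trig_poly_scale p c)
  have "(LINT x:unit_cell|lborel. h x * (c * p x)) = (LINT x:unit_cell|lborel. c * (h x * p x))"
    by (simp add: mult_ac)
  then show ?case using trig_poly_scale.IH by (simp add: set_integral_mult_right)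
next
  case (trig_poly_add p q)
  have "set_integrable lborel unit_cell (\<lambda>x. h x * p x)" "set_integrable lborel unit_cell (\<lambda>x. h x * q x)"
    by (intro set_integrable_cell_continuous continuous_on_mult h trig_poly_continuous trig_poly_add.hyps)+
  from set_integral_add(2)[OF this] show ?case
    using trig_poly_add.IH by (simp add: distrib_left)
qed

text \<open>Each factor is the square of cos (pi (x_i - a_i)), so it lies between 0 and 1 and equals
  1 only when x_i - a_i is an integer. The peaks are exactly the lattice translates of
  \<open>a\<close>.\<close>

definition fejer_bump :: "real^'d \<Rightarrow> real^'d \<Rightarrow> real" where
  "fejer_bump a x = (\<Prod>i\<in>UNIV. (1 + cos (2 * pi * (x $ i - a $ i))) / 2)"

lemma trig_poly_fejer_bump:
  fixes a :: "real^'d"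
  shows "trig_poly (\<lambda>x. complex_of_real (fejer_bump a x))"
proof -
  have "trig_poly (\<lambda>x::real^'d. complex_of_real ((1 + cos (2 * pi * (x $ i - a $ i))) / 2))" for i
  proof -
    have eq: "(\<lambda>x::real^'d. complex_of_real ((1 + cos (2 * pi * (x $ i - a $ i))) / 2)) =
       (\<lambda>x. 1 / 2 + ((cis (- (2 * pi * a $ i)) / 4) * echar (axis i 1) x + (cis (2 * pi * a $ i) / 4) * echar (- axis i 1) x))"
    proof
      fix x :: "real^'d"
      have "cis (- (2 * pi * a $ i)) * echar (axis i 1) x = cis (2 * pi * (x $ i - a $ i))"
        by (simp add: echar_def inner_axis' cis_mult right_diff_distrib)
      moreover have "cis (2 * pi * a $ i) * echar (- axis i 1) x = cis (- (2 * pi * (x $ i - a $ i)))"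
        by (simp add: echar_def inner_axis' cis_mult right_diff_distrib)
      ultimately show "complex_of_real ((1 + cos (2 * pi * (x $ i - a $ i))) / 2) =
        1 / 2 + ((cis (- (2 * pi * a $ i)) / 4) * echar (axis i 1) x + (cis (2 * pi * a $ i) / 4) * echar (- axis i 1) x)"
        by (simp add: complex_eq_iff)
    qed
    show ?thesis unfolding eq
      by (intro trig_poly_add trig_poly_const trig_poly_scale trig_poly_echar int_lattice_minus int_lattice_axis)
  qed
  then show ?thesis unfolding fejer_bump_def of_real_prod by (intro trig_poly_prod) auto
qed

lemma fejer_bump_continuous: "continuous_on S (fejer_bump a)"
  unfolding fejer_bump_def by (intro continuous_intros) auto

lemma fejer_factor: "0 \<le> (1 + cos t) / 2" "(1 + cos t) / 2 \<le> 1" for t :: real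
proof -
  have "- 1 \<le> cos t" "cos t \<le> 1" by simp_all
  then have "0 \<le> 1 + cos t" "1 + cos t \<le> 2" by linarith+
  then show "0 \<le> (1 + cos t) / 2" "(1 + cos t) / 2 \<le> 1" by simp_all
qed

lemma fejer_bump_nonneg: "fejer_bump a x \<ge> 0"
  unfolding fejer_bump_def by (intro prod_nonneg ballI fejer_factor)

lemma fejer_bump_self: "fejer_bump a a = 1"
  by (simp add: fejer_bump_def)

text \<open>Since \<open>a\<close> is interior to the cell, every coordinate of \<open>x - a\<close>
  has modulus less than 1, so no other lattice translate of \<open>a\<close> lies in the closed
  cell. For \<open>a\<close> on the boundary of the cell there would be several peaks.\<close>

lemma fejer_bump_less_1:
  assumes a: "a \<in> box 0 (\<chi> i. 1)" and x: "x \<in> cbox 0 (\<chi> i. 1)" and ne: "x \<noteq> a"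
  shows "fejer_bump a x < 1"
proof -
  obtain i where i: "x $ i \<noteq> a $ i" using ne by (auto simp: vec_eq_iff)
  have lt: "\<bar>x $ i - a $ i\<bar> < 1"
    using a x by (auto simp: mem_box_cart dest!: spec[of _ i])
  have "cos (2 * pi * (x $ i - a $ i)) \<noteq> 1"
  proof
    assume "cos (2 * pi * (x $ i - a $ i)) = 1"
    then obtain n :: int where "2 * pi * (x $ i - a $ i) = n * 2 * pi"
      by (auto simp: cos_one_2pi_int)
    then have n: "x $ i - a $ i = of_int n" by simp
    with lt have "n = 0" by linarith
    with n i show False by simp
  qed
  then have c: "(1 + cos (2 * pi * (x $ i - a $ i))) / 2 < 1"
    using cos_le_one[of "2 * pi * (x $ i - a $ i)"] by (simp add: order_less_le)
  have "fejer_bump a x = (1 + cos (2 * pi * (x $ i - a $ i))) / 2 * (\<Prod>j\<in>UNIV - {i}. (1 + cos (2 * pi * (x $ j - a $ j))) / 2)"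
    unfolding fejer_bump_def by (rule prod.remove) auto
  also have "\<dots> \<le> (1 + cos (2 * pi * (x $ i - a $ i))) / 2 * 1"
    by (intro mult_left_mono prod_le_1 conjI fejer_factor)
  finally show ?thesis using c by simp
qed

text \<open>The powers of \<open>fejer_bump a\<close> are trigonometric polynomials that concentrate at \<open>a\<close>.\<close>

lemma fourier_unique_box:
  fixes h :: "real^'d \<Rightarrow> complex"
  assumes h: "continuous_on UNIV h"
    and zero: "\<And>k. k \<in> int_lattice \<Longrightarrow> (LINT x:unit_cell|lborel. h x * echar k x) = 0"
    and a: "a \<in> box 0 (\<chi> i. 1)"
  shows "h a = 0"
proof (rule ccontr)
  assume ha: "h a \<noteq> 0"
  \<comment> \<open>The factor \<open>cnj (h a)\<close> rotates the value at \<open>a\<close> to the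
    positive number \<open>(cmod (h a))\<^sup>2\<close>.\<close>
  define u where "u x = Re (cnj (h a) * h x)" for x
  have u_cont: "continuous_on S u" for S
    unfolding u_def by (intro continuous_intros continuous_on_subset[OF h]) auto
  define c where "c = u a / 2"
  have "u a = (cmod (h a))\<^sup>2"
    unfolding cmod_power2 by (simp add: u_def power2_eq_square)
  then have c: "c > 0" "c < u a" using ha by (auto simp: c_def)
  define W where "W = box 0 (\<chi> i. 1) \<inter> u -` {c<..}"
  have W: "open W" "a \<in> W"
    using a c open_vimage[OF open_greaterThan[of c] u_cont[of UNIV]] by (auto simp: W_def intro!: open_Int)
  obtain \<rho> where \<rho>: "0 \<le> \<rho>" "\<rho> < 1" "\<And>x. x \<in> unit_cell - W \<Longrightarrow> fejer_bump a x \<le> \<rho>"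
  proof (cases "cbox 0 (\<chi> i. 1) - W = {}")
    case True
    then show ?thesis using unit_cell_bounds(2) by (intro that[of 0]) auto
  next
    case False
    have "compact (cbox 0 (\<chi> i. 1) - W)" using W by (intro compact_diff) auto
    from continuous_attains_sup[OF this False fejer_bump_continuous]
    obtain z where z: "z \<in> cbox 0 (\<chi> i. 1) - W" "\<And>y. y \<in> cbox 0 (\<chi> i. 1) - W \<Longrightarrow> fejer_bump a y \<le> fejer_bump a z"
      by blast
    show ?thesis
    proof (rule that[of "fejer_bump a z"])
      show "fejer_bump a z < 1" using z W by (intro fejer_bump_less_1 a) auto
    qed (use z unit_cell_bounds(2) in \<open>auto simp: fejer_bump_nonneg\<close>)
  qed
  \<comment> \<open>Any number strictly between \<open>\<rho>\<close> and 1 would do: the bump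
    exceeds \<open>\<tau>\<close> near \<open>a\<close> and is at most \<open>\<rho>\<close> off
    \<open>W\<close>, so the ratio of the n-th powers tends to 0.\<close>
  define \<tau> where "\<tau> = (1 + \<rho>) / 2"
  have \<tau>: "\<rho> < \<tau>" "\<tau> < 1" "0 < \<tau>" using \<rho> by (auto simp: \<tau>_def)
  define V where "V = W \<inter> fejer_bump a -` {\<tau><..}"
  have V: "open V" "a \<in> V"
    using W \<tau> open_vimage[OF open_greaterThan[of \<tau>] fejer_bump_continuous[of UNIV a]]
    by (auto simp: V_def fejer_bump_self intro!: open_Int)
  obtain r where r: "r > 0" "ball a r \<subseteq> V" using V openE by blast
  have Vc: "V \<subseteq> W" "W \<subseteq> unit_cell" using unit_cell_bounds(1) by (auto simp: V_def W_def)
  have rb: "ball a r \<subseteq> unit_cell" using r Vc by blast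
  have "compact (u ` cbox 0 (\<chi> i. 1))" by (intro compact_continuous_image u_cont) auto
  then obtain B where B: "\<And>x. x \<in> cbox 0 (\<chi> i. 1) \<Longrightarrow> \<bar>u x\<bar> \<le> B"
    by (force simp: bounded_iff dest: compact_imp_bounded)
  have B0: "B \<ge> 0" using B[of 0] by (auto simp: mem_box_cart)
  define v where "v = measure lborel (ball a r)"
  have v: "v > 0" unfolding v_def using r by (simp add: content_ball_pos)
  \<comment> \<open>The integral of \<open>u\<close> times the n-th power of the bump is 0. The ball
    contributes at least \<open>c * \<tau> ^ n * v\<close>, the rest of \<open>W\<close> a
    nonnegative amount, and the complement of \<open>W\<close> in the cell at least
    \<open>- B * \<rho> ^ n\<close>.\<close>
  have main: "c * \<tau> ^ n * v \<le> B * \<rho> ^ n" for n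
  proof -
    let ?q = "\<lambda>x. fejer_bump a x ^ n"
    have tp: "trig_poly (\<lambda>x. complex_of_real (?q x))"
      unfolding of_real_power by (intro trig_poly_power trig_poly_fejer_bump)
    have hq: "set_integrable lborel unit_cell (\<lambda>x. h x * complex_of_real (?q x))"
      by (intro set_integrable_cell_continuous continuous_on_mult h trig_poly_continuous tp)
    have int: "(LINT x:unit_cell|lborel. u x * ?q x) = 0"
    proof -
      have "(LINT x:unit_cell|lborel. cnj (h a) * (h x * complex_of_real (?q x))) = 0"
        using integral_trig_poly_eq_0[OF h zero tp] by (simp add: set_integral_mult_right)
      then have "Re (LINT x|lborel. indicator unit_cell x *\<^sub>R (cnj (h a) * (h x * complex_of_real (?q x)))) = 0"
        by (simp only: set_lebesgue_integral_def zero_complex.sel)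
      moreover have "integrable lborel (\<lambda>x. indicator unit_cell x *\<^sub>R (cnj (h a) * (h x * complex_of_real (?q x))))"
        using set_integrable_mult_right[OF hq, of "cnj (h a)"] by (simp add: set_integrable_def)
      ultimately have "(LINT x|lborel. Re (indicator unit_cell x *\<^sub>R (cnj (h a) * (h x * complex_of_real (?q x))))) = 0"
        by (simp only: integral_Re)
      also have "(\<lambda>x. Re (indicator unit_cell x *\<^sub>R (cnj (h a) * (h x * complex_of_real (?q x))))) = (\<lambda>x. indicator unit_cell x *\<^sub>R (u x * ?q x))"
        by (rule ext) (simp add: u_def mult.assoc[symmetric])
      finally show ?thesis by (simp add: set_lebesgue_integral_def)
    qed
    have uq: "integrable lborel (\<lambda>x. indicator unit_cell x *\<^sub>R (u x * ?q x))"
      unfolding set_integrable_def[symmetric]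
      by (intro set_integrable_cell_continuous continuous_intros u_cont fejer_bump_continuous)
    have i1: "integrable lborel (\<lambda>x. indicator (ball a r) x * (c * \<tau> ^ n))"
      by (intro integrable_mult_left) (use emeasure_lborel_ball_finite[of a r] in \<open>auto intro!: integrable_real_indicator\<close>)
    have i2: "integrable lborel (\<lambda>x::real^'d. indicator unit_cell x * (B * \<rho> ^ n))"
      by (intro integrable_mult_left) (auto intro!: integrable_real_indicator simp: emeasure_unit_cell)
    have "(LINT x|lborel. indicator (ball a r) x * (c * \<tau> ^ n) - indicator unit_cell x * (B * \<rho> ^ n)) \<le> (LINT x|lborel. indicator unit_cell x *\<^sub>R (u x * ?q x))"
    proof (rule integral_mono[OF Bochner_Integration.integrable_diff[OF i1 i2] uq])
      fix x
      have Bp: "B * \<rho> ^ n \<ge> 0" using B0 \<rho> by simp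
      show "indicator (ball a r) x * (c * \<tau> ^ n) - indicator unit_cell x * (B * \<rho> ^ n) \<le> indicator unit_cell x *\<^sub>R (u x * ?q x)"
      proof (cases "x \<in> unit_cell")
        case False
        then have "x \<notin> ball a r" using rb by blast
        then show ?thesis using False by simp
      next
        case cell: True
        show ?thesis
        proof (cases "x \<in> W")
          case True
          then have up: "u x \<ge> c" by (simp add: W_def)
          show ?thesis
          proof (cases "x \<in> ball a r")
            case True
            then have "\<tau> \<le> fejer_bump a x" using r by (auto simp: V_def)
            then have "\<tau> ^ n \<le> ?q x" using \<tau> by (intro power_mono) auto
            then have "c * \<tau> ^ n \<le> u x * ?q x" using up c \<tau> by (intro mult_mono) auto
            then show ?thesis using True cell Bp by simp
          next
            case False
            have "0 \<le> u x * ?q x" using up c by (simp add: fejer_bump_nonneg)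
            then show ?thesis using False cell Bp by simp
          qed
        next
          case False
          then have nb: "x \<notin> ball a r" using r Vc by blast
          have "\<bar>u x\<bar> * ?q x \<le> B * \<rho> ^ n"
            using B[of x] cell unit_cell_bounds(2) \<rho>(3)[of x] False
            by (intro mult_mono power_mono) (auto simp: fejer_bump_nonneg B0)
          moreover have "- (\<bar>u x\<bar> * ?q x) \<le> u x * ?q x"
            using mult_right_mono[of "- \<bar>u x\<bar>" "u x" "?q x"] by (simp add: fejer_bump_nonneg)
          ultimately show ?thesis using nb cell by simp
        qed
      qed
    qed
    also have "(LINT x|lborel. indicator unit_cell x *\<^sub>R (u x * ?q x)) = 0"
      using int by (simp add: set_lebesgue_integral_def)
    also have "(LINT x|lborel. indicator (ball a r) x * (c * \<tau> ^ n) - indicator unit_cell x * (B * \<rho> ^ n)) = v * (c * \<tau> ^ n) - B * \<rho> ^ n"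
      using i1 i2 by (simp add: Bochner_Integration.integral_diff v_def measure_unit_cell)
    finally show ?thesis by (simp add: mult_ac)
  qed
  have "(\<lambda>n. B * (\<rho> / \<tau>) ^ n) \<longlonglongrightarrow> B * 0"
    using \<rho> \<tau> by (intro tendsto_intros LIMSEQ_power_zero) auto
  moreover have "c * v \<le> B * (\<rho> / \<tau>) ^ n" for n
    using main[of n] \<tau> by (simp add: power_divide field_simps)
  ultimately have "c * v \<le> B * 0" by (intro LIMSEQ_le_const) auto
  then show False using c v by (simp add: mult_le_0_iff)
qed

text \<open>Continuity extends \<open>fourier_unique_box\<close> to the closed box, which contains a
  representative of every point.\<close>

lemma fourier_unique:
  fixes h :: "real^'d \<Rightarrow> complex"
  assumes h: "continuous_on UNIV h" and per: "lattice_periodic h"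
    and zero: "\<And>k. k \<in> int_lattice \<Longrightarrow> (LINT x:unit_cell|lborel. h x * echar k x) = 0"
  shows "h x = 0"
proof -
  have "box (0::real^'d) (\<chi> i. 1) \<noteq> {}"
    by (auto simp: mem_box_cart ex_in_conv[symmetric] intro!: exI[of _ "\<chi> i. 1 / 2"])
  then have cl: "closure (box (0::real^'d) (\<chi> i. 1)) = cbox 0 (\<chi> i. 1)"
    by (rule closure_box)
  have "h y = 0" if "y \<in> closure (box 0 (\<chi> i. 1))" for y
    by (rule continuous_constant_on_closure[OF continuous_on_subset[OF h] _ that])
       (auto intro: fourier_unique_box[OF h zero])
  then have "h (frac_vec x) = 0"
    using frac_vec_in_cell[of x] unit_cell_bounds(2) cl by auto
  then show ?thesis using lattice_periodic_frac_vec[OF per] by simp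
qed

section \<open>Mollification produces trigonometric polynomials\<close>

text \<open>A version of \<open>torus_fourier\<close> over \<open>lborel\<close> for Borel
  functions, suited to Fubini; \<open>torus_fourier_eq_coeff\<close> identifies the two.\<close>

definition fourier_coeff :: "(real^'d \<Rightarrow> real) \<Rightarrow> real^'d \<Rightarrow> complex" where
  "fourier_coeff f k = (LINT x:unit_cell|lborel. complex_of_real (f x) * echar (- k) x)"

context radial_bump
begin

text \<open>Convolution with the dilate of \<open>K\<close> by \<open>R\<close>, written after
  rescaling the variable so that neither the dilate nor its Jacobian appears.\<close>

definition mollify :: "real \<Rightarrow> (real^'d \<Rightarrow> real) \<Rightarrow> real^'d \<Rightarrow> real" where
  "mollify R f x = (LINT y|lborel. K y * f (x - y /\<^sub>R R))"

lemma mollify_integrable: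
  assumes [measurable]: "f \<in> borel_measurable borel" and B: "\<And>x. \<bar>f x\<bar> \<le> B"
  shows "integrable lborel (\<lambda>y. K y * f (x - y /\<^sub>R R))"
  by (rule Bochner_Integration.integrable_bound[OF integrable_mult_right[OF K_integrable, of B]])
    (use B K_nonneg in \<open>auto simp: abs_mult mult.commute[of B] intro!: mult_mono order_trans[OF B abs_ge_self]\<close>)

text \<open>Harnack in both directions. With e = exp (2 pi |w|) the increase is at most (e - 1)
  \<open>K z\<close> and the decrease at most (1 - 1/e) \<open>K z\<close>; the latter is weakened
  to (e - 1) \<open>K z\<close> by (e - 1)^2 >= 0.\<close>

lemma K_diff_le: "\<bar>K (z + w) - K z\<bar> \<le> (exp (2 * pi * norm w) - 1) * K z"
proof -
  let ?e = "exp (2 * pi * norm w)"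
  have e: "?e \<ge> 1" by simp
  have "K (z + w) \<le> ?e * K z" using K_harnack[of "z + w" "- w"] by simp
  moreover have "K z - K (z + w) \<le> (?e - 1) * K z"
  proof -
    have "K z / ?e \<le> K (z + w)" using K_harnack[of z w] by (simp add: field_simps)
    moreover have "(2 - ?e) * K z \<le> (1 / ?e) * K z"
    proof (rule mult_right_mono[OF _ K_nonneg])
      have "(?e - 1)\<^sup>2 \<ge> 0" by simp
      then have "(2 - ?e) * ?e \<le> 1" by (simp add: power2_eq_square algebra_simps)
      then show "2 - ?e \<le> 1 / ?e" by (simp add: pos_le_divide_eq)
    qed
    ultimately show ?thesis by (simp add: algebra_simps)
  qed
  ultimately show ?thesis by (simp add: abs_le_iff algebra_simps)
qed

text \<open>Translation invariance moves the shift from \<open>f\<close> to \<open>K\<close>, where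
  \<open>K_diff_le\<close> controls it. The modulus of continuity thus depends only on the bound
  \<open>B\<close>, which admits indicators.\<close>

lemma mollify_diff_le:
  assumes [measurable]: "f \<in> borel_measurable borel" and B: "\<And>x. \<bar>f x\<bar> \<le> B" and R: "R > 0"
  shows "\<bar>mollify R f (x + h) - mollify R f x\<bar> \<le> (exp (2 * pi * (R * norm h)) - 1) * B"
proof -
  have K_int': "integrable lborel (\<lambda>z. K (z + R *\<^sub>R h))"
    using K_integrable by (subst lborel_integrable_translate) auto
  have i1: "integrable lborel (\<lambda>z. K (z + R *\<^sub>R h) * f (x - z /\<^sub>R R))"
    by (rule Bochner_Integration.integrable_bound[OF integrable_mult_right[OF K_int', of B]])
      (use B K_nonneg in \<open>auto simp: abs_mult mult.commute[of B] intro!: mult_mono order_trans[OF B abs_ge_self]\<close>)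
  note i2 = mollify_integrable[OF assms(1) B, of x R]
  have "mollify R f (x + h) = (LINT z|lborel. K (z + R *\<^sub>R h) * f (x + h - (z + R *\<^sub>R h) /\<^sub>R R))"
    unfolding mollify_def
    by (rule lborel_integral_translate[where t = "R *\<^sub>R h" and f = "\<lambda>y. K y * f (x + h - y /\<^sub>R R)", symmetric]) measurable
  also have "\<dots> = (LINT z|lborel. K (z + R *\<^sub>R h) * f (x - z /\<^sub>R R))"
    using R by (simp add: scaleR_right_distrib algebra_simps)
  finally have "mollify R f (x + h) - mollify R f x = (LINT z|lborel. (K (z + R *\<^sub>R h) - K z) * f (x - z /\<^sub>R R))"
    unfolding mollify_def using i1 i2 by (simp add: left_diff_distrib)
  then have "\<bar>mollify R f (x + h) - mollify R f x\<bar> \<le> (LINT z|lborel. \<bar>(K (z + R *\<^sub>R h) - K z) * f (x - z /\<^sub>R R)\<bar>)"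
    using integral_norm_bound[of lborel "\<lambda>z. (K (z + R *\<^sub>R h) - K z) * f (x - z /\<^sub>R R)"] by simp
  also have "\<dots> \<le> (LINT z|lborel. (exp (2 * pi * (R * norm h)) - 1) * B * K z)"
  proof (rule integral_mono)
    show "integrable lborel (\<lambda>z. \<bar>(K (z + R *\<^sub>R h) - K z) * f (x - z /\<^sub>R R)\<bar>)"
      using i1 i2 by (simp add: left_diff_distrib)
    show "integrable lborel (\<lambda>z. (exp (2 * pi * (R * norm h)) - 1) * B * K z)"
      using K_integrable by simp
    fix z
    have "\<bar>K (z + R *\<^sub>R h) - K z\<bar> * \<bar>f (x - z /\<^sub>R R)\<bar> \<le> ((exp (2 * pi * norm (R *\<^sub>R h)) - 1) * K z) * B"
      using K_diff_le[of z "R *\<^sub>R h"] B K_nonneg by (intro mult_mono) auto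
    then show "\<bar>(K (z + R *\<^sub>R h) - K z) * f (x - z /\<^sub>R R)\<bar> \<le> (exp (2 * pi * (R * norm h)) - 1) * B * K z"
      using R by (simp add: abs_mult mult_ac)
  qed
  also have "\<dots> = (exp (2 * pi * (R * norm h)) - 1) * B"
    using K_integral by simp
  finally show ?thesis .
qed

lemma mollify_continuous:
  assumes "f \<in> borel_measurable borel" and "\<And>x. \<bar>f x\<bar> \<le> B" and "R > 0"
  shows "continuous_on UNIV (mollify R f)"
  unfolding continuous_on_eq_continuous_at[OF open_UNIV]
proof
  fix x
  have "((\<lambda>h. mollify R f (x + h) - mollify R f x) \<longlongrightarrow> 0) (at 0)"
  proof (rule Lim_null_comparison)
    show "\<forall>\<^sub>F h in at 0. norm (mollify R f (x + h) - mollify R f x) \<le> (exp (2 * pi * (R * norm h)) - 1) * B"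
      using mollify_diff_le[OF assms] by simp
    have "((\<lambda>h::real^'d. (exp (2 * pi * (R * norm h)) - 1) * B) \<longlongrightarrow> (exp (2 * pi * (R * norm (0::real^'d))) - 1) * B) (at 0)"
      by (intro tendsto_intros)
    then show "((\<lambda>h::real^'d. (exp (2 * pi * (R * norm h)) - 1) * B) \<longlongrightarrow> 0) (at 0)" by simp
  qed
  then show "isCont (mollify R f) x"
    using LIM_zero_cancel[of "\<lambda>h. mollify R f (x + h)" "mollify R f x"] by (simp add: isCont_iff)
qed

lemma mollify_periodic:
  assumes "lattice_periodic f"
  shows "lattice_periodic (mollify R f)"
  unfolding lattice_periodic_def
proof (intro allI ballI)
  fix x k :: "real^'d" assume k: "k \<in> int_lattice"
  have "f (x + k - y /\<^sub>R R) = f (x - y /\<^sub>R R)" for y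
    using assms k unfolding lattice_periodic_def
    by (metis add.commute add_diff_eq)
  then show "mollify R f (x + k) = mollify R f x" by (simp add: mollify_def)
qed

text \<open>Fubini, then translation invariance over the cell for each fixed \<open>y\<close>. The
  multiplier is the Fourier transform of \<open>K\<close> at \<open>k /\<^sub>R R\<close>, which
  inversion identifies as the weight.\<close>

lemma fourier_coeff_mollify:
  assumes [measurable]: "f \<in> borel_measurable borel" and B: "\<And>x. \<bar>f x\<bar> \<le> B" and R: "R > 0"
    and per: "lattice_periodic f" and k: "k \<in> int_lattice"
  shows "fourier_coeff (mollify R f) k = complex_of_real (kernel_weight \<phi> (k /\<^sub>R R)) * fourier_coeff f k"
proof -
  define F where "F y x = complex_of_real (indicator unit_cell x * (K y * f (x - y /\<^sub>R R))) * echar (- k) x" for y x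
  have [measurable]: "case_prod F \<in> borel_measurable (lborel \<Otimes>\<^sub>M lborel)"
    unfolding F_def by measurable
  have cell: "integrable lborel (\<lambda>x::real^'d. indicator unit_cell x * B)"
    by (intro integrable_mult_left) (auto intro!: integrable_real_indicator simp: emeasure_unit_cell)
  have F_int: "integrable (lborel \<Otimes>\<^sub>M lborel) (case_prod F)"
  proof (rule integrable_lborel_pair_bound[OF _ K_integrable cell])
    fix y x
    show "norm (case_prod F (y, x)) \<le> \<bar>K y\<bar> * \<bar>indicator unit_cell x * B\<bar>"
      using B[of "x - y /\<^sub>R R"] by (auto simp: F_def norm_mult abs_mult indicator_def intro!: mult_left_mono)
  qed measurable
  have "fourier_coeff (mollify R f) k = (LINT x|lborel. LINT y|lborel. F y x)"
    unfolding fourier_coeff_def set_lebesgue_integral_def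
  proof (intro Bochner_Integration.integral_cong refl)
    fix x
    have "(LINT y|lborel. F y x) = (LINT y|lborel. complex_of_real (K y * f (x - y /\<^sub>R R)) * (indicator unit_cell x *\<^sub>R echar (- k) x))"
      by (intro Bochner_Integration.integral_cong refl) (simp add: F_def scaleR_conv_of_real mult_ac)
    also have "\<dots> = complex_of_real (mollify R f x) * (indicator unit_cell x *\<^sub>R echar (- k) x)"
      unfolding mollify_def by (simp only: integral_mult_left_zero integral_complex_of_real)
    finally show "indicator unit_cell x *\<^sub>R (complex_of_real (mollify R f x) * echar (- k) x) = (LINT y|lborel. F y x)"
      by simp
  qed
  also have "\<dots> = (LINT y|lborel. LINT x|lborel. F y x)"
    by (rule lborel_pair.Fubini_integral[OF F_int])
  also have "\<dots> = (LINT y|lborel. (complex_of_real (K y) * cis (- (2 * pi * (y \<bullet> (k /\<^sub>R R))))) * fourier_coeff f k)"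
  proof (intro Bochner_Integration.integral_cong refl)
    fix y
    define g where "g x = complex_of_real (f x) * echar (- k) x" for x
    have [measurable]: "g \<in> borel_measurable borel" unfolding g_def by measurable
    have "lattice_periodic g"
      using per echar_periodic[OF int_lattice_minus[OF k]] by (simp add: lattice_periodic_def g_def)
    then have tr: "(LINT x:unit_cell|lborel. g (x + - (y /\<^sub>R R))) = fourier_coeff f k"
      unfolding fourier_coeff_def g_def[symmetric] by (intro integral_cell_translate) measurable
    have ey: "echar (- k) (y /\<^sub>R R) = cis (- (2 * pi * (y \<bullet> (k /\<^sub>R R))))"
      by (simp add: echar_def inner_commute)
    have "(LINT x|lborel. F y x) = (LINT x|lborel. (complex_of_real (K y) * echar (- k) (y /\<^sub>R R)) * (indicator unit_cell x *\<^sub>R g (x + - (y /\<^sub>R R))))"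
    proof (intro Bochner_Integration.integral_cong refl)
      fix x
      have "echar (- k) x = echar (- k) (y /\<^sub>R R) * echar (- k) (x + - (y /\<^sub>R R))"
        by (simp flip: echar_add)
      then show "F y x = (complex_of_real (K y) * echar (- k) (y /\<^sub>R R)) * (indicator unit_cell x *\<^sub>R g (x + - (y /\<^sub>R R)))"
        by (simp add: F_def g_def scaleR_conv_of_real mult_ac)
    qed
    also have "\<dots> = (complex_of_real (K y) * echar (- k) (y /\<^sub>R R)) * fourier_coeff f k"
      using tr unfolding set_lebesgue_integral_def by (simp only: integral_mult_right_zero)
    finally show "(LINT x|lborel. F y x) = (complex_of_real (K y) * cis (- (2 * pi * (y \<bullet> (k /\<^sub>R R))))) * fourier_coeff f k"
      unfolding ey .
  qed
  also have "\<dots> = complex_of_real (kernel_weight \<phi> (k /\<^sub>R R)) * fourier_coeff f k"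
    by (simp only: integral_mult_left_zero K_fourier_inv)
  finally show ?thesis .
qed

text \<open>Both sides are continuous and periodic with the same Fourier coefficients: from norm
  \<open>R\<close> on, those of the mollification vanish because the weight does. Uniqueness gives
  equality at every point, as evaluation at the given points requires.\<close>

lemma mollify_eq_trig_poly:
  assumes f: "f \<in> borel_measurable borel" and B: "\<And>x. \<bar>f x\<bar> \<le> B" and R: "R > 0"
    and per: "lattice_periodic f"
  shows "complex_of_real (mollify R f x) =
    (\<Sum>k | k \<in> int_lattice \<and> norm k < R. complex_of_real (kernel_weight \<phi> (k /\<^sub>R R)) * fourier_coeff f k * echar k x)"
proof -
  define c where "c k = complex_of_real (kernel_weight \<phi> (k /\<^sub>R R)) * fourier_coeff f k" for k
  define S where "S = {k::real^'d. k \<in> int_lattice \<and> norm k < R}"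
  have S: "finite S" unfolding S_def by (rule finite_int_lattice_norm_less)
  define D where "D x = (\<Sum>k\<in>S. c k * echar k x)" for x
  define h where "h x = complex_of_real (mollify R f x) - D x" for x
  have D_cont: "continuous_on UNIV D"
    unfolding D_def by (intro continuous_intros echar_continuous)
  have m_cont: "continuous_on UNIV (mollify R f)"
    by (rule mollify_continuous[OF f B R])
  have "h x = 0"
  proof (rule fourier_unique)
    show "continuous_on UNIV h"
      unfolding h_def by (intro continuous_intros D_cont m_cont)
    show "lattice_periodic h"
      using mollify_periodic[OF per, of R] unfolding h_def D_def
      by (auto simp: lattice_periodic_def echar_add echar_lattice S_def intro!: sum.cong)
    fix l :: "real^'d" assume l: "l \<in> int_lattice"
    have i1: "set_integrable lborel unit_cell (\<lambda>x. complex_of_real (mollify R f x) * echar l x)"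
      by (intro set_integrable_cell_continuous continuous_intros echar_continuous m_cont)
    have i2: "set_integrable lborel unit_cell (\<lambda>x. D x * echar l x)"
      by (intro set_integrable_cell_continuous continuous_intros echar_continuous D_cont)
    have i3: "set_integrable lborel unit_cell (\<lambda>x. c k * echar (k + l) x)" for k
      by (intro set_integrable_cell_continuous continuous_intros echar_continuous)
    have "(LINT x:unit_cell|lborel. D x * echar l x) = (LINT x:unit_cell|lborel. \<Sum>k\<in>S. c k * echar (k + l) x)"
      by (simp add: D_def sum_distrib_right echar_add_left mult.assoc)
    also have "\<dots> = (\<Sum>k\<in>S. LINT x:unit_cell|lborel. c k * echar (k + l) x)"
      using i3 unfolding set_lebesgue_integral_def set_integrable_def scaleR_sum_right
      by (intro Bochner_Integration.integral_sum)
    \<comment> \<open>Testing against \<open>echar l\<close> extracts the coefficient at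
      \<open>- l\<close>, since \<open>fourier_coeff\<close> integrates against
      \<open>echar (- k)\<close>.\<close>
    also have "\<dots> = (\<Sum>k\<in>S. if k = - l then c k else 0)"
    proof (rule sum.cong[OF refl])
      fix k assume "k \<in> S"
      then have "k + l \<in> int_lattice" using l by (auto simp: S_def int_lattice_add)
      then show "(LINT x:unit_cell|lborel. c k * echar (k + l) x) = (if k = - l then c k else 0)"
        by (simp add: set_integral_mult_right integral_echar add_eq_0_iff2)
    qed
    also have "\<dots> = (if - l \<in> S then c (- l) else 0)"
      using S by simp
    also have "\<dots> = c (- l)"
    proof -
      have "c (- l) = 0" if "- l \<notin> S"
      proof -
        have "norm l \<ge> R" using that l by (auto simp: S_def int_lattice_minus)
        then have "norm ((- l) /\<^sub>R R) \<ge> 1" using R by (simp add: field_simps)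
        then show ?thesis by (simp add: c_def weight_eq_0)
      qed
      then show ?thesis by simp
    qed
    also have "\<dots> = (LINT x:unit_cell|lborel. complex_of_real (mollify R f x) * echar l x)"
      using fourier_coeff_mollify[OF f B R per int_lattice_minus[OF l]] by (simp add: c_def fourier_coeff_def)
    finally show "(LINT x:unit_cell|lborel. h x * echar l x) = 0"
      using set_integral_diff(2)[OF i1 i2] by (simp add: h_def left_diff_distrib)
  qed
  then show ?thesis by (simp add: h_def D_def c_def S_def)
qed

text \<open>The weight is the Fourier transform of a nonnegative kernel of mass 1.\<close>

lemma kernel_weight_le_1: "\<bar>kernel_weight \<phi> \<eta>\<bar> \<le> 1"
proof -
  have "\<bar>kernel_weight \<phi> \<eta>\<bar> = norm (LINT x|lborel. complex_of_real (K x) * cis (- (2 * pi * (x \<bullet> \<eta>))))"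
    unfolding K_fourier_inv by simp
  also have "\<dots> \<le> (LINT x|lborel. norm (complex_of_real (K x) * cis (- (2 * pi * (x \<bullet> \<eta>)))))"
    by (rule integral_norm_bound)
  also have "\<dots> = 1" using K_integral by (simp add: norm_mult K_nonneg)
  finally show ?thesis .
qed

lemma kernel_weight_0: "kernel_weight \<phi> 0 = 1"
proof -
  have "complex_of_real (kernel_weight \<phi> 0) = complex_of_real (LINT x|lborel. K x)"
    using K_fourier_inv[of 0] by simp
  then show ?thesis using K_integral by simp
qed

end

section \<open>Boundary distance and the final inequality\<close>

lemma periodize_add: "y \<in> periodize A \<Longrightarrow> k \<in> int_lattice \<Longrightarrow> y + k \<in> periodize A"
proof -
  assume "y \<in> periodize A" "k \<in> int_lattice"
  then obtain a l where "y = a + l" "a \<in> A" "l \<in> int_lattice" "l + k \<in> int_lattice"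
    by (auto simp: periodize_def intro: int_lattice_add)
  then have "y + k = a + (l + k) \<and> a \<in> A \<and> l + k \<in> int_lattice" by (simp add: add.assoc)
  then show ?thesis unfolding periodize_def by blast
qed

lemma periodize_add_iff: "k \<in> int_lattice \<Longrightarrow> y + k \<in> periodize A \<longleftrightarrow> y \<in> periodize A"
  using periodize_add[of y A k] periodize_add[of "y + k" A "- k"] int_lattice_minus[of k] by auto

text \<open>By separation, the points of the periodized set within \<open>\<epsilon> / 2\<close> of
  a given point all come from one translate, so a frontier point is already one of that
  translate.\<close>

lemma frontier_periodize_subset:
  fixes A :: "(real^'d) set"
  assumes "\<epsilon> > 0"
    and sep: "\<And>k. k \<in> int_lattice - {0} \<Longrightarrow> edist_sets A ((\<lambda>y. y + k) ` A) > ennreal \<epsilon>"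
  shows "frontier (periodize A) \<subseteq> periodize (frontier A)"
proof
  have far: "dist a (b + k) > \<epsilon>" if "a \<in> A" "b \<in> A" "k \<in> int_lattice - {0}" for a b k
  proof -
    have "edist_sets A ((\<lambda>y. y + k) ` A) \<le> ennreal (dist a (b + k))"
      unfolding edist_sets_def using that by (intro INF_lower2[of a] INF_lower2[of "b + k"]) auto
    with sep[OF that(3)] have "ennreal \<epsilon> < ennreal (dist a (b + k))" by (rule less_le_trans)
    then show ?thesis using \<open>\<epsilon> > 0\<close> by (simp add: ennreal_less_iff)
  qed
  fix x assume x: "x \<in> frontier (periodize A)"
  then have cl: "\<And>e. e > 0 \<Longrightarrow> \<exists>y\<in>periodize A. dist y x < e" and ni: "x \<notin> interior (periodize A)"
    by (auto simp: frontier_def closure_approachable)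
  obtain a0 k0 where 0: "a0 \<in> A" "k0 \<in> int_lattice" "dist (a0 + k0) x < \<epsilon> / 2"
    using cl[of "\<epsilon> / 2"] \<open>\<epsilon> > 0\<close> by (auto simp: periodize_def)
  have "x - k0 \<in> closure A"
    unfolding closure_approachable
  proof (intro allI impI)
    fix e :: real assume "e > 0"
    then obtain a k where ak: "a \<in> A" "k \<in> int_lattice" "dist (a + k) x < min e (\<epsilon> / 2)"
      using cl[of "min e (\<epsilon> / 2)"] \<open>\<epsilon> > 0\<close> by (auto simp: periodize_def)
    have "k = k0"
    proof (rule ccontr)
      assume "k \<noteq> k0"
      then have "\<epsilon> < dist a0 (a + (k - k0))"
        using ak 0 by (intro far) (auto intro: int_lattice_diff)
      also have "dist a0 (a + (k - k0)) = dist (a0 + k0) (a + k)"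
        by (simp add: dist_norm algebra_simps)
      also have "\<dots> \<le> dist (a0 + k0) x + dist (a + k) x" by (rule dist_triangle2)
      also have "\<dots> < \<epsilon>" using ak 0 by simp
      finally show False .
    qed
    then have "dist a (x - k0) < e"
      using ak by (simp add: dist_norm algebra_simps)
    then show "\<exists>y\<in>A. dist y (x - k0) < e" using ak by blast
  qed
  moreover have "x - k0 \<notin> interior A"
  proof
    assume i: "x - k0 \<in> interior A"
    have "open ((\<lambda>y. y + k0) ` interior A)"
      using open_translation[OF open_interior[of A], of k0] by (simp add: add.commute)
    moreover have "(\<lambda>y. y + k0) ` interior A \<subseteq> periodize A"
      using interior_subset 0(2) by (auto simp: periodize_def)
    moreover have "x \<in> (\<lambda>y. y + k0) ` interior A"
      using i by (intro image_eqI[of _ _ "x - k0"]) auto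
    ultimately show False using ni interior_maximal by blast
  qed
  ultimately have "x - k0 \<in> frontier A" by (simp add: frontier_def)
  then have "x = (x - k0) + k0 \<and> x - k0 \<in> frontier A \<and> k0 \<in> int_lattice" using 0(2) by simp
  then show "x \<in> periodize (frontier A)" unfolding periodize_def by blast
qed

text \<open>The segment between \<open>x\<close> and \<open>z\<close> joins \<open>S\<close> to its
  complement and so meets the frontier. \<open>B \<noteq> {}\<close> is part of the conclusion
  because \<open>infdist\<close> to the empty set is 0, which would make the bound void.\<close>

lemma infdist_frontier_le:
  fixes x :: "'a::euclidean_space"
  assumes "(x \<in> S) \<noteq> (z \<in> S)" "frontier S \<subseteq> B"
  shows "B \<noteq> {} \<and> infdist x B \<le> dist x z"
proof -
  have "closed_segment x z \<inter> frontier S \<noteq> {}"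
    using assms(1) by (intro connected_Int_frontier) auto
  then obtain w where w: "w \<in> closed_segment x z" "w \<in> frontier S" by auto
  have "infdist x B \<le> dist x w" using w assms(2) by (intro infdist_le) auto
  also have "\<dots> \<le> dist x z"
    using dist_in_closed_segment[OF w(1)] by (simp add: dist_commute)
  finally show ?thesis using w assms(2) by auto
qed

text \<open>Confines the extended reals to the case of empty boundary; otherwise the real valued,
  continuous \<open>infdist\<close> can be used.\<close>

lemma torus_boundary_dist_eq:
  "torus_boundary_dist x A = (if periodize (frontier A) = {} then \<infinity> else ennreal (infdist x (periodize (frontier A))))"
proof (cases "periodize (frontier A) = {}")
  case True
  then show ?thesis by (simp add: torus_boundary_dist_def edist_sets_def)
next
  case False
  let ?B = "periodize (frontier A)"
  have "(INF b\<in>?B. ennreal (dist x b)) = ennreal (infdist x ?B)"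
  proof (rule antisym)
    show "ennreal (infdist x ?B) \<le> (INF b\<in>?B. ennreal (dist x b))"
      by (intro INF_greatest ennreal_leI infdist_le)
    show "(INF b\<in>?B. ennreal (dist x b)) \<le> ennreal (infdist x ?B)"
    proof (rule ennreal_le_epsilon)
      fix e :: real assume "e > 0"
      then obtain b where b: "b \<in> ?B" "dist x b < infdist x ?B + e"
        using cINF_less_iff[OF False bdd_belowI2[of ?B 0 "dist x"], of "infdist x ?B + e"]
        by (auto simp: infdist_notempty[OF False])
      have "(INF b\<in>?B. ennreal (dist x b)) \<le> ennreal (dist x b)" using b by (intro INF_lower)
      also have "\<dots> \<le> ennreal (infdist x ?B + e)" using b by (intro ennreal_leI) simp
      also have "\<dots> = ennreal (infdist x ?B) + ennreal e"
        using \<open>e > 0\<close> by (intro ennreal_plus infdist_nonneg) auto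
      finally show "(INF b\<in>?B. ennreal (dist x b)) \<le> ennreal (infdist x ?B) + ennreal e" .
    qed
  qed
  then show ?thesis using False by (simp add: torus_boundary_dist_def edist_sets_def)
qed

lemma infdist_periodize_add:
  assumes k: "k \<in> int_lattice"
  shows "infdist (x + k) (periodize A) = infdist x (periodize A)"
proof (cases "periodize A = {}")
  case False
  have le: "infdist (y + l) (periodize A) \<le> infdist y (periodize A)" if "l \<in> int_lattice" for y l
    unfolding infdist_notempty[OF False, of y]
  proof (rule cINF_greatest[OF False])
    fix b assume "b \<in> periodize A"
    then have "infdist (y + l) (periodize A) \<le> dist (y + l) (b + l)"
      using that by (intro infdist_le periodize_add)
    then show "infdist (y + l) (periodize A) \<le> dist y b" by (simp add: dist_norm)
  qed
  show ?thesis
    using le[OF k, of x] le[OF int_lattice_minus[OF k], of "x + k"] by simp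
qed (simp add: infdist_def)

text \<open>The factors 2 and 4 in \<open>H_fun\<close> cancel against those in \<open>psi\<close>;
  an empty boundary gives infinite distance, where \<open>psi\<close> is 0.\<close>

lemma H_fun_eq:
  assumes "R > 0"
  shows "H_fun \<phi> A R x = (if periodize (frontier A) = {} then 0
    else gamma_const \<phi> * kernel_tail \<phi> (R * infdist x (periodize (frontier A))))"
proof -
  have "ennreal (2 * R) * ennreal (infdist x B) = ennreal (2 * R * infdist x B)" for B
    using assms by (simp add: ennreal_mult infdist_nonneg)
  then show ?thesis
    using assms by (simp add: H_fun_def psi_def torus_boundary_dist_eq ennreal_mult_top infdist_nonneg)
qed

section \<open>Passage from Lebesgue measurable to Borel sets\<close>

lemma AE_lborel_affine:
  fixes t :: "'a::euclidean_space"
  assumes P: "AE x in lborel. P x" and c: "c \<noteq> 0"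
  shows "AE x in lborel. P (t + c *\<^sub>R x)"
proof -
  obtain N where N: "{x. \<not> P x} \<subseteq> N" "N \<in> null_sets lborel"
    using P by (auto simp: eventually_ae_filter)
  then have [measurable]: "N \<in> sets borel" by auto
  have "AE x in lborel. x \<notin> N" using N(2) by (rule AE_not_in)
  then have "AE x in density (distr lborel borel (\<lambda>x::'a. t + c *\<^sub>R x)) (\<lambda>_. \<bar>c\<bar> ^ DIM('a)). x \<notin> N"
    by (rule subst[OF lborel_affine[OF c, of t], where P = "\<lambda>M. AE x in M. x \<notin> N"])
  then have "AE x in distr lborel borel (\<lambda>x::'a. t + c *\<^sub>R x). x \<notin> N"
    using c by (subst (asm) AE_density) auto
  then have "AE x in lborel. t + c *\<^sub>R x \<notin> N"
    by (subst (asm) AE_distr_iff) auto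
  then show ?thesis by eventually_elim (use N(1) in auto)
qed

text \<open>Fubini calls for a Borel function, but the Borel part \<open>E\<close> of
  \<open>S\<close> need not be periodic. Repeating its part in the cell restores periodicity, and
  the error stays within countably many translates of a null set.\<close>

lemma periodic_borel_version:
  fixes S :: "(real^'d) set"
  assumes S: "S \<in> sets lebesgue" and per: "\<And>x k. k \<in> int_lattice \<Longrightarrow> x + k \<in> S \<longleftrightarrow> x \<in> S"
  obtains S' where "S' \<in> sets borel" "lattice_periodic (indicat_real S')"
    "AE x in lborel. indicat_real S x = indicat_real S' x"
proof -
  obtain E N N' where E: "S = E \<union> N" "N \<subseteq> N'" "N' \<in> null_sets lborel" "E \<in> sets lborel"
    using S by (rule sets_completionE)
  have [measurable]: "N' \<in> sets borel" "E \<in> sets borel" using E by auto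
  define S' where "S' = {x. frac_vec x \<in> E}"
  show ?thesis
  proof (rule that)
    show "S' \<in> sets borel" unfolding S'_def by measurable
    show "lattice_periodic (indicat_real S')"
      by (simp add: lattice_periodic_def S'_def frac_vec_periodic indicator_def)
    have null: "(\<Union>k\<in>int_lattice. {x. x + k \<in> N'}) \<in> null_sets lborel"
    proof (rule null_sets_UN'[OF countable_int_lattice])
      fix k :: "real^'d"
      show "{x. x + k \<in> N'} \<in> null_sets lborel"
        using E(3) emeasure_translate[of N' k] by (intro null_setsI) auto
    qed
    show "AE x in lborel. indicat_real S x = indicat_real S' x"
      using AE_not_in[OF null]
    proof eventually_elim
      fix x assume x: "x \<notin> (\<Union>k\<in>int_lattice. {x. x + k \<in> N'})"
      have l: "frac_vec x - x \<in> int_lattice"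
        using int_lattice_minus[OF frac_vec_diff_lattice[of x]] by simp
      have "frac_vec x \<notin> N" using x l E(2) by fastforce
      moreover have "x \<in> S \<longleftrightarrow> frac_vec x \<in> S" using per[OF l, of x] by simp
      ultimately show "indicat_real S x = indicat_real S' x"
        by (simp add: S'_def E(1) indicator_def)
    qed
  qed
qed

lemma torus_fourier_eq_coeff:
  fixes f f' :: "real^'d \<Rightarrow> real"
  assumes f: "f \<in> borel_measurable lebesgue" and [measurable]: "f' \<in> borel_measurable borel"
    and eq: "AE x in lborel. f x = f' x"
  shows "torus_fourier f k = fourier_coeff f' k"
proof -
  have e: "exp (- (2 * complex_of_real pi * \<i> * complex_of_real (k \<bullet> x))) = echar (- k) x" for x
    by (simp add: echar_def cis_conv_exp mult_ac)
  have m: "(\<lambda>x. indicator unit_cell x *\<^sub>R (complex_of_real (f' x) * echar (- k) x)) \<in> borel_measurable lborel"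
    by measurable
  have [measurable]: "f \<in> borel_measurable (completion lborel)" "echar (- k) \<in> borel_measurable (completion lborel)"
      "unit_cell \<in> sets (completion lborel)" "f' \<in> borel_measurable (completion lborel)"
    using f by (auto intro!: measurable_completion)
  have "torus_fourier f k = (LINT x|lebesgue. indicator unit_cell x *\<^sub>R (complex_of_real (f x) * echar (- k) x))"
    by (simp add: torus_fourier_def e set_lebesgue_integral_def)
  also have "\<dots> = (LINT x|lebesgue. indicator unit_cell x *\<^sub>R (complex_of_real (f' x) * echar (- k) x))"
  proof (rule integral_cong_AE)
    show "AE x in lebesgue. indicator unit_cell x *\<^sub>R (complex_of_real (f x) * echar (- k) x) = indicator unit_cell x *\<^sub>R (complex_of_real (f' x) * echar (- k) x)"
      using AE_completion[OF eq] by eventually_elim simp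
  qed measurable
  also have "\<dots> = fourier_coeff f' k"
    using m by (simp add: integral_completion fourier_coeff_def set_lebesgue_integral_def)
  finally show ?thesis .
qed

lemma torus_fourier_indicator_0:
  assumes "S \<in> sets lebesgue"
  shows "torus_fourier (indicat_real S) 0 = complex_of_real (torus_measure S)"
proof -
  have "torus_fourier (indicat_real S) 0 = (LINT x|lebesgue. complex_of_real (indicat_real (S \<inter> unit_cell) x))"
    unfolding torus_fourier_def set_lebesgue_integral_def
    by (intro Bochner_Integration.integral_cong refl) (auto simp: indicator_def)
  also have "\<dots> = complex_of_real (measure lebesgue (S \<inter> unit_cell))"
    unfolding integral_complex_of_real by simp
  finally show ?thesis by (simp add: torus_measure_def)
qed

section \<open>The indicator compared with its mollification, and averages over the points\<close>

context radial_bump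
begin

lemma tail_set_integrable: "integrable lborel (\<lambda>x. indicator {x. t \<le> norm x} x * K x)"
  using integrable_mult_indicator[OF _ K_integrable, of "{x. t \<le> norm x}"] by simp

lemma kernel_tail_eq: "kernel_tail \<phi> t = (LINT x|lborel. indicator {x. t \<le> norm x} x * K x)"
  by (simp add: kernel_tail_def set_lebesgue_integral_def)

lemma kernel_tail_nonneg: "kernel_tail \<phi> t \<ge> 0"
  unfolding kernel_tail_eq by (intro Bochner_Integration.integral_nonneg) (simp add: K_nonneg)

lemma kernel_tail_antimono: "s \<le> t \<Longrightarrow> kernel_tail \<phi> t \<le> kernel_tail \<phi> s"
  unfolding kernel_tail_eq
  by (intro integral_mono tail_set_integrable) (auto simp: indicator_def K_nonneg)

lemma kernel_tail_le_1: "kernel_tail \<phi> t \<le> 1"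
  unfolding kernel_tail_eq K_integral[symmetric]
  by (intro integral_mono tail_set_integrable K_integrable) (auto simp: indicator_def K_nonneg)

lemma kernel_tail_measurable[measurable]: "kernel_tail \<phi> \<in> borel_measurable borel"
proof -
  have "mono (\<lambda>t. - kernel_tail \<phi> t)" by (intro monoI) (simp add: kernel_tail_antimono)
  then have "(\<lambda>t. - (- kernel_tail \<phi> t)) \<in> borel_measurable borel"
    by (intro borel_measurable_uminus borel_measurable_mono)
  then show ?thesis by simp
qed

lemma gamma_pos: "gamma_const \<phi> > 0"
  unfolding gamma_const_def using K_unit_ball_pos by simp

lemma H_measurable:
  assumes "R > 0"
  shows "H_fun \<phi> A R \<in> borel_measurable borel"
proof -
  have [measurable]: "(\<lambda>x. infdist x (periodize (frontier A))) \<in> borel_measurable borel"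
    by (intro borel_measurable_continuous_onI continuous_intros)
  show ?thesis
    unfolding H_fun_eq[OF assms] by measurable
qed

lemma H_bounded: "R > 0 \<Longrightarrow> \<bar>H_fun \<phi> A R x\<bar> \<le> gamma_const \<phi>"
  using gamma_pos kernel_tail_nonneg kernel_tail_le_1
  by (auto simp: H_fun_eq abs_mult intro!: mult_left_le)

lemma H_nonneg: "R > 0 \<Longrightarrow> H_fun \<phi> A R x \<ge> 0"
  using gamma_pos kernel_tail_nonneg by (simp add: H_fun_eq)

lemma H_periodic: "R > 0 \<Longrightarrow> lattice_periodic (H_fun \<phi> A R)"
  by (simp add: lattice_periodic_def H_fun_eq infdist_periodize_add)

text \<open>The constant \<open>\<gamma>\<close> is chosen so that this holds.\<close>

lemma kernel_tail_le_mollify_H: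
  assumes R: "R > 0" and B: "B = periodize (frontier A)" "B \<noteq> {}"
  shows "kernel_tail \<phi> (R * infdist x B) \<le> mollify R (H_fun \<phi> A R) x"
proof -
  let ?t = "R * infdist x B"
  let ?U = "{y::real^'d. norm y \<le> 1}"
  have t: "?t \<ge> 0" using R by (simp add: infdist_nonneg)
  have "kernel_tail \<phi> ?t \<le> exp (2 * pi) * kernel_tail \<phi> (?t + 1)"
    by (rule tail_shift[OF t])
  \<comment> \<open>The factor \<open>exp (2 * pi)\<close> of the tail shift is traded for
    \<open>gamma_const\<close> times the ball integral, which becomes the part of the convolution
    over \<open>norm y \<le> 1\<close>.\<close>
  also have "exp (2 * pi) = gamma_const \<phi> * (LINT y:?U|lborel. K y)"
    using K_unit_ball_pos by (simp add: gamma_const_def)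
  also have "gamma_const \<phi> * (LINT y:?U|lborel. K y) * kernel_tail \<phi> (?t + 1)
     = (LINT y|lborel. (indicator ?U y * K y) * (gamma_const \<phi> * kernel_tail \<phi> (?t + 1)))"
    by (simp add: set_lebesgue_integral_def)
  also have "\<dots> \<le> mollify R (H_fun \<phi> A R) x"
    unfolding mollify_def
  proof (rule integral_mono)
    show "integrable lborel (\<lambda>y. (indicator ?U y * K y) * (gamma_const \<phi> * kernel_tail \<phi> (?t + 1)))"
      using integrable_mult_indicator[OF _ K_integrable, of ?U] by (intro integrable_mult_left) simp
    show "integrable lborel (\<lambda>y. K y * H_fun \<phi> A R (x - y /\<^sub>R R))"
      by (rule mollify_integrable[OF H_measurable[OF R] H_bounded[OF R]])
    fix y
    show "(indicator ?U y * K y) * (gamma_const \<phi> * kernel_tail \<phi> (?t + 1)) \<le> K y * H_fun \<phi> A R (x - y /\<^sub>R R)"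
    proof (cases "norm y \<le> 1")
      case True
      \<comment> \<open>A displacement by \<open>y /\<^sub>R R\<close> with
        \<open>norm y \<le> 1\<close> changes \<open>R * infdist\<close> by at most 1, the amount by
        which the tail was shifted.\<close>
      have "infdist (x - y /\<^sub>R R) B \<le> infdist x B + dist (x - y /\<^sub>R R) x"
        by (rule infdist_triangle)
      also have "dist (x - y /\<^sub>R R) x = norm y / R"
        using R by (simp add: dist_norm divide_inverse)
      also have "\<dots> \<le> 1 / R" using True R by (simp add: divide_right_mono)
      finally have "R * infdist (x - y /\<^sub>R R) B \<le> R * (infdist x B + 1 / R)"
        using R by (intro mult_left_mono) auto
      also have "\<dots> = ?t + 1" using R by (simp add: distrib_left)
      finally have "kernel_tail \<phi> (?t + 1) \<le> kernel_tail \<phi> (R * infdist (x - y /\<^sub>R R) B)"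
        by (rule kernel_tail_antimono)
      then have "gamma_const \<phi> * kernel_tail \<phi> (?t + 1) \<le> H_fun \<phi> A R (x - y /\<^sub>R R)"
        using gamma_pos B by (simp add: H_fun_eq[OF R])
      then show ?thesis using True K_nonneg[of y] by (simp add: mult_left_mono)
    qed (simp add: K_nonneg H_nonneg[OF R])
  qed
  finally show ?thesis .
qed

text \<open>As \<open>K\<close> has mass 1, the difference is the integral of \<open>K y\<close>
  against the difference of the indicators at \<open>x\<close> and \<open>x - y /\<^sub>R R\<close>.
  It vanishes unless the frontier lies between them, which forces
  \<open>R * infdist \<le> norm y\<close>; so a tail integral bounds it. \<open>S'\<close> enters
  only under the integral: at \<open>x\<close> itself the value of \<open>S\<close> is kept, since
  the given points may lie in the exceptional null set.\<close>

lemma indicator_minus_mollify_le: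
  assumes R: "R > 0" and front: "frontier S \<subseteq> periodize (frontier A)"
    and [measurable]: "S' \<in> sets borel" and AE: "AE x in lborel. indicat_real S x = indicat_real S' x"
  shows "\<bar>indicat_real S x - mollify R (indicat_real S') x\<bar> \<le> mollify R (H_fun \<phi> A R) x"
proof -
  let ?B = "periodize (frontier A)"
  have int: "integrable lborel (\<lambda>y. K y * indicat_real S' (x - y /\<^sub>R R))"
    by (rule mollify_integrable[where B = 1]) auto
  have AE2: "AE y in lborel. indicat_real S (x - y /\<^sub>R R) = indicat_real S' (x - y /\<^sub>R R)"
    using AE_lborel_affine[OF AE, of "- inverse R" x] R by simp
  have "(LINT y|lborel. K y * indicat_real S x - K y * indicat_real S' (x - y /\<^sub>R R)) = indicat_real S x - mollify R (indicat_real S') x"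
    using int K_integrable K_integral by (simp add: mollify_def)
  then have eq: "\<bar>indicat_real S x - mollify R (indicat_real S') x\<bar> \<le>
      (LINT y|lborel. \<bar>K y * indicat_real S x - K y * indicat_real S' (x - y /\<^sub>R R)\<bar>)"
    using integral_norm_bound[of lborel "\<lambda>y. K y * indicat_real S x - K y * indicat_real S' (x - y /\<^sub>R R)"] by simp
  have i: "integrable lborel (\<lambda>y. \<bar>K y * indicat_real S x - K y * indicat_real S' (x - y /\<^sub>R R)\<bar>)"
    using int K_integrable by simp
  have cross: "?B \<noteq> {} \<and> R * infdist x ?B \<le> norm y" if "(x \<in> S) \<noteq> (x - y /\<^sub>R R \<in> S)" for y
  proof -
    from infdist_frontier_le[OF that front]
    have "?B \<noteq> {}" "infdist x ?B \<le> norm y / R"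
      using R by (auto simp: dist_norm divide_inverse mult.commute)
    then show ?thesis using R by (simp add: pos_le_divide_eq mult.commute)
  qed
  show ?thesis
  proof (cases "?B = {}")
    \<comment> \<open>Here \<open>S\<close> is empty or the whole space and \<open>H_fun\<close> is
      0, so the difference has to vanish exactly.\<close>
    case True
    have "(LINT y|lborel. \<bar>K y * indicat_real S x - K y * indicat_real S' (x - y /\<^sub>R R)\<bar>) \<le> (LINT y::real^'d|lborel. 0)"
    proof (rule integral_mono_AE[OF i])
      show "AE y in lborel. \<bar>K y * indicat_real S x - K y * indicat_real S' (x - y /\<^sub>R R)\<bar> \<le> 0"
        using AE2
      proof eventually_elim
        fix y assume "indicat_real S (x - y /\<^sub>R R) = indicat_real S' (x - y /\<^sub>R R)"
        then show "\<bar>K y * indicat_real S x - K y * indicat_real S' (x - y /\<^sub>R R)\<bar> \<le> 0"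
          using cross[of y] True by (auto simp: indicator_def)
      qed
    qed simp
    then show ?thesis
      using eq True by (simp add: mollify_def H_fun_eq[OF R])
  next
    case False
    have "(LINT y|lborel. \<bar>K y * indicat_real S x - K y * indicat_real S' (x - y /\<^sub>R R)\<bar>) \<le> kernel_tail \<phi> (R * infdist x ?B)"
      unfolding kernel_tail_eq
    proof (rule integral_mono_AE[OF i tail_set_integrable])
      show "AE y in lborel. \<bar>K y * indicat_real S x - K y * indicat_real S' (x - y /\<^sub>R R)\<bar> \<le> indicator {y. R * infdist x ?B \<le> norm y} y * K y"
        using AE2
      proof eventually_elim
        fix y assume a: "indicat_real S (x - y /\<^sub>R R) = indicat_real S' (x - y /\<^sub>R R)"
        have "\<bar>K y * indicat_real S x - K y * indicat_real S' (x - y /\<^sub>R R)\<bar> = K y * \<bar>indicat_real S x - indicat_real S (x - y /\<^sub>R R)\<bar>"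
          unfolding a[symmetric] using K_nonneg[of y] by (simp add: abs_mult flip: right_diff_distrib)
        also have "\<dots> \<le> K y * indicator {y. R * infdist x ?B \<le> norm y} y"
          using cross[of y] K_nonneg[of y]
          by (cases "(x \<in> S) = (x - y /\<^sub>R R \<in> S)") (auto simp: indicator_def)
        finally show "\<bar>K y * indicat_real S x - K y * indicat_real S' (x - y /\<^sub>R R)\<bar> \<le> indicator {y. R * infdist x ?B \<le> norm y} y * K y"
          by (simp add: mult.commute)
      qed
    qed
    also have "\<dots> \<le> mollify R (H_fun \<phi> A R) x"
      using R False by (intro kernel_tail_le_mollify_H) auto
    finally show ?thesis using eq by simp
  qed
qed

text \<open>The multipliers have modulus at most 1 and the one at frequency 0 equals 1, so the
  zeroth coefficient is reproduced exactly while the others can only shrink. Applied to both the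
  indicator and \<open>H_fun\<close>.\<close>

lemma average_mollify:
  assumes f: "f \<in> borel_measurable borel" and B: "\<And>x. \<bar>f x\<bar> \<le> B" and R: "R > 0"
    and per: "lattice_periodic f" and m: "m \<ge> 1"
  shows "cmod (complex_of_real (inverse (real m) * (\<Sum>j=1..m. mollify R f (x j))) - fourier_coeff f 0)
    \<le> (\<Sum>k | k \<in> int_lattice \<and> 0 < norm k \<and> norm k < R.
        cmod (fourier_coeff f k) * cmod (complex_of_real (inverse (real m)) * (\<Sum>j=1..m. echar k (x j))))"
proof -
  let ?S = "{k::real^'d. k \<in> int_lattice \<and> norm k < R}"
  let ?Z = "{k::real^'d. k \<in> int_lattice \<and> 0 < norm k \<and> norm k < R}"
  define w where "w k = complex_of_real (kernel_weight \<phi> (k /\<^sub>R R))" for k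
  define e where "e k = complex_of_real (inverse (real m)) * (\<Sum>j=1..m. echar k (x j))" for k
  have S: "finite ?S" by (rule finite_int_lattice_norm_less)
  have SS: "?S = insert 0 ?Z" using R int_lattice_zero by auto
  have S0: "finite ?Z" using S by (rule rev_finite_subset) auto
  have "complex_of_real (inverse (real m) * (\<Sum>j=1..m. mollify R f (x j)))
     = complex_of_real (inverse (real m)) * (\<Sum>j=1..m. \<Sum>k\<in>?S. w k * fourier_coeff f k * echar k (x j))"
    by (simp add: mollify_eq_trig_poly[OF f B R per] w_def)
  also have "\<dots> = (\<Sum>k\<in>?S. w k * fourier_coeff f k * e k)"
    unfolding e_def by (subst sum.swap) (simp add: sum_distrib_left mult_ac)
  also have "\<dots> = w 0 * fourier_coeff f 0 * e 0 + (\<Sum>k\<in>?Z. w k * fourier_coeff f k * e k)"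
    unfolding SS by (subst sum.insert) (use S0 in auto)
  also have "w 0 * fourier_coeff f 0 * e 0 = fourier_coeff f 0"
    using m by (simp add: w_def e_def kernel_weight_0)
  finally have "complex_of_real (inverse (real m) * (\<Sum>j=1..m. mollify R f (x j))) - fourier_coeff f 0
     = (\<Sum>k\<in>?Z. w k * fourier_coeff f k * e k)" by simp
  also have "cmod \<dots> \<le> (\<Sum>k\<in>?Z. cmod (fourier_coeff f k) * cmod (e k))"
  proof (rule sum_norm_le)
    fix k
    have "cmod (w k) \<le> 1" by (simp add: w_def kernel_weight_le_1)
    then have "cmod (w k) * (cmod (fourier_coeff f k) * cmod (e k)) \<le> 1 * (cmod (fourier_coeff f k) * cmod (e k))"
      by (intro mult_right_mono) auto
    then show "cmod (w k * fourier_coeff f k * e k) \<le> cmod (fourier_coeff f k) * cmod (e k)"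
      by (simp add: norm_mult mult.assoc)
  qed
  finally show ?thesis by (simp add: e_def)
qed

end

theorem theorem9:
  fixes \<phi> :: "real^'d \<Rightarrow> real"
    and \<Omega>\<^sub>0 \<Omega> :: "(real^'d) set"
    and x :: "nat \<Rightarrow> real^'d"
    and m :: nat
    and R \<epsilon> :: real
  assumes "smooth \<phi>"
    and "radial \<phi>"
    and "\<And>\<xi>. norm \<xi> \<ge> 1/2 \<Longrightarrow> \<phi> \<xi> = 0"
    and "(LINT \<xi>|lborel. (\<phi> \<xi>)\<^sup>2) = 1"
    and "\<epsilon> > 0"
    and "\<And>k. k \<in> int_lattice - {0} \<Longrightarrow> edist_sets \<Omega>\<^sub>0 ((\<lambda>y. y + k) ` \<Omega>\<^sub>0) > ennreal \<epsilon>"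
    and "\<Omega> = periodize \<Omega>\<^sub>0"
    and "\<Omega> \<in> sets lebesgue"
    and "R > 0"
    and "m \<ge> 1"
  shows "\<bar>torus_measure \<Omega> - inverse (real m) * (\<Sum>j=1..m. indicat_real \<Omega> (x j))\<bar>
    \<le> cmod (torus_fourier (H_fun \<phi> \<Omega>\<^sub>0 R) 0)
      + (\<Sum>k | k \<in> int_lattice \<and> 0 < norm k \<and> norm k < R.
          (cmod (torus_fourier (indicat_real \<Omega>) k) + cmod (torus_fourier (H_fun \<phi> \<Omega>\<^sub>0 R) k))
          * cmod (complex_of_real (inverse (real m)) * (\<Sum>j=1..m. exp (2 * pi * \<i> * (k \<bullet> x j)))))"
proof -
  interpret radial_bump \<phi>
  proof
    show "continuous_on UNIV \<phi>" using assms(1) unfolding smooth_def by (metis C_k.simps(1))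
  qed (use assms in auto)
  let ?H = "H_fun \<phi> \<Omega>\<^sub>0 R"
  have per: "y + k \<in> \<Omega> \<longleftrightarrow> y \<in> \<Omega>" if "k \<in> int_lattice" for y k
    using that unfolding assms(7) by (rule periodize_add_iff)
  obtain S' where S': "S' \<in> sets borel" "lattice_periodic (indicat_real S')"
    "AE y in lborel. indicat_real \<Omega> y = indicat_real S' y"
    using periodic_borel_version[OF assms(8) per] by blast
  have front: "frontier \<Omega> \<subseteq> periodize (frontier \<Omega>\<^sub>0)"
    unfolding assms(7) using assms(5,6) by (rule frontier_periodize_subset)
  define e where "e k = cmod (complex_of_real (inverse (real m)) * (\<Sum>j=1..m. exp (2 * pi * \<i> * (k \<bullet> x j))))" for k
  have e: "e k = cmod (complex_of_real (inverse (real m)) * (\<Sum>j=1..m. echar k (x j)))" for k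
    unfolding e_def by (simp add: echar_def cis_conv_exp mult_ac)
  have Hm: "?H \<in> borel_measurable borel" by (rule H_measurable[OF assms(9)])
  have fH: "torus_fourier ?H k = fourier_coeff ?H k" for k
    by (rule torus_fourier_eq_coeff) (use Hm in \<open>auto intro: measurable_completion\<close>)
  have fS: "torus_fourier (indicat_real \<Omega>) k = fourier_coeff (indicat_real S') k" for k
    by (rule torus_fourier_eq_coeff) (use S' assms(8) in auto)
  let ?Z = "{k::real^'d. k \<in> int_lattice \<and> 0 < norm k \<and> norm k < R}"
  define avg where "avg f = inverse (real m) * (\<Sum>j=1..m. f (x j))" for f :: "real^'d \<Rightarrow> real"
  \<comment> \<open>The zeroth coefficient of the indicator is the measure itself, so only nonzero
    frequencies remain.\<close>
  have \<mu>: "\<bar>avg (mollify R (indicat_real S')) - torus_measure \<Omega>\<bar> \<le> (\<Sum>k\<in>?Z. cmod (torus_fourier (indicat_real \<Omega>) k) * e k)"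
  proof -
    have "cmod (complex_of_real (avg (mollify R (indicat_real S'))) - fourier_coeff (indicat_real S') 0)
      \<le> (\<Sum>k\<in>?Z. cmod (fourier_coeff (indicat_real S') k) * e k)"
      unfolding avg_def e
      by (rule average_mollify[where B = 1]) (use S' assms(9,10) in auto)
    then show ?thesis
      unfolding fS[symmetric] torus_fourier_indicator_0[OF assms(8)] of_real_diff[symmetric] norm_of_real by simp
  qed
  \<comment> \<open>Here the zeroth coefficient is not subtracted; it becomes the first term of the
    bound.\<close>
  have Q: "avg (mollify R ?H) \<le> cmod (torus_fourier ?H 0) + (\<Sum>k\<in>?Z. cmod (torus_fourier ?H k) * e k)"
  proof -
    have "cmod (complex_of_real (avg (mollify R ?H)) - fourier_coeff ?H 0) \<le> (\<Sum>k\<in>?Z. cmod (fourier_coeff ?H k) * e k)"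
      unfolding avg_def e
      by (rule average_mollify[OF Hm H_bounded[OF assms(9)] assms(9) H_periodic[OF assms(9)] assms(10)])
    moreover have "avg (mollify R ?H) \<le> cmod (complex_of_real (avg (mollify R ?H)))" by simp
    moreover have "\<dots> \<le> cmod (fourier_coeff ?H 0) + cmod (complex_of_real (avg (mollify R ?H)) - fourier_coeff ?H 0)"
      by (rule norm_triangle_sub)
    ultimately show ?thesis unfolding fH by linarith
  qed
  have "\<bar>avg (indicat_real \<Omega>) - avg (mollify R (indicat_real S'))\<bar>
     = inverse (real m) * \<bar>\<Sum>j=1..m. indicat_real \<Omega> (x j) - mollify R (indicat_real S') (x j)\<bar>"
    unfolding avg_def by (simp add: sum_subtractf abs_mult flip: right_diff_distrib)
  also have "\<dots> \<le> avg (mollify R ?H)"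
    unfolding avg_def
    by (intro mult_left_mono order_trans[OF sum_abs sum_mono]
        indicator_minus_mollify_le[OF assms(9) front S'(1,3)]) auto
  finally have "\<bar>torus_measure \<Omega> - avg (indicat_real \<Omega>)\<bar> \<le>
     (\<Sum>k\<in>?Z. cmod (torus_fourier (indicat_real \<Omega>) k) * e k) + (cmod (torus_fourier ?H 0) + (\<Sum>k\<in>?Z. cmod (torus_fourier ?H k) * e k))"
    using \<mu> Q by linarith
  also have "\<dots> = cmod (torus_fourier ?H 0) + (\<Sum>k\<in>?Z. (cmod (torus_fourier (indicat_real \<Omega>) k) + cmod (torus_fourier ?H k)) * e k)"
    by (simp add: distrib_right sum.distrib)
  finally show ?thesis unfolding avg_def e_def .
qed

end
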